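(* Let $(X_t)_{t\ge 0}$ be an absorbed Markov process on $E\cup\{\partial\}$ with quasi-stationary distribution $\alpha$, rate $\lambda_0$ and right eigenfunction $\eta$, as described in the context, and assume the following: there exist a function $\psi_1:E\to[1,+\infty)$ with $\alpha(\psi_1)<+\infty$ and $\eta\in\mathbb{L}^\infty(\psi_1)$, and two constants $C,\gamma>0$ such that, for all $\mu\in\mathcal{M}_1(E)$ and all $t\ge 0$, $$\|e^{\lambda_0 t}\mu P_t-\mu(\eta)\alpha\|_{\psi_1}\le C\,\mu(\psi_1)\,e^{-\gamma t}.$$ For a bounded measurable function $f:E\to\mathbb{R}$ set $$\sigma_f^2:=2\int_0^\infty \mathbf{Cov}^{\mathbb{Q}}_\beta\big(f(X_0),f(X_s)\big)\,ds .$$ Then, for every bounded measurable $f:E\to\mathbb{R}$ such that $\sigma_f^2>0$ and every $\mu\in\mathcal{M}_1(E)$ such that $\mu(\psi_1)<+\infty$ and $\mu(\eta)>0$, $$\mathbb{P}_\mu\left(\sqrt t\left[\frac1t\int_0^t f(X_s)\,ds-\beta(f)\right]\in\cdot\ \middle|\ \tau_\partial>t\right)\longrightarrow \mathcal{N}(0,\sigma_f^2)\qquad (t\to+\infty)$$ weakly as probability measures on $\mathbb{R}$, where $\mathcal{N}(0,\sigma_f^2)$ is the centered Gaussian law with variance $\sigma_f^2$.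
   Context: Setting. $(X_t)_{t\ge0}$ is a time-homogeneous continuous-time Markov process (with respect to its natural filtration $(\mathcal{F}_t)_{t\ge0}$) on a state space $E\cup\{\partial\}$, where $\partial\notin E$ is absorbing and $\mathcal{E}$ is the $\sigma$-field associated with $E$. $E$ and the sample paths are equipped with appropriate $\sigma$-fields so that time integrals $\int_0^t f(X_s)ds$ of bounded measurable $f$ make sense (e.g. $(s,\omega)\mapsto X_s(\omega)$ jointly measurable; typically $E$ is Polish and $X$ is càdlàg). $\tau_\partial$ is the hitting time of $\partial$. $\mathbb{P}_x$ is the law of the process with $\mathbb{P}_x[X_0=x]=1$, $\mathbb{P}_\mu:=\int\mu(dx)\mathbb{P}_x$, and $\mathbb{E}_x,\mathbb{E}_\mu$ are the corresponding expectations. $\mathcal{M}_1(E)$ is the set of probability measures on $E$, and $\mu(f):=\int_E f\,d\mu$. Semigroup: $P_tf(x):=\mathbb{E}_x(f(X_t)\mathbf{1}_{\tau_\partial>t})$ and $\mu P_t:=\mathbb{P}_\mu(X_t\in\cdot,\tau_\partial>t)$. Norms: for a positive function $\psi$, $\mathbb{L}^\infty(\psi)$ is the set of (measurable) functions $f$ with $f/\psi$ bounded, with norm $\|f\|_{\mathbb{L}^\infty(\psi)}:=\|f/\psi\|_\infty$; for (finite) measures, $\|\mu-\nu\|_\psi:=\sup_{\|f\|_{\mathbb{L}^\infty(\psi)}\le1}|\mu(f)-\nu(f)|$. Standing assumptions: $X$ admits a quasi-stationary distribution, i.e. $\alpha\in\mathcal{M}_1(E)$ with $\mathbb{P}_\alpha[X_t\in\cdot\mid\tau_\partial>t]=\alpha$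 for all $t\ge0$; $\lambda_0:=-\log\mathbb{P}_\alpha[\tau_\partial>1]$ (so $\mathbb{P}_\alpha[\tau_\partial>t]=e^{-\lambda_0t}$ for all $t\ge 0$). There is a nonnegative function $\eta$ on $E$, vanishing at $\partial$, with $\alpha(\eta)=1$ and $\mathbb{E}_x[\eta(X_t)\mathbf{1}_{\tau_\partial>t}]=e^{-\lambda_0t}\eta(x)$ for all $x\in E$, $t\ge0$. $Q$-process: let $E':=\{x\in E:\eta(x)>0\}$. For $x\in E'$, $t\ge0$ and $\Gamma\in\mathcal{F}_t$, $\mathbb{Q}_x(\Gamma):=\lim_{T\to\infty}\mathbb{P}_x(\Gamma\mid\tau_\partial>T)$; under the assumption of the theorem this is well defined and $X$ under $(\mathbb{Q}_x)_{x\in E'}$ is a Markov process on $E'$ with invariant probability measure $\beta(dx):=\eta(x)\alpha(dx)$. $\mathbb{Q}_\beta:=\int_{E'}\beta(dx)\mathbb{Q}_x$, and $\mathbf{Cov}^{\mathbb{Q}}_\beta$ is the covariance under $\mathbb{Q}_\beta$. *)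

theory Defs
  imports "HOL-Probability.Probability"
begin

section \<open>Absorbed Markov processes\<close>

text \<open>
  The state space with cemetery is a measurable space \<open>S\<close> with a distinguished measurable point
  \<open>cem\<close>; the state space \<open>E\<close> without it is \<open>live S cem\<close>.
\<close>

definition live :: "'a measure \<Rightarrow> 'a \<Rightarrow> 'a measure" where
  "live S cem = restrict_space S (space S - {cem})"

definition hitting_time :: "(real \<Rightarrow> 'w \<Rightarrow> 'a) \<Rightarrow> 'a \<Rightarrow> 'w \<Rightarrow> ereal" where
  "hitting_time X cem \<omega> = Inf (ereal ` {t. 0 \<le> t \<and> X t \<omega> = cem})"

definition survival :: "'w measure \<Rightarrow> 'a \<Rightarrow> (real \<Rightarrow> 'w \<Rightarrow> 'a) \<Rightarrow> real \<Rightarrow> 'w set" where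
  "survival \<Omega> cem X t = {\<omega> \<in> space \<Omega>. ereal t < hitting_time X cem \<omega>}"

definition natural_filtration ::
    "'w measure \<Rightarrow> 'a measure \<Rightarrow> (real \<Rightarrow> 'w \<Rightarrow> 'a) \<Rightarrow> real \<Rightarrow> 'w measure" where
  "natural_filtration \<Omega> S X t =
     sigma (space \<Omega>) {X s -` A \<inter> space \<Omega> | s A. 0 \<le> s \<and> s \<le> t \<and> A \<in> sets S}"

text \<open>
  Only the space and the \<open>\<sigma>\<close>-algebra of \<open>\<Omega>\<close> matter; \<open>P x\<close> is the law of the process started at
  \<open>x\<close>. Absorption is required almost surely, so measurability of the hitting time is a separate
  assumption (it follows from joint measurability if absorption holds for every path).
\<close>

locale absorbed_markov_process =
  fixes \<Omega> :: "'w measure"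
    and S :: "'a measure"
    and cem :: 'a
    and X :: "real \<Rightarrow> 'w \<Rightarrow> 'a"
    and P :: "'a \<Rightarrow> 'w measure"
  assumes cem_in_space: "cem \<in> space S"
    and cem_measurable: "{cem} \<in> sets S"
    and jointly_measurable:
      "(\<lambda>(s, \<omega>). X s \<omega>) \<in> restrict_space borel {0..} \<Otimes>\<^sub>M \<Omega> \<rightarrow>\<^sub>M S"
    and kernel: "P \<in> S \<rightarrow>\<^sub>M prob_algebra \<Omega>"
    and start: "x \<in> space S \<Longrightarrow> AE \<omega> in P x. X 0 \<omega> = x"
    and markov:
      "x \<in> space S \<Longrightarrow> 0 \<le> s \<Longrightarrow> 0 \<le> t \<Longrightarrow> \<Gamma> \<in> sets (natural_filtration \<Omega> S X s) \<Longrightarrow>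
       A \<in> sets S \<Longrightarrow>
       emeasure (P x) (\<Gamma> \<inter> (X (s + t) -` A \<inter> space \<Omega>)) =
       (\<integral>\<^sup>+\<omega>\<in>\<Gamma>. emeasure (P (X s \<omega>)) (X t -` A \<inter> space \<Omega>) \<partial>P x)"
    and absorbing:
      "x \<in> space S \<Longrightarrow> AE \<omega> in P x. \<forall>s t. 0 \<le> s \<and> s \<le> t \<and> X s \<omega> = cem \<longrightarrow> X t \<omega> = cem"
    and hitting_time_measurable: "hitting_time X cem \<in> borel_measurable \<Omega>"

text \<open>
  For an initial law \<open>\<mu>\<close> the law of the process is \<open>\<mu> \<bind> P\<close>. On \<open>survival \<Omega> cem X t\<close> the
  map \<open>X t\<close> takes values in \<open>live S cem\<close>, so the following is the finite measure \<open>\<mu> P\<^sub>t\<close> on \<open>E\<close>.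
\<close>

definition killed_law ::
    "'w measure \<Rightarrow> 'a measure \<Rightarrow> 'a \<Rightarrow> (real \<Rightarrow> 'w \<Rightarrow> 'a) \<Rightarrow> ('a \<Rightarrow> 'w measure) \<Rightarrow>
     'a measure \<Rightarrow> real \<Rightarrow> 'a measure" where
  "killed_law \<Omega> S cem X P \<mu> t =
     distr (restrict_space (\<mu> \<bind> P) (survival \<Omega> cem X t)) (live S cem) (X t)"

definition quasi_stationary ::
    "'a measure \<Rightarrow> 'a \<Rightarrow> (real \<Rightarrow> 'w \<Rightarrow> 'a) \<Rightarrow> ('a \<Rightarrow> 'w measure) \<Rightarrow> 'a measure \<Rightarrow> bool" where
  "quasi_stationary S cem X P \<alpha> \<longleftrightarrow>
     \<alpha> \<in> space (prob_algebra (live S cem)) \<and>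
     (\<forall>t\<ge>0. \<forall>A\<in>sets (live S cem).
        \<P>(\<omega> in \<alpha> \<bind> P. X t \<omega> \<in> A \<bar> ereal t < hitting_time X cem \<omega>) = measure \<alpha> A)"

definition absorption_rate ::
    "'w measure \<Rightarrow> 'a \<Rightarrow> (real \<Rightarrow> 'w \<Rightarrow> 'a) \<Rightarrow> ('a \<Rightarrow> 'w measure) \<Rightarrow> 'a measure \<Rightarrow> real" where
  "absorption_rate \<Omega> cem X P \<alpha> = - ln (measure (\<alpha> \<bind> P) (survival \<Omega> cem X 1))"

definition right_eigenfunction ::
    "'w measure \<Rightarrow> 'a measure \<Rightarrow> 'a \<Rightarrow> (real \<Rightarrow> 'w \<Rightarrow> 'a) \<Rightarrow> ('a \<Rightarrow> 'w measure) \<Rightarrow>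
     'a measure \<Rightarrow> real \<Rightarrow> ('a \<Rightarrow> real) \<Rightarrow> bool" where
  "right_eigenfunction \<Omega> S cem X P \<alpha> rate \<eta> \<longleftrightarrow>
     \<eta> \<in> borel_measurable (live S cem) \<and>
     (\<forall>x\<in>space (live S cem). 0 \<le> \<eta> x) \<and>
     \<eta> cem = 0 \<and>
     (\<integral>\<^sup>+x. \<eta> x \<partial>\<alpha>) = 1 \<and>
     (\<forall>x\<in>space (live S cem). \<forall>t\<ge>0.
        (\<integral>\<^sup>+\<omega>\<in>survival \<Omega> cem X t. \<eta> (X t \<omega>) \<partial>P x) = ennreal (exp (- rate * t) * \<eta> x))"

section \<open>Weighted norms\<close>

definition Linf_norm :: "'a measure \<Rightarrow> ('a \<Rightarrow> real) \<Rightarrow> ('a \<Rightarrow> real) \<Rightarrow> ennreal" where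
  "Linf_norm M \<psi> f = (SUP x\<in>space M. ennreal \<bar>f x / \<psi> x\<bar>)"

definition Linf :: "'a measure \<Rightarrow> ('a \<Rightarrow> real) \<Rightarrow> ('a \<Rightarrow> real) set" where
  "Linf M \<psi> = {f \<in> borel_measurable M. Linf_norm M \<psi> f < \<infinity>}"

text \<open>
  The supremum ranges over those \<open>g\<close> in the unit ball for which both integrals exist; the Bochner
  integral of a non-integrable function is \<open>0\<close>, so without this restriction an infinite distance
  could be reported as finite. By truncation the value is \<open>\<infinity>\<close> whenever exactly one of the two
  measures has infinite \<open>\<psi>\<close>-moment.
\<close>

definition weighted_dist ::
    "'a measure \<Rightarrow> ('a \<Rightarrow> real) \<Rightarrow> 'a measure \<Rightarrow> 'a measure \<Rightarrow> ennreal" where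
  "weighted_dist M \<psi> \<mu> \<nu> =
     (SUP g\<in>{g \<in> Linf M \<psi>. Linf_norm M \<psi> g \<le> 1 \<and> integrable \<mu> g \<and> integrable \<nu> g}.
        ennreal \<bar>(\<integral>x. g x \<partial>\<mu>) - (\<integral>x. g x \<partial>\<nu>)\<bar>)"

section \<open>The Q-process\<close>

text \<open>
  The law \<open>\<Q>\<^sub>x\<close> is given by a limit on each \<open>\<F>\<^sub>s\<close> separately, so it is represented by the family of
  its restrictions to \<open>\<F>\<^sub>s\<close>; no extension to the full \<open>\<sigma>\<close>-algebra is needed. If the set function is
  not a measure on \<open>\<F>\<^sub>s\<close>, then \<^const>\<open>measure_of\<close> yields the zero measure.
\<close>

definition Q_law ::
    "'w measure \<Rightarrow> 'a measure \<Rightarrow> 'a \<Rightarrow> (real \<Rightarrow> 'w \<Rightarrow> 'a) \<Rightarrow> ('a \<Rightarrow> 'w measure) \<Rightarrow>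
     real \<Rightarrow> 'a \<Rightarrow> 'w measure" where
  "Q_law \<Omega> S cem X P s x =
     measure_of (space \<Omega>) (sets (natural_filtration \<Omega> S X s))
       (\<lambda>\<Gamma>. ennreal (Lim at_top
          (\<lambda>T. \<P>(\<omega> in P x. \<omega> \<in> \<Gamma> \<bar> ereal T < hitting_time X cem \<omega>))))"

definition beta_measure :: "('a \<Rightarrow> real) \<Rightarrow> 'a measure \<Rightarrow> 'a measure" where
  "beta_measure \<eta> \<alpha> = density \<alpha> (\<lambda>x. ennreal (\<eta> x))"

definition Q_beta ::
    "'w measure \<Rightarrow> 'a measure \<Rightarrow> 'a \<Rightarrow> (real \<Rightarrow> 'w \<Rightarrow> 'a) \<Rightarrow> ('a \<Rightarrow> 'w measure) \<Rightarrow>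
     'a measure \<Rightarrow> ('a \<Rightarrow> real) \<Rightarrow> real \<Rightarrow> 'w measure" where
  "Q_beta \<Omega> S cem X P \<alpha> \<eta> s =
     restrict_space (beta_measure \<eta> \<alpha>) {x \<in> space (live S cem). 0 < \<eta> x} \<bind>
       Q_law \<Omega> S cem X P s"

definition covariance :: "'w measure \<Rightarrow> ('w \<Rightarrow> real) \<Rightarrow> ('w \<Rightarrow> real) \<Rightarrow> real" where
  "covariance M U V =
     (\<integral>\<omega>. (U \<omega> - (\<integral>\<omega>'. U \<omega>' \<partial>M)) * (V \<omega> - (\<integral>\<omega>'. V \<omega>' \<partial>M)) \<partial>M)"

definition asymptotic_variance ::
    "'w measure \<Rightarrow> 'a measure \<Rightarrow> 'a \<Rightarrow> (real \<Rightarrow> 'w \<Rightarrow> 'a) \<Rightarrow> ('a \<Rightarrow> 'w measure) \<Rightarrow>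
     'a measure \<Rightarrow> ('a \<Rightarrow> real) \<Rightarrow> ('a \<Rightarrow> real) \<Rightarrow> real" where
  "asymptotic_variance \<Omega> S cem X P \<alpha> \<eta> f =
     2 * (LINT s:{0..}|lborel.
       covariance (Q_beta \<Omega> S cem X P \<alpha> \<eta> s) (\<lambda>\<omega>. f (X 0 \<omega>)) (\<lambda>\<omega>. f (X s \<omega>)))"

section \<open>Conditional fluctuations and weak convergence\<close>

definition conditional_fluctuation_law ::
    "'w measure \<Rightarrow> 'a \<Rightarrow> (real \<Rightarrow> 'w \<Rightarrow> 'a) \<Rightarrow> ('a \<Rightarrow> 'w measure) \<Rightarrow>
     'a measure \<Rightarrow> ('a \<Rightarrow> real) \<Rightarrow> ('a \<Rightarrow> real) \<Rightarrow> 'a measure \<Rightarrow> real \<Rightarrow> real measure" where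
  "conditional_fluctuation_law \<Omega> cem X P \<alpha> \<eta> f \<mu> t =
     distr (uniform_measure (\<mu> \<bind> P) (survival \<Omega> cem X t)) borel
       (\<lambda>\<omega>. sqrt t * (1 / t * (LINT s:{0..t}|lborel. f (X s \<omega>)) -
          (\<integral>x. f x \<partial>beta_measure \<eta> \<alpha>)))"

text \<open>
  Weak convergence along an arbitrary filter; \<^const>\<open>weak_conv_m\<close> only covers sequences.
\<close>

definition weakly_converges ::
    "('i \<Rightarrow> real measure) \<Rightarrow> real measure \<Rightarrow> 'i filter \<Rightarrow> bool" where
  "weakly_converges L N F \<longleftrightarrow>
     (\<forall>g :: real \<Rightarrow> real. continuous_on UNIV g \<and> bounded (range g) \<longrightarrow>
        ((\<lambda>i. \<integral>y. g y \<partial>L i) \<longlongrightarrow> (\<integral>y. g y \<partial>N)) F)"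

lemma weakly_converges_sequentially_iff:
  assumes "\<And>n. real_distribution (L n)" "real_distribution N"
  shows "weakly_converges L N sequentially \<longleftrightarrow> weak_conv_m L N"
proof
  assume "weakly_converges L N sequentially"
  then show "weak_conv_m L N"
    using assms unfolding weakly_converges_def
    by (intro integral_bdd_continuous_conv_imp_weak_conv)
       (auto simp: continuous_on_eq_continuous_at bounded_iff)
next
  assume *: "weak_conv_m L N"
  show "weakly_converges L N sequentially"
    unfolding weakly_converges_def
  proof (intro allI impI)
    fix g :: "real \<Rightarrow> real"
    assume g: "continuous_on UNIV g \<and> bounded (range g)"
    then obtain B where "\<And>x. norm (g x) \<le> B"
      by (auto simp: bounded_iff)
    with g show "(\<lambda>n. \<integral>y. g y \<partial>L n) \<longlonglongrightarrow> (\<integral>y. g y \<partial>N)"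
      using weak_conv_imp_integral_bdd_continuous_conv[OF assms *, of g B]
      by (auto simp: continuous_on_eq_continuous_at)
  qed
qed

end

theory Submission
  imports Defs
begin

text \<open>
  Write \<open>R\<^sub>t g(x) = exp(\<lambda>\<^sub>0 t) E\<^sub>x[g(X\<^sub>t); t < \<tau>]\<close> for the rescaled semigroup of the killed process. The
  assumption says that, exponentially fast on \<open>L\<^sup>\<infinity>(\<psi>\<^sub>1)\<close>, \<open>R\<^sub>t\<close> tends to the projection
  \<open>g \<mapsto> \<alpha>(g) \<eta>\<close>. Subtracting \<open>\<beta>(f)\<close> from \<open>f\<close> one may suppose \<open>\<alpha>(f \<eta>) = 0\<close>. Put
  \<open>A\<^sub>t = \<integral>\<^sub>0\<^sup>t f(X\<^sub>s) ds\<close> and consider the oscillating operators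
  \<open>G\<^sub>t g(x) = exp(\<lambda>\<^sub>0 t) E\<^sub>x[exp(\<i> \<theta> A\<^sub>t) g(X\<^sub>t); t < \<tau>]\<close>, whose values at \<open>g = 1\<close> are, up to
  normalisation, the characteristic function to be studied. The proof perturbs \<open>R\<close> through Duhamel's
  formula
  \<open>G\<^sub>t g = R\<^sub>t g + \<i> \<theta> \<integral>\<^sub>0\<^sup>t G\<^sub>s (f R\<^bsub>t-s\<^esub> g) ds\<close> (theorem \<open>Duhamel\<close>, lemma \<open>G_Duhamel\<close>); no spectral
  theory enters.

  If \<open>\<alpha>(w) = 0\<close> the formula gives \<open>G\<^sub>t w = O(exp(-\<gamma> t) + |\<theta>|)\<close> (\<open>G_decay\<close>), so up to this error
  \<open>G\<^sub>s w\<close> is \<open>\<alpha>(w) G\<^sub>s \<eta>\<close> for general \<open>w\<close>. Since \<open>R\<^sub>t \<eta> = \<eta>\<close>, two applications of the formula to \<open>\<eta>\<close> turn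
  \<open>y(t) = G\<^sub>t \<eta>(x)\<close> into the solution of
  \<open>y(t) = \<eta>(x) - \<theta>\<^sup>2 (\<sigma>\<^sup>2 / 2) \<integral>\<^sub>0\<^sup>t y(s) ds + error\<close>,
  where \<open>\<sigma>\<^sup>2 / 2 = \<integral>\<^sub>0\<^sup>\<infinity> \<alpha>(f R\<^sub>q (f \<eta>)) dq\<close> (\<open>G_\<eta>_integral_equation\<close>). For \<open>\<theta> = u / \<surd>T\<close> the error is
  \<open>O(1 / \<surd>T)\<close> uniformly on \<open>[0, T]\<close>, so \<open>y(T)\<close> tends to \<open>exp(-u\<^sup>2 \<sigma>\<^sup>2 / 2) \<eta>(x)\<close>; as \<open>1 - \<eta>\<close> is
  \<open>\<alpha>\<close>-centred the same holds for \<open>G\<^sub>T 1(x)\<close> (\<open>G_one_limit\<close>). All errors are proportional to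
  \<open>\<psi>\<^sub>1(x)\<close>. Integrating over \<open>\<mu>\<close>, dividing by the case \<open>u = 0\<close> and applying Levy's continuity theorem
  gives the central limit theorem (\<open>conditional_CLT\<close>).

  The constant is the asserted one because on \<open>\<F>\<^sub>s\<close> the Q-process started at \<open>x\<close> has density
  \<open>exp(\<lambda>\<^sub>0 s) \<eta>(X\<^sub>s) / \<eta>(x)\<close> with respect to the original process, so that the covariance of \<open>f(X\<^sub>0)\<close> and
  \<open>f(X\<^sub>s)\<close> under its stationary law is \<open>\<alpha>(f R\<^sub>s (f \<eta>))\<close> (\<open>covariance_Q_beta\<close>).

  Two measure-theoretic points need care. Survival beyond \<open>s\<close> is not decided by the path up to time
  \<open>s\<close>: a path may be alive at \<open>s\<close> and dead immediately afterwards. For all but countably many \<open>s\<close> this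
  has probability zero (\<open>AE_alive_survives\<close>), which is enough under a time integral and for limits that
  may be computed at a nearby later time. Moreover \<open>A\<^sub>s\<close> need not be adapted, so the Markov property
  is extended to integrands containing \<open>exp(\<i> \<theta> A\<^sub>s)\<close> by expanding the exponential (\<open>markov_phase\<close>).
\<close>

section \<open>Integrals over intervals and a perturbed linear integral equation\<close>

lemma norm_integral_le:
  fixes f :: "'a \<Rightarrow> 'b::{banach, second_countable_topology}"
  assumes g: "integrable M g" and le: "AE x in M. norm (f x) \<le> g x"
  shows "norm (\<integral>x. f x \<partial>M) \<le> (\<integral>x. g x \<partial>M)"
proof (cases "integrable M f")
  case True
  have "norm (\<integral>x. f x \<partial>M) \<le> (\<integral>x. norm (f x) \<partial>M)" by (rule integral_norm_bound)
  also have "\<dots> \<le> (\<integral>x. g x \<partial>M)" by (intro integral_mono_AE integrable_norm True g le)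
  finally show ?thesis .
next
  case False
  have "AE x in M. 0 \<le> g x" using le by eventually_elim (meson norm_ge_zero order_trans)
  with False show ?thesis by (simp add: not_integrable_integral_eq integral_nonneg_AE)
qed

lemma set_integrable_bounded_interval:
  fixes a :: "real \<Rightarrow> 'b::{banach, second_countable_topology}"
  assumes [measurable]: "a \<in> borel_measurable borel"
    and "\<And>r. s \<le> r \<Longrightarrow> r \<le> t \<Longrightarrow> norm (a r) \<le> B"
  shows "set_integrable lborel {s..t} a"
  unfolding set_integrable_def
proof (rule integrableI_bounded_set_indicator[where B=B])
  show "emeasure lborel {s..t} < \<infinity>" by (cases "s \<le> t") auto
qed (use assms in auto)

lemma set_integral_interval_bound:
  fixes a :: "real \<Rightarrow> 'b::{banach, second_countable_topology}"
  assumes "\<And>r. s \<le> r \<Longrightarrow> r \<le> t \<Longrightarrow> norm (a r) \<le> B" "s \<le> t" "0 \<le> B"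
  shows "norm (LINT r:{s..t}|lborel. a r) \<le> B * (t - s)"
proof -
  have "norm (LINT r:{s..t}|lborel. a r) \<le> (\<integral>r. indicator {s..t} r * B \<partial>lborel)"
    unfolding set_lebesgue_integral_def
  proof (rule norm_integral_le)
    show "integrable lborel (\<lambda>r. indicator {s..t} r * B)" using assms(2) by simp
  qed (use assms in \<open>auto simp: indicator_def\<close>)
  also have "\<dots> = B * (t - s)" using assms by simp
  finally show ?thesis .
qed

lemma set_integral_interval_split:
  fixes a :: "real \<Rightarrow> 'b::{banach, second_countable_topology}"
  assumes "set_integrable lborel {r..t} a" "r \<le> s" "s \<le> t"
  shows "(LINT u:{r..t}|lborel. a u) = (LINT u:{r..s}|lborel. a u) + (LINT u:{s..t}|lborel. a u)"
proof -
  have 1: "{r..t} = {r..s} \<union> {s<..t}" and 2: "{r..s} \<inter> {s<..t} = {}" using assms by auto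
  have "(LINT u:{r..t}|lborel. a u) = (LINT u:{r..s}|lborel. a u) + (LINT u:{s<..t}|lborel. a u)"
    unfolding 1 by (rule set_integral_Un[OF 2]) (rule set_integrable_subset[OF assms(1)]; use assms in auto)+
  also have "(LINT u:{s<..t}|lborel. a u) = (LINT u:{s..t}|lborel. a u)"
    using assms(3) by (intro set_integral_discrete_difference[where X="{s}"]) auto
  finally show ?thesis .
qed

lemma pred_snd_le_fst[measurable]:
  "Measurable.pred (borel \<Otimes>\<^sub>M borel) (\<lambda>p :: real \<times> real. snd p \<in> {0..fst p})"
proof -
  have "{p :: real \<times> real. snd p \<in> {0..fst p}} \<in> sets (borel \<Otimes>\<^sub>M borel)"
    unfolding atLeastAtMost_iff borel_prod
    by (intro borel_closed closed_Collect_conj closed_Collect_le continuous_intros)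
  then show ?thesis by (simp add: pred_def space_pair_measure)
qed

lemma cis_Lipschitz: "norm (cis x - cis y) \<le> \<bar>x - y\<bar>"
proof -
  have *: "norm (cis z - 1) \<le> \<bar>z\<bar>" for z
    using iexp_approx1[of z 0] by (simp add: cis_conv_exp)
  have "cis x - cis y = cis y * (cis (x - y) - 1)" by (simp add: algebra_simps cis_mult)
  then show ?thesis using *[of "x - y"] by (simp add: norm_mult)
qed

lemma cis_quadratic: "norm (cis x - cis y - \<i> * (x - y) * cis y) \<le> (x - y)\<^sup>2"
proof -
  have *: "norm (cis z - 1 - \<i> * z) \<le> z\<^sup>2" for z
  proof -
    have "norm (cis z - 1 - \<i> * z) \<le> z\<^sup>2 / 2"
      using iexp_approx1[of z 1] by (simp add: cis_conv_exp power2_eq_square algebra_simps)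
    also have "\<dots> \<le> z\<^sup>2" by simp
    finally show ?thesis .
  qed
  have "cis x - cis y - \<i> * (x - y) * cis y = cis y * (cis (x - y) - 1 - \<i> * (x - y))"
    by (simp add: algebra_simps cis_mult)
  then show ?thesis using *[of "x - y"] by (simp add: norm_mult)
qed

lemma quadratic_increments_constant:
  fixes \<phi> :: "real \<Rightarrow> 'b::real_normed_vector"
  assumes "\<And>x y. 0 \<le> x \<Longrightarrow> x \<le> y \<Longrightarrow> norm (\<phi> y - \<phi> x) \<le> K * (y - x)\<^sup>2" and "0 \<le> t"
  shows "\<phi> t = \<phi> 0"
proof -
  have sym: "norm (\<phi> y - \<phi> x) \<le> K * \<bar>y - x\<bar> * \<bar>y - x\<bar>" if "0 \<le> x" "0 \<le> y" for x y
    using assms(1)[of x y] assms(1)[of y x] that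
    by (cases "x \<le> y") (auto simp: power2_eq_square norm_minus_commute algebra_simps)
  have "(\<phi> has_derivative (\<lambda>h. 0)) (at x within {0..})" if x: "x \<in> {0..}" for x
    unfolding has_derivative_within
  proof (intro conjI)
    have "((\<lambda>y. K * \<bar>y - x\<bar>) \<longlongrightarrow> K * \<bar>x - x\<bar>) (at x within {0..})" by (intro tendsto_intros)
    then have lim: "((\<lambda>y. K * \<bar>y - x\<bar>) \<longlongrightarrow> 0) (at x within {0..})" by simp
    show "((\<lambda>y. (1 / norm (y - x)) *\<^sub>R (\<phi> y - (\<phi> x + 0))) \<longlongrightarrow> 0) (at x within {0..})"
    proof (rule Lim_null_comparison[OF _ lim])
      show "\<forall>\<^sub>F y in at x within {0..}. norm ((1 / norm (y - x)) *\<^sub>R (\<phi> y - (\<phi> x + 0))) \<le> K * \<bar>y - x\<bar>"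
        unfolding eventually_at_filter
      proof (rule always_eventually, intro allI impI)
        fix y assume "y \<noteq> x" "y \<in> {0..}"
        then show "norm ((1 / norm (y - x)) *\<^sub>R (\<phi> y - (\<phi> x + 0))) \<le> K * \<bar>y - x\<bar>"
          using sym[of x y] x mult_left_mono[of "norm (\<phi> y - \<phi> x)" _ "1 / \<bar>y - x\<bar>"] by fastforce
      qed
    qed
  qed simp
  from has_derivative_zero_constant[OF convex_real_interval(1) this]
  show ?thesis using \<open>0 \<le> t\<close> by fastforce
qed

text \<open>
  The primitive of a merely measurable \<open>a\<close> need not be differentiable, so the chain rule is not at
  hand.  But the difference of the two sides has increments of second order, hence is constant.
\<close>

lemma cis_primitive:
  fixes a :: "real \<Rightarrow> real"
  assumes [measurable]: "a \<in> borel_measurable borel" and B: "\<And>r. \<bar>a r\<bar> \<le> B" and "0 \<le> t"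
  defines "F \<equiv> \<lambda>s. (LINT r:{0..s}|lborel. a r)"
  shows "cis (\<theta> * F t) = 1 + \<i> * \<theta> * (LINT s:{0..t}|lborel. a s *\<^sub>R cis (\<theta> * F s))"
proof -
  have B0: "0 \<le> B" using B[of 0] by linarith
  have Fm[measurable]: "F \<in> borel_measurable borel"
    unfolding F_def set_lebesgue_integral_def by measurable
  define g where "g s = a s *\<^sub>R cis (\<theta> * F s)" for s
  have cism[measurable]: "cis \<in> borel_measurable borel"
    by (intro borel_measurable_continuous_onI continuous_intros)
  have gm[measurable]: "g \<in> borel_measurable borel"
    unfolding g_def by measurable
  have gB: "norm (g s) \<le> B" for s using B[of s] by (simp add: g_def)
  note ia = set_integrable_bounded_interval[of a, OF _ B[folded real_norm_def]]
  note ig = set_integrable_bounded_interval[OF gm gB]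
  have Fd: "F y - F x = (LINT r:{x..y}|lborel. a r)" if "0 \<le> x" "x \<le> y" for x y
    using set_integral_interval_split[OF ia, of 0 x y] that unfolding F_def by simp
  have FL: "\<bar>F y - F x\<bar> \<le> B * (y - x)" if "0 \<le> x" "x \<le> y" for x y
    using set_integral_interval_bound[of x y a B] B B0 that Fd[OF that] by simp
  define \<phi> where "\<phi> s = cis (\<theta> * F s) - \<i> * \<theta> * (LINT r:{0..s}|lborel. g r)" for s
  have "norm (\<phi> y - \<phi> x) \<le> (2 * \<theta>\<^sup>2 * B\<^sup>2) * (y - x)\<^sup>2" if xy: "0 \<le> x" "x \<le> y" for x y
  proof -
    have e1: "(LINT r:{0..y}|lborel. g r) = (LINT r:{0..x}|lborel. g r) + (LINT r:{x..y}|lborel. g r)"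
      using set_integral_interval_split[OF ig, of 0 x y] xy by simp
    have e2: "(LINT r:{x..y}|lborel. g r)
        = (LINT r:{x..y}|lborel. a r *\<^sub>R cis (\<theta> * F x)) + (LINT r:{x..y}|lborel. a r *\<^sub>R (cis (\<theta> * F r) - cis (\<theta> * F x)))"
    proof (subst set_integral_add(2)[symmetric])
      show "set_integrable lborel {x..y} (\<lambda>r. a r *\<^sub>R cis (\<theta> * F x))"
        using B by (intro set_integrable_bounded_interval[where B=B]) auto
      show "set_integrable lborel {x..y} (\<lambda>r. a r *\<^sub>R (cis (\<theta> * F r) - cis (\<theta> * F x)))"
      proof (intro set_integrable_bounded_interval[where B="B * 2"])
        fix r show "norm (a r *\<^sub>R (cis (\<theta> * F r) - cis (\<theta> * F x))) \<le> B * 2"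
          using B[of r] norm_triangle_ineq4[of "cis (\<theta> * F r)" "cis (\<theta> * F x)"] B0
          by (auto intro!: mult_mono)
      qed auto
    qed (simp add: g_def[abs_def] flip: scaleR_add_right)
    have e3: "(LINT r:{x..y}|lborel. a r *\<^sub>R cis (\<theta> * F x)) = (F y - F x) * cis (\<theta> * F x)"
      proof -
      have "(LINT r:{x..y}|lborel. a r *\<^sub>R cis (\<theta> * F x)) = (LINT r|lborel. (indicator {x..y} r *\<^sub>R a r) *\<^sub>R cis (\<theta> * F x))"
        unfolding set_lebesgue_integral_def by simp
      also have "\<dots> = (LINT r|lborel. indicator {x..y} r *\<^sub>R a r) *\<^sub>R cis (\<theta> * F x)"
        by (rule integral_scaleR_left) (use ia[of x y] in \<open>simp add: set_integrable_def\<close>)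
      finally show ?thesis
        using Fd[OF xy] by (simp add: set_lebesgue_integral_def scaleR_conv_of_real)
    qed
    have eq: "\<phi> y - \<phi> x = (cis (\<theta> * F y) - cis (\<theta> * F x) - \<i> * (\<theta> * F y - \<theta> * F x) * cis (\<theta> * F x))
        - \<i> * \<theta> * (LINT r:{x..y}|lborel. a r *\<^sub>R (cis (\<theta> * F r) - cis (\<theta> * F x)))"
      unfolding \<phi>_def e1 e2 e3 by (simp add: algebra_simps)
    have n1: "norm (cis (\<theta> * F y) - cis (\<theta> * F x) - \<i> * (\<theta> * F y - \<theta> * F x) * cis (\<theta> * F x)) \<le> \<theta>\<^sup>2 * B\<^sup>2 * (y - x)\<^sup>2"
    proof -
      have "(\<theta> * F y - \<theta> * F x)\<^sup>2 = \<theta>\<^sup>2 * \<bar>F y - F x\<bar>\<^sup>2"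
        by (simp add: power_mult_distrib[symmetric] algebra_simps)
      also have "\<dots> \<le> \<theta>\<^sup>2 * (B * (y - x))\<^sup>2" by (intro mult_left_mono power_mono FL xy) auto
      finally have "(\<theta> * F y - \<theta> * F x)\<^sup>2 \<le> \<theta>\<^sup>2 * B\<^sup>2 * (y - x)\<^sup>2"
        by (simp only: power_mult_distrib mult.assoc)
      with cis_quadratic[of "\<theta> * F y" "\<theta> * F x"] show ?thesis by simp
    qed
    have n2: "norm (LINT r:{x..y}|lborel. a r *\<^sub>R (cis (\<theta> * F r) - cis (\<theta> * F x))) \<le> (B * (\<bar>\<theta>\<bar> * (B * (y - x)))) * (y - x)"
    proof (rule set_integral_interval_bound)
      fix r assume r: "x \<le> r" "r \<le> y"
      have "norm (cis (\<theta> * F r) - cis (\<theta> * F x)) \<le> \<bar>\<theta>\<bar> * \<bar>F r - F x\<bar>"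
        using cis_Lipschitz[of "\<theta> * F r" "\<theta> * F x"] by (simp add: abs_mult[symmetric] algebra_simps)
      also have "\<dots> \<le> \<bar>\<theta>\<bar> * (B * (r - x))" using FL[of x r] r xy by (intro mult_left_mono) auto
      also have "\<dots> \<le> \<bar>\<theta>\<bar> * (B * (y - x))" using r B0 by (intro mult_left_mono) auto
      finally show "norm (a r *\<^sub>R (cis (\<theta> * F r) - cis (\<theta> * F x))) \<le> B * (\<bar>\<theta>\<bar> * (B * (y - x)))"
        using B[of r] B0 by (auto intro!: mult_mono)
    qed (use xy B0 in auto)
    have "norm (\<phi> y - \<phi> x) \<le> \<theta>\<^sup>2 * B\<^sup>2 * (y - x)\<^sup>2 + \<bar>\<theta>\<bar> * ((B * (\<bar>\<theta>\<bar> * (B * (y - x)))) * (y - x))"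
      unfolding eq by (rule order_trans[OF norm_triangle_ineq4]) (use n1 n2 in \<open>auto simp: norm_mult intro!: add_mono mult_left_mono\<close>)
    also have "\<bar>\<theta>\<bar> * ((B * (\<bar>\<theta>\<bar> * (B * (y - x)))) * (y - x)) = \<bar>\<theta>\<bar>\<^sup>2 * B\<^sup>2 * (y - x)\<^sup>2"
      by (simp only: power2_eq_square mult_ac)
    finally show ?thesis by (simp add: mult_ac)
  qed
  from quadratic_increments_constant[OF this \<open>0 \<le> t\<close>] have "\<phi> t = \<phi> 0" .
  moreover have "F 0 = 0" "(LINT r:{0..0}|lborel. g r) = 0"
    by (auto simp: F_def set_lebesgue_integral_def intro!: integral_eq_zero_AE AE_I'[of "{0}"]
        split: split_indicator split_indicator_asm)
  ultimately show ?thesis by (simp add: \<phi>_def g_def algebra_simps)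
qed

text \<open>
  The comparison function \<open>W t = exp (a t) (m - a \<integral> y)\<close> equals \<open>m\<close> at time \<open>0\<close>, and its derivative
  is the defect multiplied by \<open>- a exp (a t)\<close>.
\<close>

lemma perturbed_linear_integral_equation:
  fixes y :: "real \<Rightarrow> complex" and m :: complex
  assumes y: "continuous_on {0..T} y" and "0 \<le> T" "0 \<le> a"
    and e: "\<And>t. 0 \<le> t \<Longrightarrow> t \<le> T \<Longrightarrow> norm (y t + a * (LINT s:{0..t}|lborel. y s) - m) \<le> e"
  shows "norm (y T - exp (- a * T) * m) \<le> e * (1 + a * T * exp (a * T))"
proof -
  have eq: "(LINT s:{0..t}|lborel. y s) = integral {0..t} y" if "0 \<le> t" "t \<le> T" for t
    by (rule set_borel_integral_eq_integral, rule borel_integrable_atLeastAtMost')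
       (rule continuous_on_subset[OF y], use that in auto)
  define W where "W t = exp (a * t) *\<^sub>R (m - a *\<^sub>R integral {0..t} y)" for t
  define D where "D t = (a * exp (a * t)) *\<^sub>R (m - a *\<^sub>R integral {0..t} y - y t)" for t
  have dW: "(W has_vector_derivative D t) (at t within {0..T})" if "t \<in> {0..T}" for t
  proof -
    have "((\<lambda>t. m - a *\<^sub>R integral {0..t} y) has_vector_derivative (0 - a *\<^sub>R y t)) (at t within {0..T})"
      by (intro has_vector_derivative_diff has_vector_derivative_const
          bounded_linear.has_vector_derivative[OF bounded_linear_scaleR_right] integral_has_vector_derivative y that)
    moreover have "((\<lambda>t. exp (a * t)) has_real_derivative (a * exp (a * t))) (at t within {0..T})"
      by (auto intro!: derivative_eq_intros)
    ultimately have "(W has_vector_derivative (exp (a * t) *\<^sub>R (0 - a *\<^sub>R y t) + (a * exp (a * t)) *\<^sub>R (m - a *\<^sub>R integral {0..t} y))) (at t within {0..T})"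
      unfolding W_def by (intro has_vector_derivative_scaleR)
    then show ?thesis by (simp add: D_def algebra_simps)
  qed
  have e0: "0 \<le> e" using e[of 0] \<open>0 \<le> T\<close> by (meson norm_ge_zero order_trans order_refl)
  have nD: "norm (D t) \<le> a * exp (a * T) * e" if t: "t \<in> {0..T}" for t
  proof -
    have "norm (m - a *\<^sub>R integral {0..t} y - y t) \<le> e"
      using e[of t] eq[of t] t by (simp add: norm_minus_commute scaleR_conv_of_real algebra_simps)
    moreover have "exp (a * t) \<le> exp (a * T)" using t \<open>0 \<le> a\<close> by (auto intro!: mult_left_mono)
    ultimately show ?thesis using \<open>0 \<le> a\<close> e0 by (auto simp: D_def intro!: mult_mono)
  qed
  have "norm (W T - W 0) \<le> a * exp (a * T) * e * norm (T - 0)"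
    by (rule differentiable_bound[of "{0..T}" W "\<lambda>t h. h *\<^sub>R D t"])
       (use dW nD \<open>0 \<le> T\<close> in \<open>auto simp: has_vector_derivative_def onorm_scaleR_left onorm_id intro: onorm_scaleR_left_lemma\<close>)
  then have WT: "norm (W T - m) \<le> a * exp (a * T) * e * T"
    using \<open>0 \<le> T\<close> by (simp add: W_def)
  have "y T - exp (- a * T) *\<^sub>R m = (y T + a *\<^sub>R integral {0..T} y - m) + exp (- a * T) *\<^sub>R (W T - m)"
    by (simp add: W_def algebra_simps exp_minus flip: exp_add)
  also have "norm \<dots> \<le> e + 1 * (a * exp (a * T) * e * T)"
    using e[of T] eq[of T] \<open>0 \<le> T\<close> \<open>0 \<le> a\<close> WT
    by (intro norm_triangle_mono, simp add: scaleR_conv_of_real,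
        unfold norm_scaleR, intro mult_mono) auto
  finally show ?thesis by (simp add: scaleR_conv_of_real algebra_simps flip: exp_of_real)
qed

section \<open>The Markov property of the killed process\<close>

text \<open>
  The densities \<open>U\<close> and \<open>V\<close> define the same measure on the smaller \<open>\<sigma>\<close>-algebra \<open>F\<close>, and \<open>Z\<close> is
  integrated against that measure.
\<close>

lemma nn_integral_mult_eq_of_subalgebra:
  fixes U V Z :: "'w \<Rightarrow> ennreal"
  assumes sub: "subalgebra M F" and [measurable]: "U \<in> borel_measurable M" "V \<in> borel_measurable M"
    and eq: "\<And>\<Gamma>. \<Gamma> \<in> sets F \<Longrightarrow> (\<integral>\<^sup>+\<omega>. U \<omega> * indicator \<Gamma> \<omega> \<partial>M) = (\<integral>\<^sup>+\<omega>. V \<omega> * indicator \<Gamma> \<omega> \<partial>M)"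
    and Z: "Z \<in> borel_measurable F"
  shows "(\<integral>\<^sup>+\<omega>. Z \<omega> * U \<omega> \<partial>M) = (\<integral>\<^sup>+\<omega>. Z \<omega> * V \<omega> \<partial>M)"
proof -
  have Zm[measurable]: "Z \<in> borel_measurable M" by (rule measurable_from_subalg[OF sub Z])
  have subd: "subalgebra (density M W) F" for W using sub by (simp add: subalgebra_def)
  have Gm: "\<Gamma> \<in> sets M" if "\<Gamma> \<in> sets F" for \<Gamma> using sub that by (auto simp: subalgebra_def)
  have "restr_to_subalg (density M U) F = restr_to_subalg (density M V) F"
    by (rule measure_eqI)
       (auto simp: sets_restr_to_subalg[OF subd] emeasure_restr_to_subalg[OF subd] emeasure_density Gm eq)
  then have "(\<integral>\<^sup>+\<omega>. Z \<omega> \<partial>density M U) = (\<integral>\<^sup>+\<omega>. Z \<omega> \<partial>density M V)"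
    using nn_integral_subalgebra2[OF subd Z] by metis
  then show ?thesis by (simp add: nn_integral_density mult.commute)
qed

lemma borel_measurable_live_extend:
  assumes "f \<in> borel_measurable (live S cem)" "{cem} \<in> sets S"
  shows "f \<in> borel_measurable S"
proof (rule measurable_piecewise_restrict[of "{space S - {cem}, {cem}}"])
  fix A assume A: "A \<in> {space S - {cem}, {cem}}"
  then show "A \<inter> space S \<in> sets S" using assms(2) by auto
  show "f \<in> measurable (restrict_space S A) borel"
  proof (cases "A = {cem}")
    case True
    have "restrict_space S {cem} = restrict_space S {cem}" "space (restrict_space S {cem}) \<subseteq> {cem}"
      by (auto simp: space_restrict_space)
    with True show ?thesis
      by (subst measurable_cong[where g="\<lambda>_. f cem"]) auto
  next
    case False with A assms(1) show ?thesis by (auto simp: live_def)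
  qed
qed auto

lemma space_live: "space (live S cem) = space S - {cem}"
  by (auto simp: live_def space_restrict_space)

lemma borel_measurable_live_restrict: "f \<in> borel_measurable S \<Longrightarrow> f \<in> borel_measurable (live S cem)"
  unfolding live_def by (rule measurable_restrict_space1)

context absorbed_markov_process
begin

lemma kernel_subprob: "P \<in> S \<rightarrow>\<^sub>M subprob_algebra \<Omega>"
  using kernel by (rule measurable_prob_algebraD)

lemma
  assumes "x \<in> space S"
  shows prob_space_P: "prob_space (P x)" and sets_P: "sets (P x) = sets \<Omega>" and space_P: "space (P x) = space \<Omega>"
  using measurable_space[OF kernel assms] sets_eq_imp_space_eq by (auto simp: space_prob_algebra)

text \<open>
  Freezing the path at its starting point for negative times makes it jointly measurable on all of
  \<open>\<real> \<times> \<Omega>\<close>, so that Fubini's theorem can be used with Lebesgue measure on the whole line.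
\<close>

lemma measurable_X_max[measurable]: "(\<lambda>p. X (max 0 (fst p)) (snd p)) \<in> borel \<Otimes>\<^sub>M \<Omega> \<rightarrow>\<^sub>M S"
proof -
  have "(\<lambda>p :: real \<times> 'w. (max 0 (fst p), snd p)) \<in> borel \<Otimes>\<^sub>M \<Omega> \<rightarrow>\<^sub>M restrict_space borel {0..} \<Otimes>\<^sub>M \<Omega>"
    by (intro measurable_Pair measurable_restrict_space2) auto
  from measurable_compose[OF this jointly_measurable] show ?thesis by simp
qed

lemma measurable_X[measurable (raw)]: "0 \<le> t \<Longrightarrow> X t \<in> \<Omega> \<rightarrow>\<^sub>M S"
  using measurable_compose[OF measurable_Pair1' measurable_X_max, of t] by (simp add: max_def)

lemma measurable_X_max1[measurable]: "X (max 0 t) \<in> \<Omega> \<rightarrow>\<^sub>M S"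
  by (rule measurable_X) simp

lemma X_in_space: "0 \<le> t \<Longrightarrow> \<omega> \<in> space \<Omega> \<Longrightarrow> X t \<omega> \<in> space S"
  using measurable_space[OF measurable_X] .

abbreviation "survives t \<equiv> survival \<Omega> cem X t"

lemma sets_survival[measurable]: "survives t \<in> sets \<Omega>"
  using hitting_time_measurable unfolding survival_def by measurable

lemma indicator_survival_measurable[measurable]:
  "(\<lambda>p. indicator (survives (fst p)) (snd p) :: 'c::{zero_neq_one, topological_space}) \<in> borel_measurable (borel \<Otimes>\<^sub>M \<Omega>)"
proof -
  note [measurable] = hitting_time_measurable
  have "(\<lambda>p :: real \<times> 'w. if ereal (fst p) < hitting_time X cem (snd p) then 1 else 0 :: 'c) \<in> borel_measurable (borel \<Otimes>\<^sub>M \<Omega>)"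
    by measurable
  then show ?thesis
    by (rule measurable_cong[THEN iffD1, rotated]) (auto simp: survival_def space_pair_measure)
qed

lemma X_alive: "0 \<le> s \<Longrightarrow> s \<le> t \<Longrightarrow> \<omega> \<in> survives t \<Longrightarrow> X s \<omega> \<noteq> cem"
proof
  assume *: "0 \<le> s" "s \<le> t" "\<omega> \<in> survives t" "X s \<omega> = cem"
  then have "hitting_time X cem \<omega> \<le> ereal s" unfolding hitting_time_def by (intro Inf_lower) auto
  also have "ereal s \<le> ereal t" using * by simp
  finally show False using * by (auto simp: survival_def dest: leD)
qed

lemma survives_antimono: "s \<le> t \<Longrightarrow> survives t \<subseteq> survives s"
  by (auto simp: survival_def intro: order.strict_trans1[OF ereal_less_eq(3)[THEN iffD2]])

definition absorbed_path :: "'w \<Rightarrow> bool" where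
  "absorbed_path \<omega> \<longleftrightarrow> (\<forall>s t. 0 \<le> s \<and> s \<le> t \<and> X s \<omega> = cem \<longrightarrow> X t \<omega> = cem)"

lemma AE_absorbed_path: "x \<in> space S \<Longrightarrow> AE \<omega> in P x. absorbed_path \<omega>"
  using absorbing[of x] by (simp add: absorbed_path_def)

text \<open>
  The hitting time is an infimum which need not be attained: a path may be alive at time \<open>t\<close> and dead
  at all later times. Hence survival beyond \<open>t\<close> is tested strictly after \<open>t\<close>.
\<close>

lemma survives_iff_alive_later:
  assumes "absorbed_path \<omega>" "\<omega> \<in> space \<Omega>" "0 \<le> t"
  shows "\<omega> \<in> survives t \<longleftrightarrow> (\<exists>n::nat. X (t + 1 / Suc n) \<omega> \<noteq> cem)"
proof
  assume "\<omega> \<in> survives t"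
  then have "ereal t < hitting_time X cem \<omega>" by (simp add: survival_def)
  then obtain r where r: "t < r" "ereal r < hitting_time X cem \<omega>"
    using ereal_dense2[of "ereal t"] by (metis less_ereal.simps(1))
  then obtain n where n: "1 / Suc n < r - t"
    using nat_approx_posE[of "r - t"] by auto
  have "\<omega> \<in> survives r" using r assms by (simp add: survival_def)
  then show "\<exists>n::nat. X (t + 1 / Suc n) \<omega> \<noteq> cem"
    using X_alive[of "t + 1 / Suc n" r \<omega>] n assms(3) by (intro exI[of _ n]) auto
next
  assume "\<exists>n::nat. X (t + 1 / Suc n) \<omega> \<noteq> cem"
  then obtain n :: nat where n: "X (t + 1 / Suc n) \<omega> \<noteq> cem" by blast
  have "ereal (t + 1 / Suc n) \<le> hitting_time X cem \<omega>"
    unfolding hitting_time_def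
  proof (rule Inf_greatest)
    fix z assume "z \<in> ereal ` {t. 0 \<le> t \<and> X t \<omega> = cem}"
    then obtain s where s: "z = ereal s" "0 \<le> s" "X s \<omega> = cem" by auto
    then show "ereal (t + 1 / Suc n) \<le> z"
      using assms(1) n unfolding absorbed_path_def by (metis ereal_less_eq(3) linear)
  qed
  then have "ereal t < hitting_time X cem \<omega>"
    by (rule order.strict_trans2[rotated]) simp
  then show "\<omega> \<in> survives t" using assms(2) by (simp add: survival_def)
qed

lemma not_survives_cem: "0 \<le> t \<Longrightarrow> AE \<omega> in P cem. \<omega> \<notin> survives t"
  using start[OF cem_in_space]
proof eventually_elim
  case (elim \<omega>) then show ?case using X_alive[of 0 t \<omega>] by auto
qed

abbreviation "\<F> s \<equiv> natural_filtration \<Omega> S X s"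

lemma space_filtration: "space (\<F> s) = space \<Omega>"
  unfolding natural_filtration_def by (rule space_measure_of) auto

lemma sets_filtration: "sets (\<F> s) = sigma_sets (space \<Omega>) {X r -` A \<inter> space \<Omega> | r A. 0 \<le> r \<and> r \<le> s \<and> A \<in> sets S}"
  unfolding natural_filtration_def by (rule sets_measure_of) auto

lemma filtration_le: "sets (\<F> s) \<subseteq> sets \<Omega>"
  unfolding sets_filtration
  by (rule sets.sigma_sets_subset) (auto intro!: measurable_sets[OF measurable_X])

lemma filtration_mono: "s \<le> t \<Longrightarrow> sets (\<F> s) \<subseteq> sets (\<F> t)"
  unfolding sets_filtration by (rule sigma_sets_subseteq) force

lemma subalgebra_filtration: "x \<in> space S \<Longrightarrow> subalgebra (P x) (\<F> s)"
  using filtration_le by (simp add: subalgebra_def space_P sets_P space_filtration)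

lemma measurable_filtration_X: "0 \<le> r \<Longrightarrow> r \<le> s \<Longrightarrow> X r \<in> \<F> s \<rightarrow>\<^sub>M S"
  by (rule measurableI) (auto simp: space_filtration X_in_space sets_filtration intro!: sigma_sets.Basic)

lemma measurable_filtration_mono: "s \<le> t \<Longrightarrow> f \<in> \<F> s \<rightarrow>\<^sub>M N \<Longrightarrow> f \<in> \<F> t \<rightarrow>\<^sub>M N"
  using filtration_mono[of s t] by (auto simp: measurable_def space_filtration)

lemma measurable_filtration_imp: "f \<in> \<F> s \<rightarrow>\<^sub>M N \<Longrightarrow> f \<in> \<Omega> \<rightarrow>\<^sub>M N"
  using filtration_le[of s] by (auto simp: measurable_def space_filtration)

text \<open>
  For fixed \<open>\<Gamma>\<close> the Markov property identifies two measures on the state space: the law of \<open>X (s + t)\<close>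
  restricted to \<open>\<Gamma>\<close>, and the mixture of the laws of \<open>X t\<close> over the position at time \<open>s\<close>.
\<close>

lemma nn_markov:
  fixes Z :: "'w \<Rightarrow> ennreal" and k :: "'a \<Rightarrow> ennreal"
  assumes x: "x \<in> space S" and st: "0 \<le> s" "0 \<le> t"
    and Z: "Z \<in> borel_measurable (\<F> s)" and k[measurable]: "k \<in> borel_measurable S"
  shows "(\<integral>\<^sup>+\<omega>. Z \<omega> * k (X (s + t) \<omega>) \<partial>P x) = (\<integral>\<^sup>+\<omega>. Z \<omega> * (\<integral>\<^sup>+\<omega>'. k (X t \<omega>') \<partial>P (X s \<omega>)) \<partial>P x)"
proof (rule nn_integral_mult_eq_of_subalgebra[OF subalgebra_filtration[OF x] _ _ _ Z])
  note [measurable_cong] = sets_P[OF x]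
  have [measurable]: "X s \<in> \<Omega> \<rightarrow>\<^sub>M S" "X t \<in> \<Omega> \<rightarrow>\<^sub>M S" "X (s + t) \<in> \<Omega> \<rightarrow>\<^sub>M S" using st by auto
  show "(\<lambda>\<omega>. k (X (s + t) \<omega>)) \<in> borel_measurable (P x)"
    using measurable_compose[OF measurable_X[of "s + t"] k] st by (simp add: measurable_cong_sets[OF sets_P[OF x] refl])
  have K[measurable]: "(\<lambda>\<omega>. distr (P (X s \<omega>)) S (X t)) \<in> \<Omega> \<rightarrow>\<^sub>M subprob_algebra S"
    by (rule measurable_compose[OF measurable_compose[OF measurable_X[OF st(1)] kernel_subprob] measurable_distr[OF measurable_X[OF st(2)]]])
  show V[measurable]: "(\<lambda>\<omega>. \<integral>\<^sup>+\<omega>'. k (X t \<omega>') \<partial>P (X s \<omega>)) \<in> borel_measurable (P x)"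
    using measurable_compose[OF measurable_X[OF st(1)] measurable_compose[OF kernel_subprob
        nn_integral_measurable_subprob_algebra[OF measurable_compose[OF measurable_X[OF st(2)] k]]]]
    by (simp add: measurable_cong_sets[OF sets_P[OF x] refl])
  fix \<Gamma> assume G: "\<Gamma> \<in> sets (\<F> s)"
  then have [measurable]: "\<Gamma> \<in> sets \<Omega>" using filtration_le by auto
  define N where "N = density (P x) (indicator \<Gamma>)"
  have setsN[measurable_cong]: "sets N = sets \<Omega>" by (simp add: N_def sets_P[OF x])
  have neN: "space N \<noteq> {}" using prob_space.not_empty[OF prob_space_P[OF x]] by (simp add: N_def)
  have KN: "(\<lambda>\<omega>. distr (P (X s \<omega>)) S (X t)) \<in> N \<rightarrow>\<^sub>M subprob_algebra S" by measurable
  have Xs: "X s \<omega> \<in> space S" if "\<omega> \<in> space (P x)" for \<omega> using that st by (simp add: X_in_space space_P[OF x])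
  have "distr N S (X (s + t)) = N \<bind> (\<lambda>\<omega>. distr (P (X s \<omega>)) S (X t))"
  proof (rule measure_eqI)
    show "sets (distr N S (X (s + t))) = sets (N \<bind> (\<lambda>\<omega>. distr (P (X s \<omega>)) S (X t)))"
      by (simp add: sets_bind[OF _ neN])
    fix A assume "A \<in> sets (distr N S (X (s + t)))"
    then have A[measurable]: "A \<in> sets S" by simp
    have B[measurable]: "X (s + t) -` A \<inter> space \<Omega> \<in> sets \<Omega>" by measurable
    have "emeasure (distr N S (X (s + t))) A = emeasure N (X (s + t) -` A \<inter> space \<Omega>)"
      by (subst emeasure_distr) (auto simp: N_def space_P[OF x] measurable_cong_sets[OF sets_P[OF x] refl])
    also have "\<dots> = (\<integral>\<^sup>+\<omega>. indicator \<Gamma> \<omega> * indicator (X (s + t) -` A \<inter> space \<Omega>) \<omega> \<partial>P x)"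
      unfolding N_def by (rule emeasure_density) (auto simp: sets_P[OF x] B intro!: borel_measurable_indicator)
    also have "\<dots> = emeasure (P x) (\<Gamma> \<inter> (X (s + t) -` A \<inter> space \<Omega>))"
      unfolding indicator_inter_arith[symmetric] by (rule nn_integral_indicator) (simp add: sets_P[OF x])
    also have "\<dots> = (\<integral>\<^sup>+\<omega>. emeasure (P (X s \<omega>)) (X t -` A \<inter> space \<Omega>) * indicator \<Gamma> \<omega> \<partial>P x)"
      by (rule markov[OF x st G A])
    also have "\<dots> = (\<integral>\<^sup>+\<omega>. emeasure (distr (P (X s \<omega>)) S (X t)) A * indicator \<Gamma> \<omega> \<partial>P x)"
      using Xs by (intro nn_integral_cong) (simp add: emeasure_distr space_P sets_P cong: measurable_cong_sets)
    also have "\<dots> = emeasure (N \<bind> (\<lambda>\<omega>. distr (P (X s \<omega>)) S (X t))) A"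
      by (subst emeasure_bind[OF neN KN A]) (simp add: N_def nn_integral_density mult.commute)
    finally show "emeasure (distr N S (X (s + t))) A = emeasure (N \<bind> (\<lambda>\<omega>. distr (P (X s \<omega>)) S (X t))) A" .
  qed
  then have "(\<integral>\<^sup>+y. k y \<partial>distr N S (X (s + t))) = (\<integral>\<^sup>+y. k y \<partial>(N \<bind> (\<lambda>\<omega>. distr (P (X s \<omega>)) S (X t))))" by simp
  also have "\<dots> = (\<integral>\<^sup>+\<omega>. (\<integral>\<^sup>+y. k y \<partial>distr (P (X s \<omega>)) S (X t)) \<partial>N)" by (rule nn_integral_bind[OF k KN])
  also have "\<dots> = (\<integral>\<^sup>+\<omega>. (\<integral>\<^sup>+\<omega>'. k (X t \<omega>') \<partial>P (X s \<omega>)) \<partial>N)"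
    using Xs by (intro nn_integral_cong nn_integral_distr) (auto simp: N_def sets_P cong: measurable_cong_sets)
  finally show "(\<integral>\<^sup>+\<omega>. k (X (s + t) \<omega>) * indicator \<Gamma> \<omega> \<partial>P x) = (\<integral>\<^sup>+\<omega>. (\<integral>\<^sup>+\<omega>'. k (X t \<omega>') \<partial>P (X s \<omega>)) * indicator \<Gamma> \<omega> \<partial>P x)"
    by (simp add: nn_integral_distr N_def nn_integral_density mult.commute)
qed

text \<open>
  Survival beyond time \<open>s\<close> is not determined by the path up to time \<open>s\<close>: the process may be alive at
  time \<open>s\<close> and dead immediately afterwards. It is the increasing limit of being alive at \<open>s + 1/n\<close>.
\<close>

lemma nn_markov_survival_now:
  fixes Z :: "'w \<Rightarrow> ennreal"
  assumes x: "x \<in> space S" and s: "0 \<le> s" and Z: "Z \<in> borel_measurable (\<F> s)"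
  shows "(\<integral>\<^sup>+\<omega>. Z \<omega> * indicator (survives s) \<omega> \<partial>P x) = (\<integral>\<^sup>+\<omega>. Z \<omega> * emeasure (P (X s \<omega>)) (survives 0) \<partial>P x)"
proof -
  have Zm[measurable]: "Z \<in> borel_measurable \<Omega>" by (rule measurable_filtration_imp[OF Z])
  let ?a = "\<lambda>y. indicator (- {cem}) y :: ennreal"
  have am[measurable]: "?a \<in> borel_measurable S"
  proof -
    have "(\<lambda>y. 1 - indicator {cem} y :: ennreal) \<in> borel_measurable S" using cem_measurable by measurable
    then show ?thesis by (rule measurable_cong[THEN iffD1, rotated]) (auto split: split_indicator)
  qed
  have lim: "(\<integral>\<^sup>+\<omega>. V \<omega> * indicator (survives r) \<omega> \<partial>P y) = (SUP n::nat. \<integral>\<^sup>+\<omega>. V \<omega> * ?a (X (r + 1 / Suc n) \<omega>) \<partial>P y)"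
    and inc: "incseq (\<lambda>n::nat. \<integral>\<^sup>+\<omega>. V \<omega> * ?a (X (r + 1 / Suc n) \<omega>) \<partial>P y)"
    if y: "y \<in> space S" and r: "0 \<le> r" and V: "V \<in> borel_measurable \<Omega>" for y r V
  proof -
    note [measurable_cong] = sets_P[OF y] and [measurable] = V
    have [measurable]: "X (r + 1 / Suc n) \<in> \<Omega> \<rightarrow>\<^sub>M S" for n :: nat using r by auto
    have mono: "AE \<omega> in P y. V \<omega> * ?a (X (r + 1 / Suc n) \<omega>) \<le> V \<omega> * ?a (X (r + 1 / Suc (Suc n)) \<omega>)" for n :: nat
      using AE_absorbed_path[OF y]
    proof eventually_elim
      case (elim \<omega>)
      have "1 / real (Suc (Suc n)) \<le> 1 / real (Suc n)" by (simp add: field_simps)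
      then have "X (r + 1 / Suc (Suc n)) \<omega> = cem \<Longrightarrow> X (r + 1 / Suc n) \<omega> = cem"
        using elim r unfolding absorbed_path_def
        by (elim allE[of _ "r + 1 / Suc (Suc n)"] allE[of _ "r + 1 / Suc n"]) auto
      then show ?case by (intro mult_left_mono) (auto split: split_indicator)
    qed
    have "(\<integral>\<^sup>+\<omega>. V \<omega> * indicator (survives r) \<omega> \<partial>P y) = (\<integral>\<^sup>+\<omega>. (SUP n::nat. V \<omega> * ?a (X (r + 1 / Suc n) \<omega>)) \<partial>P y)"
    proof (rule nn_integral_cong_AE)
      show "AE \<omega> in P y. V \<omega> * indicator (survives r) \<omega> = (SUP n::nat. V \<omega> * ?a (X (r + 1 / Suc n) \<omega>))"
        using AE_absorbed_path[OF y] AE_space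
      proof eventually_elim
        case (elim \<omega>)
        then have "(indicator (survives r) \<omega> :: ennreal) = (SUP n::nat. ?a (X (r + 1 / Suc n) \<omega>))"
          using survives_iff_alive_later[of \<omega> r] r
          by (intro antisym) (auto simp: space_P[OF y] indicator_def intro!: SUP_least intro: SUP_upper2)
        then show ?case by (simp add: SUP_mult_left_ennreal)
      qed
    qed
    also have "\<dots> = (SUP n::nat. \<integral>\<^sup>+\<omega>. V \<omega> * ?a (X (r + 1 / Suc n) \<omega>) \<partial>P y)"
      by (rule nn_integral_monotone_convergence_SUP_AE) (rule mono, measurable)
    finally show "(\<integral>\<^sup>+\<omega>. V \<omega> * indicator (survives r) \<omega> \<partial>P y) = (SUP n::nat. \<integral>\<^sup>+\<omega>. V \<omega> * ?a (X (r + 1 / Suc n) \<omega>) \<partial>P y)" .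
    show "incseq (\<lambda>n::nat. \<integral>\<^sup>+\<omega>. V \<omega> * ?a (X (r + 1 / Suc n) \<omega>) \<partial>P y)"
      by (intro incseq_SucI nn_integral_mono_AE mono)
  qed
  have Xs: "X s \<omega> \<in> space S" if "\<omega> \<in> space (P x)" for \<omega> using that s by (simp add: X_in_space space_P[OF x])
  have p0: "emeasure (P y) (survives 0) = (SUP n::nat. \<integral>\<^sup>+\<omega>. ?a (X (1 / Suc n) \<omega>) \<partial>P y)" if "y \<in> space S" for y
    using lim[OF that, of 0 "\<lambda>_. 1"] that by (simp add: sets_P)
  have "(\<integral>\<^sup>+\<omega>. Z \<omega> * indicator (survives s) \<omega> \<partial>P x) = (SUP n::nat. \<integral>\<^sup>+\<omega>. Z \<omega> * ?a (X (s + 1 / Suc n) \<omega>) \<partial>P x)"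
    by (rule lim[OF x s Zm])
  also have "\<dots> = (SUP n::nat. \<integral>\<^sup>+\<omega>. Z \<omega> * (\<integral>\<^sup>+\<omega>'. ?a (X (1 / Suc n) \<omega>') \<partial>P (X s \<omega>)) \<partial>P x)"
    by (intro SUP_cong refl nn_markov[OF x s _ Z am]) simp
  also have "\<dots> = (\<integral>\<^sup>+\<omega>. (SUP n::nat. Z \<omega> * (\<integral>\<^sup>+\<omega>'. ?a (X (1 / Suc n) \<omega>') \<partial>P (X s \<omega>))) \<partial>P x)"
  proof (rule nn_integral_monotone_convergence_SUP_AE[symmetric])
    fix n :: nat
    show "AE \<omega> in P x. Z \<omega> * (\<integral>\<^sup>+\<omega>'. ?a (X (1 / Suc n) \<omega>') \<partial>P (X s \<omega>)) \<le> Z \<omega> * (\<integral>\<^sup>+\<omega>'. ?a (X (1 / Suc (Suc n)) \<omega>') \<partial>P (X s \<omega>))"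
      using inc[of _ 0 "\<lambda>_. 1", THEN incseq_SucD, of _ n] Xs by (intro AE_I2 mult_left_mono) auto
    show "(\<lambda>\<omega>. Z \<omega> * (\<integral>\<^sup>+\<omega>'. ?a (X (1 / Suc n) \<omega>') \<partial>P (X s \<omega>))) \<in> borel_measurable (P x)"
      using measurable_compose[OF measurable_X[OF s] measurable_compose[OF kernel_subprob
        nn_integral_measurable_subprob_algebra[OF measurable_compose[OF measurable_X[of "1 / Suc n"] am]]]]
      by (simp add: measurable_cong_sets[OF sets_P[OF x] refl])
  qed
  also have "\<dots> = (\<integral>\<^sup>+\<omega>. Z \<omega> * emeasure (P (X s \<omega>)) (survives 0) \<partial>P x)"
    using Xs by (intro nn_integral_cong) (simp add: p0 SUP_mult_left_ennreal)
  finally show ?thesis .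
qed

text \<open>
  Survival beyond a time has conditional probability \<open>p (X r)\<close> given the path up to that time, where
  \<open>p\<close> is the probability of surviving time \<open>0\<close>. This weight is inserted at time \<open>s + t\<close>, carried
  through the Markov property, and removed at time \<open>t\<close> of the restarted process.
\<close>

lemma nn_markov_survival:
  fixes Z :: "'w \<Rightarrow> ennreal" and k :: "'a \<Rightarrow> ennreal"
  assumes x: "x \<in> space S" and st: "0 \<le> s" "0 \<le> t"
    and Z: "Z \<in> borel_measurable (\<F> s)" and k: "k \<in> borel_measurable S"
  shows "(\<integral>\<^sup>+\<omega>. Z \<omega> * (indicator (survives (s + t)) \<omega> * k (X (s + t) \<omega>)) \<partial>P x)
    = (\<integral>\<^sup>+\<omega>. Z \<omega> * (\<integral>\<^sup>+\<omega>'. indicator (survives t) \<omega>' * k (X t \<omega>') \<partial>P (X s \<omega>)) \<partial>P x)"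
proof -
  define p where "p y = emeasure (P y) (survives 0)" for y
  have p[measurable]: "p \<in> borel_measurable S"
    unfolding p_def using measurable_compose[OF kernel_subprob measurable_emeasure_subprob_algebra[OF sets_survival]] .
  have kp: "(\<lambda>y. k y * p y) \<in> borel_measurable S" using k p by measurable
  have now: "(\<integral>\<^sup>+\<omega>. Y \<omega> * (indicator (survives r) \<omega> * k (X r \<omega>)) \<partial>P y) = (\<integral>\<^sup>+\<omega>. Y \<omega> * (k (X r \<omega>) * p (X r \<omega>)) \<partial>P y)"
    if "y \<in> space S" "0 \<le> r" "Y \<in> borel_measurable (\<F> r)" for y r Y
  proof -
    have "(\<lambda>\<omega>. Y \<omega> * k (X r \<omega>)) \<in> borel_measurable (\<F> r)"
      using that(3) measurable_compose[OF measurable_filtration_X[OF that(2) order_refl] k] by measurable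
    from nn_markov_survival_now[OF that(1,2) this] show ?thesis by (simp add: p_def mult_ac)
  qed
  have "(\<integral>\<^sup>+\<omega>. Z \<omega> * (indicator (survives (s + t)) \<omega> * k (X (s + t) \<omega>)) \<partial>P x)
      = (\<integral>\<^sup>+\<omega>. Z \<omega> * (k (X (s + t) \<omega>) * p (X (s + t) \<omega>)) \<partial>P x)"
    by (rule now[OF x]) (use st measurable_filtration_mono[OF _ Z] in auto)
  also have "\<dots> = (\<integral>\<^sup>+\<omega>. Z \<omega> * (\<integral>\<^sup>+\<omega>'. k (X t \<omega>') * p (X t \<omega>') \<partial>P (X s \<omega>)) \<partial>P x)"
    by (rule nn_markov[OF x st Z kp])
  also have "\<dots> = (\<integral>\<^sup>+\<omega>. Z \<omega> * (\<integral>\<^sup>+\<omega>'. indicator (survives t) \<omega>' * k (X t \<omega>') \<partial>P (X s \<omega>)) \<partial>P x)"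
    using now[of _ t "\<lambda>_. 1"] st
    by (intro nn_integral_cong) (simp add: X_in_space space_P[OF x])
  finally show ?thesis .
qed

definition killed :: "('a \<Rightarrow> real) \<Rightarrow> real \<Rightarrow> 'w \<Rightarrow> real" where
  "killed g t \<omega> = indicator (survives t) \<omega> * g (X (max 0 t) \<omega>)"

definition killed_semigroup :: "real \<Rightarrow> ('a \<Rightarrow> real) \<Rightarrow> 'a \<Rightarrow> real" where
  "killed_semigroup t g x = (\<integral>\<omega>. killed g t \<omega> \<partial>P x)"

lemma killed_measurable2[measurable]:
  assumes [measurable]: "g \<in> borel_measurable S"
  shows "(\<lambda>p. killed g (fst p) (snd p)) \<in> borel_measurable (borel \<Otimes>\<^sub>M \<Omega>)"
  unfolding killed_def by measurable

lemma killed_measurable[measurable]: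
  assumes [measurable]: "g \<in> borel_measurable S"
  shows "killed g t \<in> borel_measurable \<Omega>"
  unfolding killed_def by measurable

lemma killed_semigroup_measurable2[measurable]:
  assumes [measurable]: "g \<in> borel_measurable S"
  shows "(\<lambda>p. killed_semigroup (fst p) g (snd p)) \<in> borel_measurable (borel \<Otimes>\<^sub>M S)"
proof -
  have d: "killed_semigroup t g y = enn2real (\<integral>\<^sup>+\<omega>. ennreal (killed g t \<omega>) \<partial>P y) - enn2real (\<integral>\<^sup>+\<omega>. ennreal (- killed g t \<omega>) \<partial>P y)"
    if "integrable (P y) (killed g t)" for t y
    unfolding killed_semigroup_def by (rule real_lebesgue_integral_def[OF that])
  have nn: "(\<lambda>p. \<integral>\<^sup>+\<omega>. h (killed g (fst p) \<omega>) \<partial>P (snd p)) \<in> borel_measurable (borel \<Otimes>\<^sub>M S)"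
    if [measurable]: "h \<in> borel_measurable borel" for h :: "real \<Rightarrow> ennreal"
  proof (rule nn_integral_measurable_subprob_algebra2[where N=\<Omega>])
    have "(\<lambda>q :: (real \<times> 'a) \<times> 'w. (fst (fst q), snd q)) \<in> (borel \<Otimes>\<^sub>M S) \<Otimes>\<^sub>M \<Omega> \<rightarrow>\<^sub>M borel \<Otimes>\<^sub>M \<Omega>" by measurable
    from measurable_compose[OF this measurable_compose[OF killed_measurable2 that]]
    show "(\<lambda>(p, \<omega>). h (killed g (fst p) \<omega>)) \<in> borel_measurable ((borel \<Otimes>\<^sub>M S) \<Otimes>\<^sub>M \<Omega>)"
      by (simp add: split_beta')
    show "(\<lambda>p. P (snd p)) \<in> borel \<Otimes>\<^sub>M S \<rightarrow>\<^sub>M subprob_algebra \<Omega>"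
      by (rule measurable_compose[OF measurable_snd kernel_subprob])
  qed
  define I where "I h p = (\<integral>\<^sup>+\<omega>. h (killed g (fst p) \<omega>) \<partial>P (snd p))" for h :: "real \<Rightarrow> ennreal" and p
  have [measurable]: "I h \<in> borel_measurable (borel \<Otimes>\<^sub>M S)" if "h \<in> borel_measurable borel" for h
    unfolding I_def using nn[OF that] .
  have "(\<lambda>p. if I (\<lambda>z. ennreal (norm z)) p < \<infinity> then enn2real (I ennreal p) - enn2real (I (\<lambda>z. ennreal (- z)) p) else 0)
    \<in> borel_measurable (borel \<Otimes>\<^sub>M S)"
    by measurable
  then show ?thesis
  proof (rule measurable_cong[THEN iffD1, rotated])
    fix p assume "p \<in> space (borel \<Otimes>\<^sub>M S :: (real \<times> 'a) measure)"
    then have setsP: "sets (P (snd p)) = sets \<Omega>" by (auto simp: space_pair_measure sets_P)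
    have m: "killed g t \<in> borel_measurable (P (snd p))" for t
      using killed_measurable[OF assms, of t] by (simp add: measurable_cong_sets[OF setsP refl])
    show "(if I (\<lambda>z. ennreal (norm z)) p < \<infinity> then enn2real (I ennreal p) - enn2real (I (\<lambda>z. ennreal (- z)) p) else 0)
      = killed_semigroup (fst p) g (snd p)"
    proof (cases "integrable (P (snd p)) (killed g (fst p))")
      case True
      then show ?thesis using d[OF True] by (simp add: integrable_iff_bounded I_def)
    next
      case False
      then have "\<not> I (\<lambda>z. ennreal (norm z)) p < \<infinity>" using m by (simp add: integrable_iff_bounded I_def)
      then show ?thesis using False by (simp add: killed_semigroup_def not_integrable_integral_eq)
    qed
  qed
qed

lemma killed_semigroup_measurable[measurable]:
  assumes "g \<in> borel_measurable S"
  shows "killed_semigroup t g \<in> borel_measurable S"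
  using measurable_compose[OF measurable_Pair1' killed_semigroup_measurable2[OF assms], of t] by simp

lemma killed_semigroup_cem: "0 \<le> t \<Longrightarrow> killed_semigroup t g cem = 0"
  unfolding killed_semigroup_def
  by (rule integral_eq_zero_AE, rule AE_mp[OF not_survives_cem[of t]]) (auto simp: killed_def)

lemma markov_killed_nonneg:
  fixes Z :: "'w \<Rightarrow> real"
  assumes x: "x \<in> space S" and st: "0 \<le> s" "0 \<le> t"
    and Z: "Z \<in> borel_measurable (\<F> s)" "\<And>\<omega>. 0 \<le> Z \<omega>"
    and g[measurable]: "g \<in> borel_measurable S" and g0: "\<And>y. 0 \<le> g y"
    and int: "integrable (P x) (killed g (s + t))"
  shows "integrable (P x) (\<lambda>\<omega>. killed_semigroup t g (X s \<omega>))"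
    and "(\<integral>\<omega>. Z \<omega> * killed g (s + t) \<omega> \<partial>P x) = (\<integral>\<omega>. Z \<omega> * killed_semigroup t g (X s \<omega>) \<partial>P x)"
    and "AE \<omega> in P x. integrable (P (X s \<omega>)) (killed g t)"
proof -
  note [measurable_cong] = sets_P[OF x]
  have Zm[measurable]: "Z \<in> borel_measurable \<Omega>" by (rule measurable_filtration_imp[OF Z(1)])
  have [measurable]: "X s \<in> \<Omega> \<rightarrow>\<^sub>M S" using st by auto
  define N where "N y = (\<integral>\<^sup>+\<omega>'. ennreal (killed g t \<omega>') \<partial>P y)" for y
  have k0: "0 \<le> killed g r \<omega>" for r \<omega> by (simp add: killed_def g0)
  have kk: "ennreal (killed g r \<omega>) = indicator (survives r) \<omega> * ennreal (g (X r \<omega>))" if "0 \<le> r" for r \<omega>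
    using that by (simp add: killed_def max_def split: split_indicator)
  have N[measurable]: "N \<in> borel_measurable S"
    unfolding N_def
    by (rule measurable_compose[OF kernel_subprob nn_integral_measurable_subprob_algebra]) measurable
  have gm: "(\<lambda>y. ennreal (g y)) \<in> borel_measurable S" by measurable
  have nn: "(\<integral>\<^sup>+\<omega>. Y \<omega> * ennreal (killed g (s + t) \<omega>) \<partial>P x) = (\<integral>\<^sup>+\<omega>. Y \<omega> * N (X s \<omega>) \<partial>P x)"
    if "Y \<in> borel_measurable (\<F> s)" for Y
    using nn_markov_survival[OF x st that gm] st by (simp add: kk N_def)
  have fin: "(\<integral>\<^sup>+\<omega>. ennreal (killed g (s + t) \<omega>) \<partial>P x) < \<infinity>"
    using int k0 by (simp add: integrable_iff_bounded)
  have "(\<integral>\<^sup>+\<omega>. N (X s \<omega>) \<partial>P x) < \<infinity>" using nn[of "\<lambda>_. 1"] fin by simp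
  then have AEf: "AE \<omega> in P x. N (X s \<omega>) < \<infinity>"
    using nn_integral_PInf_AE[of "\<lambda>\<omega>. N (X s \<omega>)" "P x"] by (auto simp: top.not_eq_extremum)
  have sp: "AE \<omega> in P x. X s \<omega> \<in> space S" using st by (intro AE_I2) (simp add: space_P[OF x] X_in_space)
  show AEi: "AE \<omega> in P x. integrable (P (X s \<omega>)) (killed g t)"
    using AEf sp
  proof eventually_elim
    case (elim \<omega>)
    then show ?case using k0 by (simp add: integrable_iff_bounded N_def measurable_cong_sets[OF sets_P refl])
  qed
  have eqN: "AE \<omega> in P x. ennreal (killed_semigroup t g (X s \<omega>)) = N (X s \<omega>)"
    using AEi
  proof eventually_elim
    case (elim \<omega>) then show ?case
      unfolding killed_semigroup_def N_def by (intro nn_integral_eq_integral[symmetric]) (auto simp: k0)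
  qed
  have s0: "0 \<le> killed_semigroup t g y" for y unfolding killed_semigroup_def by (intro integral_nonneg_AE) (simp add: k0)
  have eq2: "(\<integral>\<^sup>+\<omega>. ennreal (Y \<omega>) * ennreal (killed g (s + t) \<omega>) \<partial>P x) = (\<integral>\<^sup>+\<omega>. ennreal (Y \<omega>) * ennreal (killed_semigroup t g (X s \<omega>)) \<partial>P x)"
    if "Y \<in> borel_measurable (\<F> s)" for Y
    using nn[of "\<lambda>\<omega>. ennreal (Y \<omega>)"] that eqN by (auto intro!: nn_integral_cong_AE)
  show "integrable (P x) (\<lambda>\<omega>. killed_semigroup t g (X s \<omega>))"
    using eq2[of "\<lambda>_. 1"] fin s0 by (simp add: integrable_iff_bounded)
  show "(\<integral>\<omega>. Z \<omega> * killed g (s + t) \<omega> \<partial>P x) = (\<integral>\<omega>. Z \<omega> * killed_semigroup t g (X s \<omega>) \<partial>P x)"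
    using eq2[OF Z(1)] Z(2) k0 s0
    by (subst (1 2) integral_eq_nn_integral) (auto simp: ennreal_mult)
qed

lemma integrable_bounded_mult:
  fixes h Y :: "'w \<Rightarrow> real"
  assumes x: "x \<in> space S" and h: "integrable (P x) h"
    and Y[measurable]: "Y \<in> borel_measurable \<Omega>" and b: "\<And>\<omega>. \<bar>Y \<omega>\<bar> \<le> C"
  shows "integrable (P x) (\<lambda>\<omega>. Y \<omega> * h \<omega>)"
proof (rule Bochner_Integration.integrable_bound[OF integrable_mult_right[OF integrable_abs[OF h], of C]])
  note [measurable_cong] = sets_P[OF x]
  have "\<bar>Y \<omega>\<bar> * \<bar>h \<omega>\<bar> \<le> \<bar>C\<bar> * \<bar>h \<omega>\<bar>" for \<omega>
    using b[of \<omega>] by (intro mult_right_mono) auto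
  then show "AE \<omega> in P x. norm (Y \<omega> * h \<omega>) \<le> norm (C * \<bar>h \<omega>\<bar>)" by (simp add: abs_mult)
  show "(\<lambda>\<omega>. Y \<omega> * h \<omega>) \<in> borel_measurable (P x)" using h by measurable
qed

lemma markov_killed:
  fixes Z :: "'w \<Rightarrow> real"
  assumes x: "x \<in> space S" and st: "0 \<le> s" "0 \<le> t"
    and Z: "Z \<in> borel_measurable (\<F> s)" "\<And>\<omega>. \<bar>Z \<omega>\<bar> \<le> c"
    and g[measurable]: "g \<in> borel_measurable S"
    and int: "integrable (P x) (killed g (s + t))"
  shows "integrable (P x) (\<lambda>\<omega>. killed_semigroup t g (X s \<omega>))"
    and "(\<integral>\<omega>. Z \<omega> * killed g (s + t) \<omega> \<partial>P x) = (\<integral>\<omega>. Z \<omega> * killed_semigroup t g (X s \<omega>) \<partial>P x)"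
proof -
  note [measurable_cong] = sets_P[OF x]
  have Zm[measurable]: "Z \<in> borel_measurable \<Omega>" by (rule measurable_filtration_imp[OF Z(1)])
  have [measurable]: "X s \<in> \<Omega> \<rightarrow>\<^sub>M S" using st by auto
  let ?p = "\<lambda>y. max 0 (g y)" and ?m = "\<lambda>y. max 0 (- g y)"
  have gp: "?p \<in> borel_measurable S" "?m \<in> borel_measurable S" by measurable
  have kp: "killed ?p r \<omega> = max 0 (killed g r \<omega>)" "killed ?m r \<omega> = max 0 (- killed g r \<omega>)" for r \<omega>
    by (auto simp: killed_def split: split_indicator)
  have ip: "integrable (P x) (killed ?p (s + t))" "integrable (P x) (killed ?m (s + t))"
    using int unfolding kp by auto
  have kd: "killed g r \<omega> = killed ?p r \<omega> - killed ?m r \<omega>" for r \<omega> unfolding kp by auto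
  note P1 = markov_killed_nonneg[OF x st _ _ gp(1) _ ip(1)]
  note P2 = markov_killed_nonneg[OF x st _ _ gp(2) _ ip(2)]
  have sd: "AE \<omega> in P x. killed_semigroup t g (X s \<omega>) = killed_semigroup t ?p (X s \<omega>) - killed_semigroup t ?m (X s \<omega>)"
    using P1(3)[of "\<lambda>_. 1", simplified] P2(3)[of "\<lambda>_. 1", simplified]
  proof eventually_elim
    case (elim \<omega>)
    then show ?case unfolding killed_semigroup_def
      by (subst Bochner_Integration.integral_diff[symmetric]) (auto simp flip: kd)
  qed
  note i1 = P1(1)[of "\<lambda>_. 1", simplified] and i2 = P2(1)[of "\<lambda>_. 1", simplified]
  have "integrable (P x) (\<lambda>\<omega>. killed_semigroup t ?p (X s \<omega>) - killed_semigroup t ?m (X s \<omega>))"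
    using i1 i2 by (rule Bochner_Integration.integrable_diff)
  then show isg: "integrable (P x) (\<lambda>\<omega>. killed_semigroup t g (X s \<omega>))"
  proof (rule integrable_cong_AE_imp)
    show "AE \<omega> in P x. killed_semigroup t ?p (X s \<omega>) - killed_semigroup t ?m (X s \<omega>) = killed_semigroup t g (X s \<omega>)"
      using sd by eventually_elim simp
  qed measurable
  note Zi = integrable_bounded_mult[OF x]
  have pos: "(\<integral>\<omega>. Y \<omega> * killed g (s + t) \<omega> \<partial>P x) = (\<integral>\<omega>. Y \<omega> * killed_semigroup t g (X s \<omega>) \<partial>P x)"
    if Y: "Y \<in> borel_measurable (\<F> s)" "\<And>\<omega>. 0 \<le> Y \<omega>" "\<And>\<omega>. Y \<omega> \<le> C" for Y and C :: real
  proof -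
    have Ym: "Y \<in> borel_measurable \<Omega>" by (rule measurable_filtration_imp[OF Y(1)])
    have Yb: "\<bar>Y \<omega>\<bar> \<le> C" for \<omega> using Y by simp
    have "(\<integral>\<omega>. Y \<omega> * killed g (s + t) \<omega> \<partial>P x) = (\<integral>\<omega>. Y \<omega> * killed ?p (s + t) \<omega> \<partial>P x) - (\<integral>\<omega>. Y \<omega> * killed ?m (s + t) \<omega> \<partial>P x)"
      by (subst Bochner_Integration.integral_diff[symmetric]) (auto intro!: Zi[OF _ Ym Yb] ip simp: kd[of "s + t"] algebra_simps)
    also have "\<dots> = (\<integral>\<omega>. Y \<omega> * killed_semigroup t ?p (X s \<omega>) \<partial>P x) - (\<integral>\<omega>. Y \<omega> * killed_semigroup t ?m (X s \<omega>) \<partial>P x)"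
      using P1(2)[OF Y(1,2)] P2(2)[OF Y(1,2)] by simp
    also have "\<dots> = (\<integral>\<omega>. Y \<omega> * killed_semigroup t ?p (X s \<omega>) - Y \<omega> * killed_semigroup t ?m (X s \<omega>) \<partial>P x)"
      by (subst Bochner_Integration.integral_diff) (auto intro!: Zi[OF _ Ym Yb] i1 i2)
    also have "\<dots> = (\<integral>\<omega>. Y \<omega> * killed_semigroup t g (X s \<omega>) \<partial>P x)"
    proof (rule integral_cong_AE)
      show "AE \<omega> in P x. Y \<omega> * killed_semigroup t ?p (X s \<omega>) - Y \<omega> * killed_semigroup t ?m (X s \<omega>) = Y \<omega> * killed_semigroup t g (X s \<omega>)"
        using sd by eventually_elim (simp add: right_diff_distrib)
    qed (use Ym in measurable)
    finally show ?thesis .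
  qed
  have c: "0 \<le> c" using Z(2) by (meson abs_ge_zero order_trans)
  \<comment> \<open>A constant is added to make the weight nonnegative, and subtracted again afterwards.\<close>
  have Zc: "(\<lambda>\<omega>. Z \<omega> + c) \<in> borel_measurable (\<F> s)" using Z(1) by measurable
  have b: "0 \<le> Z \<omega> + c" "Z \<omega> + c \<le> 2 * c" for \<omega> using Z(2)[of \<omega>] by auto
  have "(\<integral>\<omega>. (Z \<omega> + c) * killed g (s + t) \<omega> \<partial>P x) = (\<integral>\<omega>. (Z \<omega> + c) * killed_semigroup t g (X s \<omega>) \<partial>P x)"
    by (rule pos[OF Zc b])
  moreover have "(\<integral>\<omega>. 1 * killed g (s + t) \<omega> \<partial>P x) = (\<integral>\<omega>. 1 * killed_semigroup t g (X s \<omega>) \<partial>P x)"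
    by (rule pos[where Y="\<lambda>_. 1" and C=1]) auto
  ultimately show "(\<integral>\<omega>. Z \<omega> * killed g (s + t) \<omega> \<partial>P x) = (\<integral>\<omega>. Z \<omega> * killed_semigroup t g (X s \<omega>) \<partial>P x)"
    using Zi[OF int Zm Z(2)] Zi[OF isg Zm Z(2)] int isg by (simp add: distrib_right)
qed

text \<open>
  A path that is alive at time \<open>s\<close> but does not survive \<open>s\<close> dies exactly at \<open>s\<close>, and the law of the
  hitting time has only countably many atoms.
\<close>

lemma AE_alive_survives:
  assumes x: "x \<in> space S"
  shows "AE s in lborel. 0 \<le> s \<longrightarrow> (AE \<omega> in P x. X s \<omega> \<noteq> cem \<longrightarrow> \<omega> \<in> survives s)"
proof -
  let ?\<tau> = "hitting_time X cem"
  have tm: "?\<tau> \<in> borel_measurable (P x)"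
    using hitting_time_measurable by (simp add: measurable_cong_sets[OF sets_P[OF x] refl])
  interpret Px: prob_space "P x" by (rule prob_space_P[OF x])
  interpret D: prob_space "distr (P x) borel ?\<tau>" by (rule Px.prob_space_distr[OF tm])
  define C where "C = {s. measure (distr (P x) borel ?\<tau>) {ereal s} \<noteq> 0}"
  have "countable (ereal ` C)"
    by (rule countable_subset[OF _ D.countable_support]) (auto simp: C_def)
  then have "countable C" by (rule countable_image_inj_on) (auto simp: inj_on_def)
  then have "C \<in> null_sets lborel" by (rule countable_imp_null_set_lborel)
  then show ?thesis
  proof (rule AE_I', intro subsetI)
    fix s assume "s \<in> {s \<in> space lborel. \<not> (0 \<le> s \<longrightarrow> (AE \<omega> in P x. X s \<omega> \<noteq> cem \<longrightarrow> \<omega> \<in> survives s))}"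
    then have s: "0 \<le> s" and n: "\<not> (AE \<omega> in P x. X s \<omega> \<noteq> cem \<longrightarrow> \<omega> \<in> survives s)" by auto
    show "s \<in> C"
    proof (rule ccontr)
      assume "s \<notin> C"
      then have "measure (P x) (?\<tau> -` {ereal s} \<inter> space (P x)) = 0"
        by (simp add: C_def measure_distr[OF tm])
      then have "?\<tau> -` {ereal s} \<inter> space (P x) \<in> null_sets (P x)"
        using tm by (intro null_setsI) (auto simp: Px.emeasure_eq_measure)
      then have "AE \<omega> in P x. \<omega> \<notin> ?\<tau> -` {ereal s} \<inter> space (P x)" by (rule AE_not_in)
      then have "AE \<omega> in P x. X s \<omega> \<noteq> cem \<longrightarrow> \<omega> \<in> survives s"
        using AE_absorbed_path[OF x] AE_space
      proof eventually_elim
        case (elim \<omega>)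
        show ?case
        proof (intro impI, rule ccontr)
          assume alive: "X s \<omega> \<noteq> cem" and "\<omega> \<notin> survives s"
          with elim have "?\<tau> \<omega> < ereal s" by (auto simp: survival_def space_P[OF x])
          then obtain r where "0 \<le> r" "X r \<omega> = cem" "r < s"
            unfolding hitting_time_def by (auto simp: Inf_less_iff)
          with elim alive show False unfolding absorbed_path_def by (metis less_imp_le)
        qed
      qed
      with n show False by simp
    qed
  qed
qed

lemma Fubini_time:
  fixes h :: "real \<Rightarrow> 'w \<Rightarrow> 'b::{banach, second_countable_topology}"
  assumes x: "x \<in> space S" and h[measurable]: "(\<lambda>p. h (fst p) (snd p)) \<in> borel_measurable (borel \<Otimes>\<^sub>M \<Omega>)"
    and H: "integrable (P x) H" and b: "\<And>r \<omega>. \<omega> \<in> space \<Omega> \<Longrightarrow> norm (h r \<omega>) \<le> indicator {0..t::real} r * H \<omega>"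
  shows "(\<integral>\<omega>. (\<integral>r. h r \<omega> \<partial>lborel) \<partial>P x) = (\<integral>r. (\<integral>\<omega>. h r \<omega> \<partial>P x) \<partial>lborel)"
    and "integrable (P x) (\<lambda>\<omega>. \<integral>r. h r \<omega> \<partial>lborel)"
proof -
  note [measurable_cong] = sets_P[OF x]
  interpret Px: prob_space "P x" by (rule prob_space_P[OF x])
  interpret pair_sigma_finite lborel "P x" ..
  have H0: "AE \<omega> in P x. indicator {0..t} r * H \<omega> = norm (indicator {0..t} r * H \<omega>)" for r
    using AE_space
  proof eventually_elim
    case (elim \<omega>)
    then have "0 \<le> indicator {0..t} r * H \<omega>" using b[of \<omega> r] norm_ge_zero order_trans space_P[OF x] by metis
    then show ?case by simp
  qed
  have Hm: "H \<in> borel_measurable (P x)" using H by auto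
  then have [measurable]: "H \<in> borel_measurable \<Omega>" by (simp add: measurable_cong_sets[OF sets_P[OF x] refl])
  have "integrable (lborel \<Otimes>\<^sub>M P x) (\<lambda>p. indicator {0..t} (fst p) * H (snd p))"
  proof (rule Fubini_integrable)
    have "integrable lborel (indicator {0..t} :: real \<Rightarrow> real)"
      by (rule integrable_real_indicator) (cases "0 \<le> t"; simp)+
    then have "integrable lborel (\<lambda>r. indicator {0..t} r * (\<integral>\<omega>. norm (H \<omega>) \<partial>P x))" by simp
    then show "integrable lborel (\<lambda>r. \<integral>\<omega>. norm (indicator {0..t} (fst (r, \<omega>)) * H (snd (r, \<omega>))) \<partial>P x)"
      by (simp add: abs_mult)
  qed (use H in auto)
  then have int: "integrable (lborel \<Otimes>\<^sub>M P x) (\<lambda>(r, \<omega>). h r \<omega>)"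
  proof (rule Bochner_Integration.integrable_bound)
    show "AE p in (lborel :: real measure) \<Otimes>\<^sub>M P x. norm (case p of (r, \<omega>) \<Rightarrow> h r \<omega>) \<le> norm (indicator {0..t} (fst p) * H (snd p))"
    proof (rule AE_I2)
      fix p :: "real \<times> 'w" assume "p \<in> space (lborel \<Otimes>\<^sub>M P x)"
      then have "norm (h (fst p) (snd p)) \<le> indicator {0..t} (fst p) * H (snd p)"
        by (intro b) (auto simp: space_pair_measure space_P[OF x])
      then show "norm (case p of (r, \<omega>) \<Rightarrow> h r \<omega>) \<le> norm (indicator {0..t} (fst p) * H (snd p))"
        by (simp add: split_beta')
    qed
  qed (simp add: split_beta')
  show "(\<integral>\<omega>. (\<integral>r. h r \<omega> \<partial>lborel) \<partial>P x) = (\<integral>r. (\<integral>\<omega>. h r \<omega> \<partial>P x) \<partial>lborel)"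
    by (rule Fubini_integral[OF int])
  show "integrable (P x) (\<lambda>\<omega>. \<integral>r. h r \<omega> \<partial>lborel)"
    by (rule integrable_snd[OF int])
qed

end

section \<open>The oscillating killed semigroup\<close>

locale bounded_functional = absorbed_markov_process \<Omega> S cem X P
  for \<Omega> :: "'w measure" and S :: "'a measure" and cem :: 'a
    and X :: "real \<Rightarrow> 'w \<Rightarrow> 'a" and P :: "'a \<Rightarrow> 'w measure" +
  fixes f :: "'a \<Rightarrow> real" and B :: real
  assumes f_measurable[measurable]: "f \<in> borel_measurable S"
    and f_bounded: "\<bar>f y\<bar> \<le> B"
begin

definition A :: "real \<Rightarrow> 'w \<Rightarrow> real" where
  "A t \<omega> = (LINT s:{0..t}|lborel. f (X (max 0 s) \<omega>))"

lemma B_nonneg: "0 \<le> B"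
  using f_bounded[of undefined] by linarith

lemma A_measurable2[measurable]: "(\<lambda>p. A (fst p) (snd p)) \<in> borel_measurable (borel \<Otimes>\<^sub>M \<Omega>)"
proof -
  have "(\<lambda>q::(real \<times> 'w) \<times> real. (fst (fst q), snd q)) \<in> (borel \<Otimes>\<^sub>M \<Omega>) \<Otimes>\<^sub>M borel \<rightarrow>\<^sub>M borel \<Otimes>\<^sub>M borel" by measurable
  then have [measurable]: "Measurable.pred ((borel \<Otimes>\<^sub>M \<Omega>) \<Otimes>\<^sub>M borel) (\<lambda>q::(real \<times> 'w) \<times> real. snd q \<in> {0..fst (fst q)})"
    using measurable_compose[OF _ pred_snd_le_fst] by fastforce
  have "(\<lambda>q::(real \<times> 'w) \<times> real. (snd q, snd (fst q))) \<in> (borel \<Otimes>\<^sub>M \<Omega>) \<Otimes>\<^sub>M borel \<rightarrow>\<^sub>M borel \<Otimes>\<^sub>M \<Omega>" by measurable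
  from measurable_compose[OF this measurable_X_max]
  have [measurable]: "(\<lambda>q::(real \<times> 'w) \<times> real. X (max 0 (snd q)) (snd (fst q))) \<in> (borel \<Otimes>\<^sub>M \<Omega>) \<Otimes>\<^sub>M borel \<rightarrow>\<^sub>M S" by simp
  have "(\<lambda>q::(real \<times> 'w) \<times> real. indicator {0..fst (fst q)} (snd q) *\<^sub>R f (X (max 0 (snd q)) (snd (fst q)))) \<in> borel_measurable ((borel \<Otimes>\<^sub>M \<Omega>) \<Otimes>\<^sub>M lborel)"
    by measurable
  then show ?thesis
    unfolding A_def set_lebesgue_integral_def
    by (intro lborel.borel_measurable_lebesgue_integral) (simp add: split_beta')
qed

lemma A_measurable[measurable]: "A t \<in> borel_measurable \<Omega>"
  using measurable_compose[OF measurable_Pair1' A_measurable2, of t] by simp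

lemma A_bound: "0 \<le> t \<Longrightarrow> \<bar>A t \<omega>\<bar> \<le> B * t"
  using set_integral_interval_bound[of 0 t "\<lambda>s. f (X (max 0 s) \<omega>)" B] f_bounded B_nonneg unfolding A_def by simp

lemma cis_measurable[measurable]: "cis \<in> borel_measurable borel"
  by (intro borel_measurable_continuous_onI continuous_intros)

lemma path_measurable:
  assumes "\<omega> \<in> space \<Omega>"
  shows "(\<lambda>s. X (max 0 s) \<omega>) \<in> borel \<rightarrow>\<^sub>M S"
  using measurable_compose[OF measurable_Pair2'[OF assms] measurable_X_max] by simp

lemma cis_A:
  assumes w: "\<omega> \<in> space \<Omega>" and t: "0 \<le> t"
  shows "cis (\<theta> * A t \<omega>) = 1 + \<i> * \<theta> * (LINT s:{0..t}|lborel. f (X (max 0 s) \<omega>) *\<^sub>R cis (\<theta> * A s \<omega>))"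
  using cis_primitive[OF measurable_compose[OF path_measurable[OF w] f_measurable] f_bounded t]
  unfolding A_def .

text \<open>
  One factor \<open>A s\<close> is the time integral of \<open>f (X r)\<close> over \<open>r \<le> s\<close>. Each \<open>f (X r)\<close> is known at time \<open>s\<close>
  and can be absorbed into \<open>Z\<close>, which leaves one power less.
\<close>

lemma integral_power_A_eq_0:
  assumes x: "x \<in> space S" and s: "0 \<le> s" and D: "integrable (P x) D"
    and D0: "\<And>Z. Z \<in> borel_measurable (\<F> s) \<Longrightarrow> (\<exists>c. \<forall>\<omega>. \<bar>Z \<omega>\<bar> \<le> c) \<Longrightarrow> (\<integral>\<omega>. Z \<omega> * D \<omega> \<partial>P x) = (0::real)"
    and Z: "Z \<in> borel_measurable (\<F> s)" "\<And>\<omega>. \<bar>Z \<omega>\<bar> \<le> c"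
  shows "(\<integral>\<omega>. Z \<omega> * A s \<omega> ^ n * D \<omega> \<partial>P x) = 0"
  using Z
proof (induction n arbitrary: Z c)
  case 0
  then show ?case using D0[of Z] by auto
next
  case (Suc n)
  note [measurable] = measurable_filtration_imp[OF Suc.prems(1)]
  note [measurable_cong] = sets_P[OF x]
  have [measurable]: "D \<in> borel_measurable \<Omega>"
    using borel_measurable_integrable[OF D] by (simp add: measurable_cong_sets[OF sets_P[OF x] refl])
  have c: "0 \<le> c" using Suc.prems(2) by (meson abs_ge_zero order_trans)
  define h where "h r \<omega> = indicator {0..s} r * (f (X (max 0 r) \<omega>) * (Z \<omega> * A s \<omega> ^ n * D \<omega>))" for r \<omega>
  have [measurable]: "(\<lambda>p. h (fst p) (snd p)) \<in> borel_measurable (borel \<Otimes>\<^sub>M \<Omega>)"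
    unfolding h_def by measurable
  have "(\<integral>\<omega>. Z \<omega> * A s \<omega> ^ Suc n * D \<omega> \<partial>P x) = (\<integral>\<omega>. (\<integral>r. h r \<omega> \<partial>lborel) \<partial>P x)"
  proof (rule Bochner_Integration.integral_cong[OF refl])
    fix \<omega>
    have "(\<integral>r. h r \<omega> \<partial>lborel) = (\<integral>r. (indicator {0..s} r * f (X (max 0 r) \<omega>)) * (Z \<omega> * A s \<omega> ^ n * D \<omega>) \<partial>lborel)"
      by (simp add: h_def mult_ac)
    also have "\<dots> = A s \<omega> * (Z \<omega> * A s \<omega> ^ n * D \<omega>)"
      by (simp add: A_def set_lebesgue_integral_def)
    finally show "Z \<omega> * A s \<omega> ^ Suc n * D \<omega> = (\<integral>r. h r \<omega> \<partial>lborel)" by simp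
  qed
  also have "\<dots> = (\<integral>r. (\<integral>\<omega>. h r \<omega> \<partial>P x) \<partial>lborel)"
  proof (rule Fubini_time[OF x, where H="\<lambda>\<omega>. B * (c * (B * s) ^ n * \<bar>D \<omega>\<bar>)" and t=s])
    fix r \<omega>
    have "\<bar>f (X (max 0 r) \<omega>) * (Z \<omega> * A s \<omega> ^ n * D \<omega>)\<bar> \<le> B * (c * (B * s) ^ n * \<bar>D \<omega>\<bar>)"
      unfolding abs_mult power_abs using B_nonneg c s
      by (intro mult_mono f_bounded Suc.prems power_mono A_bound) auto
    then show "norm (h r \<omega>) \<le> indicator {0..s} r * (B * (c * (B * s) ^ n * \<bar>D \<omega>\<bar>))"
      by (auto simp: h_def split: split_indicator)
  qed (use D in auto)
  also have "\<dots> = (\<integral>r. 0 \<partial>(lborel::real measure))"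
  proof (rule Bochner_Integration.integral_cong[OF refl])
    fix r :: real
    show "(\<integral>\<omega>. h r \<omega> \<partial>P x) = 0"
    proof (cases "r \<in> {0..s}")
      case True
      have "(\<lambda>\<omega>. f (X (max 0 r) \<omega>) * Z \<omega>) \<in> borel_measurable (\<F> s)"
        using Suc.prems(1) measurable_compose[OF measurable_filtration_X f_measurable, of "max 0 r" s] True by auto
      moreover have "\<bar>f (X (max 0 r) \<omega>) * Z \<omega>\<bar> \<le> B * c" for \<omega>
        unfolding abs_mult using B_nonneg by (intro mult_mono f_bounded Suc.prems) auto
      ultimately have "(\<integral>\<omega>. (f (X (max 0 r) \<omega>) * Z \<omega>) * A s \<omega> ^ n * D \<omega> \<partial>P x) = 0" by (rule Suc.IH)
      then show ?thesis using True by (simp add: h_def mult.assoc)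
    qed (simp add: h_def)
  qed
  finally show ?case by simp
qed

lemma norm_exp_partial_sum: "norm (\<Sum>n<N. (z::complex) ^ n /\<^sub>R fact n) \<le> exp (norm z)"
proof -
  have "norm (\<Sum>n<N. z ^ n /\<^sub>R fact n) \<le> (\<Sum>n<N. norm z ^ n /\<^sub>R fact n)"
    by (rule sum_norm_le) (simp add: norm_power)
  also have "\<dots> \<le> (\<Sum>n. norm z ^ n /\<^sub>R fact n)"
    by (rule sum_le_suminf[OF summable_exp_generic]) auto
  also have "\<dots> = exp (norm z)" by (simp add: exp_def)
  finally show ?thesis .
qed

text \<open>
  \<open>A s\<close> need not be measurable for the natural filtration at time \<open>s\<close>, because the process is not
  assumed to be progressive. Its powers are time integrals of functions which are, and the phase is
  a power series.
\<close>

lemma markov_phase: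
  fixes Z :: "'w \<Rightarrow> real"
  assumes x: "x \<in> space S" and st: "0 \<le> s" "0 \<le> t"
    and Z: "Z \<in> borel_measurable (\<F> s)" "\<And>\<omega>. \<bar>Z \<omega>\<bar> \<le> c"
    and g[measurable]: "g \<in> borel_measurable S"
    and int: "integrable (P x) (killed g (s + t))"
  shows "(\<integral>\<omega>. (Z \<omega> * killed g (s + t) \<omega>) *\<^sub>R cis (\<theta> * A s \<omega>) \<partial>P x) = (\<integral>\<omega>. (Z \<omega> * killed_semigroup t g (X s \<omega>)) *\<^sub>R cis (\<theta> * A s \<omega>) \<partial>P x)"
proof -
  note [measurable_cong] = sets_P[OF x]
  note [measurable] = measurable_filtration_imp[OF Z(1)]
  have [measurable]: "X s \<in> \<Omega> \<rightarrow>\<^sub>M S" using st by auto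
  note M = markov_killed[OF x st _ _ g int]
  have isg: "integrable (P x) (\<lambda>\<omega>. killed_semigroup t g (X s \<omega>))" using M(1)[of "\<lambda>_. 0" 0] by simp
  define D where "D \<omega> = killed g (s + t) \<omega> - killed_semigroup t g (X s \<omega>)" for \<omega>
  have D: "integrable (P x) D" unfolding D_def using int isg by simp
  have [measurable]: "D \<in> borel_measurable \<Omega>" unfolding D_def by measurable
  note bi = integrable_bounded_mult[OF x]
  have D0: "(\<integral>\<omega>. Y \<omega> * D \<omega> \<partial>P x) = 0" if Y: "Y \<in> borel_measurable (\<F> s)" "\<exists>c. \<forall>\<omega>. \<bar>Y \<omega>\<bar> \<le> c" for Y
  proof -
    from Y obtain C where C: "\<And>\<omega>. \<bar>Y \<omega>\<bar> \<le> C" by blast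
    show ?thesis
      using M(2)[OF Y(1) C] bi[OF int measurable_filtration_imp[OF Y(1)] C] bi[OF isg measurable_filtration_imp[OF Y(1)] C]
      by (simp add: D_def right_diff_distrib)
  qed
  have c: "0 \<le> c" using Z(2) by (meson abs_ge_zero order_trans)
  have ZD: "integrable (P x) (\<lambda>\<omega>. Z \<omega> * D \<omega>)" by (rule bi[OF D _ Z(2)]) measurable
  let ?z = "\<lambda>\<omega>. \<i> * of_real (\<theta> * A s \<omega>)"
  let ?S = "\<lambda>N \<omega>. (Z \<omega> * D \<omega>) *\<^sub>R (\<Sum>n<N. ?z \<omega> ^ n /\<^sub>R fact n)"
  have "(\<lambda>N. \<integral>\<omega>. ?S N \<omega> \<partial>P x) \<longlonglongrightarrow> (\<integral>\<omega>. (Z \<omega> * D \<omega>) *\<^sub>R cis (\<theta> * A s \<omega>) \<partial>P x)"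
  proof (rule integral_dominated_convergence[where w="\<lambda>\<omega>. \<bar>Z \<omega> * D \<omega>\<bar> * exp (\<bar>\<theta>\<bar> * (B * s))"])
    show "AE \<omega> in P x. (\<lambda>N. ?S N \<omega>) \<longlonglongrightarrow> (Z \<omega> * D \<omega>) *\<^sub>R cis (\<theta> * A s \<omega>)"
      using exp_converges[of "?z _"] by (intro AE_I2 tendsto_scaleR tendsto_const) (simp add: sums_def cis_conv_exp)
    fix N
    show "AE \<omega> in P x. norm (?S N \<omega>) \<le> \<bar>Z \<omega> * D \<omega>\<bar> * exp (\<bar>\<theta>\<bar> * (B * s))"
    proof (rule AE_I2)
      fix \<omega>
      have "norm (\<Sum>n<N. ?z \<omega> ^ n /\<^sub>R fact n) \<le> exp (norm (?z \<omega>))" by (rule norm_exp_partial_sum)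
      also have "\<dots> \<le> exp (\<bar>\<theta>\<bar> * (B * s))"
        using A_bound[OF st(1), of \<omega>] by (simp add: norm_mult abs_mult mult_left_mono)
      finally show "norm (?S N \<omega>) \<le> \<bar>Z \<omega> * D \<omega>\<bar> * exp (\<bar>\<theta>\<bar> * (B * s))"
        unfolding norm_scaleR by (rule mult_left_mono) simp
    qed
    show "integrable (P x) (\<lambda>\<omega>. \<bar>Z \<omega> * D \<omega>\<bar> * exp (\<bar>\<theta>\<bar> * (B * s)))"
      by (intro integrable_mult_left integrable_abs ZD)
  qed measurable
  moreover have "(\<integral>\<omega>. ?S N \<omega> \<partial>P x) = 0" for N
  proof -
    have e: "?S N \<omega> = (\<Sum>n<N. (Z \<omega> * A s \<omega> ^ n * D \<omega>) *\<^sub>R ((\<i> * of_real \<theta>) ^ n /\<^sub>R fact n))" for \<omega>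
      by (simp add: scaleR_sum_right scaleR_conv_of_real power_mult_distrib sum_distrib_left mult_ac)
    have i: "integrable (P x) (\<lambda>\<omega>. Z \<omega> * A s \<omega> ^ n * D \<omega>)" for n
    proof (rule bi[OF D])
      fix \<omega> show "\<bar>Z \<omega> * A s \<omega> ^ n\<bar> \<le> c * (B * s) ^ n"
        unfolding abs_mult power_abs using c by (intro mult_mono Z power_mono A_bound[OF st(1)]) auto
    qed measurable
    have "(\<integral>\<omega>. ?S N \<omega> \<partial>P x) = (\<Sum>n<N. (\<integral>\<omega>. Z \<omega> * A s \<omega> ^ n * D \<omega> \<partial>P x) *\<^sub>R ((\<i> * of_real \<theta>) ^ n /\<^sub>R fact n))"
      unfolding e using i by (subst Bochner_Integration.integral_sum) auto
    then show ?thesis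
      using integral_power_A_eq_0[OF x st(1) D D0 Z] by simp
  qed
  ultimately have "(\<integral>\<omega>. (Z \<omega> * D \<omega>) *\<^sub>R cis (\<theta> * A s \<omega>) \<partial>P x) = 0"
    by (simp add: LIMSEQ_const_iff)
  moreover have ic: "integrable (P x) (\<lambda>\<omega>. h \<omega> *\<^sub>R cis (\<theta> * A s \<omega>))" if "integrable (P x) h" for h
    by (rule Bochner_Integration.integrable_bound[OF that]) (use that in auto)
  have "(\<integral>\<omega>. (Z \<omega> * D \<omega>) *\<^sub>R cis (\<theta> * A s \<omega>) \<partial>P x)
    = (\<integral>\<omega>. (Z \<omega> * killed g (s + t) \<omega>) *\<^sub>R cis (\<theta> * A s \<omega>) \<partial>P x) - (\<integral>\<omega>. (Z \<omega> * killed_semigroup t g (X s \<omega>)) *\<^sub>R cis (\<theta> * A s \<omega>) \<partial>P x)"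
    using ic[OF bi[OF int _ Z(2)]] ic[OF bi[OF isg _ Z(2)]]
    by (subst Bochner_Integration.integral_diff[symmetric]) (auto simp: D_def algebra_simps)
  ultimately show ?thesis by simp
qed

definition phase_semigroup :: "real \<Rightarrow> real \<Rightarrow> ('a \<Rightarrow> real) \<Rightarrow> 'a \<Rightarrow> complex" where
  "phase_semigroup \<theta> t g x = (\<integral>\<omega>. killed g t \<omega> *\<^sub>R cis (\<theta> * A t \<omega>) \<partial>P x)"

lemma phase_semigroup_measurable:
  assumes x: "x \<in> space S" and g[measurable]: "(\<lambda>p. g (fst p) (snd p)) \<in> borel_measurable (borel \<Otimes>\<^sub>M S)"
  shows "(\<lambda>s. phase_semigroup \<theta> s (g s) x) \<in> borel_measurable borel"
proof -
  interpret Px: prob_space "P x" by (rule prob_space_P[OF x])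
  note [measurable_cong] = sets_P[OF x]
  have "(\<lambda>p. (fst p, X (max 0 (fst p)) (snd p))) \<in> borel \<Otimes>\<^sub>M \<Omega> \<rightarrow>\<^sub>M borel \<Otimes>\<^sub>M S" by measurable
  from measurable_compose[OF this g]
  have [measurable]: "(\<lambda>p. killed (g (fst p)) (fst p) (snd p)) \<in> borel_measurable (borel \<Otimes>\<^sub>M \<Omega>)"
    unfolding killed_def by simp
  show ?thesis
    unfolding phase_semigroup_def
    by (rule Px.borel_measurable_lebesgue_integral) (simp add: split_beta')
qed

text \<open>
  The phase at time \<open>t\<close> is expanded by \<open>cis_A\<close>, and the integrand at time \<open>s\<close> is conditioned on the
  path up to \<open>s\<close>. The result involves being alive at \<open>s\<close>; under the time integral this may be replaced
  by survival beyond \<open>s\<close>.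
\<close>

theorem Duhamel:
  assumes x: "x \<in> space S" and t: "0 \<le> t" and g[measurable]: "g \<in> borel_measurable S"
    and int: "integrable (P x) (killed g t)"
  shows "phase_semigroup \<theta> t g x = killed_semigroup t g x
    + \<i> * \<theta> * (LINT s:{0..t}|lborel. phase_semigroup \<theta> s (\<lambda>y. f y * killed_semigroup (t - s) g y) x)"
proof -
  interpret Px: prob_space "P x" by (rule prob_space_P[OF x])
  note [measurable_cong] = sets_P[OF x]
  define h where "h s \<omega> = indicator {0..t} s *\<^sub>R ((f (X (max 0 s) \<omega>) * killed g t \<omega>) *\<^sub>R cis (\<theta> * A s \<omega>))" for s \<omega>
  have hm[measurable]: "(\<lambda>p. h (fst p) (snd p)) \<in> borel_measurable (borel \<Otimes>\<^sub>M \<Omega>)"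
    unfolding h_def by measurable
  have hb: "norm (h s \<omega>) \<le> indicator {0..t} s * (B * \<bar>killed g t \<omega>\<bar>)" for s \<omega>
    using f_bounded by (auto simp: h_def abs_mult split: split_indicator intro!: mult_right_mono)
  have iH: "integrable (P x) (\<lambda>\<omega>. B * \<bar>killed g t \<omega>\<bar>)" using int by simp
  note Fub = Fubini_time[OF x hm iH hb]
  have "phase_semigroup \<theta> t g x = (\<integral>\<omega>. killed g t \<omega> *\<^sub>R 1 + \<i> * \<theta> * (\<integral>s. h s \<omega> \<partial>lborel) \<partial>P x)"
    unfolding phase_semigroup_def
  proof (rule Bochner_Integration.integral_cong[OF refl])
    fix \<omega> assume "\<omega> \<in> space (P x)"
    then have w: "\<omega> \<in> space \<Omega>" by (simp add: space_P[OF x])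
    have "(\<integral>s. h s \<omega> \<partial>lborel) = (\<integral>s. killed g t \<omega> *\<^sub>R (indicator {0..t} s *\<^sub>R (f (X (max 0 s) \<omega>) *\<^sub>R cis (\<theta> * A s \<omega>))) \<partial>lborel)"
      by (simp add: h_def mult_ac)
    also have "\<dots> = killed g t \<omega> *\<^sub>R (LINT s:{0..t}|lborel. f (X (max 0 s) \<omega>) *\<^sub>R cis (\<theta> * A s \<omega>))"
      unfolding set_lebesgue_integral_def by (rule integral_scaleR_right)
    finally show "killed g t \<omega> *\<^sub>R cis (\<theta> * A t \<omega>) = killed g t \<omega> *\<^sub>R 1 + \<i> * \<theta> * (\<integral>s. h s \<omega> \<partial>lborel)"
      unfolding cis_A[OF w t] by (simp add: scaleR_add_right)
  qed
  also have "\<dots> = (\<integral>\<omega>. killed g t \<omega> *\<^sub>R 1 \<partial>P x) + \<i> * \<theta> * (\<integral>\<omega>. (\<integral>s. h s \<omega> \<partial>lborel) \<partial>P x)"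
    using int Fub(2) by (subst Bochner_Integration.integral_add) auto
  also have "(\<integral>\<omega>. killed g t \<omega> *\<^sub>R (1::complex) \<partial>P x) = killed_semigroup t g x"
    using int by (simp add: killed_semigroup_def scaleR_conv_of_real)
  also have "(\<integral>\<omega>. (\<integral>s. h s \<omega> \<partial>lborel) \<partial>P x) = (\<integral>s. (\<integral>\<omega>. h s \<omega> \<partial>P x) \<partial>lborel)"
    by (rule Fub(1))
  also have "\<dots> = (LINT s:{0..t}|lborel. phase_semigroup \<theta> s (\<lambda>y. f y * killed_semigroup (t - s) g y) x)"
    unfolding set_lebesgue_integral_def
  proof (rule integral_cong_AE)
    have "(\<lambda>p :: real \<times> 'a. (t - fst p, snd p)) \<in> borel \<Otimes>\<^sub>M S \<rightarrow>\<^sub>M borel \<Otimes>\<^sub>M S" by measurable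
    from measurable_compose[OF this killed_semigroup_measurable2[OF g]]
    have [measurable]: "(\<lambda>p. killed_semigroup (t - fst p) g (snd p)) \<in> borel_measurable (borel \<Otimes>\<^sub>M S)" by simp
    have [measurable]: "(\<lambda>s. phase_semigroup \<theta> s (\<lambda>y. f y * killed_semigroup (t - s) g y) x) \<in> borel_measurable borel"
      by (rule phase_semigroup_measurable[OF x]) measurable
    show "(\<lambda>s. indicator {0..t} s *\<^sub>R phase_semigroup \<theta> s (\<lambda>y. f y * killed_semigroup (t - s) g y) x) \<in> borel_measurable lborel"
      by measurable
    show "(\<lambda>s. \<integral>\<omega>. h s \<omega> \<partial>P x) \<in> borel_measurable lborel"
      by (rule Px.borel_measurable_lebesgue_integral) (simp add: split_beta')
    show "AE s in lborel. (\<integral>\<omega>. h s \<omega> \<partial>P x) = indicator {0..t} s *\<^sub>R phase_semigroup \<theta> s (\<lambda>y. f y * killed_semigroup (t - s) g y) x"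
      using AE_alive_survives[OF x]
    proof eventually_elim
      case (elim s)
      show ?case
      proof (cases "s \<in> {0..t}")
        case True
        then have s: "0 \<le> s" "0 \<le> t - s" and m: "max 0 s = s" by auto
        have [measurable]: "X s \<in> \<Omega> \<rightarrow>\<^sub>M S" using s by auto
        have fm: "(\<lambda>\<omega>. f (X s \<omega>)) \<in> borel_measurable (\<F> s)"
          by (rule measurable_compose[OF measurable_filtration_X f_measurable]) (use s in auto)
        have "(\<integral>\<omega>. h s \<omega> \<partial>P x) = (\<integral>\<omega>. (f (X s \<omega>) * killed g (s + (t - s)) \<omega>) *\<^sub>R cis (\<theta> * A s \<omega>) \<partial>P x)"
          using True m by (simp add: h_def)
        also have "\<dots> = (\<integral>\<omega>. (f (X s \<omega>) * killed_semigroup (t - s) g (X s \<omega>)) *\<^sub>R cis (\<theta> * A s \<omega>) \<partial>P x)"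
          by (rule markov_phase[OF x s fm f_bounded g]) (use int in simp)
        also have "\<dots> = phase_semigroup \<theta> s (\<lambda>y. f y * killed_semigroup (t - s) g y) x"
          unfolding phase_semigroup_def
        proof (rule integral_cong_AE)
          from elim s have "AE \<omega> in P x. X s \<omega> \<noteq> cem \<longrightarrow> \<omega> \<in> survives s" by simp
          then show "AE \<omega> in P x. (f (X s \<omega>) * killed_semigroup (t - s) g (X s \<omega>)) *\<^sub>R cis (\<theta> * A s \<omega>)
            = killed (\<lambda>y. f y * killed_semigroup (t - s) g y) s \<omega> *\<^sub>R cis (\<theta> * A s \<omega>)"
          proof eventually_elim
            case (elim \<omega>)
            then show ?case
              using killed_semigroup_cem[OF s(2)] X_alive[OF s(1) order_refl, of \<omega>] m
              by (cases "X s \<omega> = cem") (auto simp: killed_def)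
          qed
        qed measurable
        finally show ?thesis using True by simp
      qed (simp add: h_def)
    qed
  qed
  finally show ?thesis .
qed

end

section \<open>Exponential convergence of the rescaled semigroup\<close>

locale exponentially_quasi_ergodic = absorbed_markov_process \<Omega> S cem X P
  for \<Omega> :: "'w measure" and S :: "'a measure" and cem :: 'a
    and X :: "real \<Rightarrow> 'w \<Rightarrow> 'a" and P :: "'a \<Rightarrow> 'w measure" +
  fixes \<alpha> :: "'a measure" and \<eta> \<psi> :: "'a \<Rightarrow> real" and l C \<gamma> :: real
  assumes qsd: "quasi_stationary S cem X P \<alpha>"
    and eta: "right_eigenfunction \<Omega> S cem X P \<alpha> l \<eta>"
    and psi_live: "\<psi> \<in> borel_measurable (live S cem)"
    and psi_ge_1: "\<forall>x\<in>space (live S cem). 1 \<le> \<psi> x"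
    and alpha_psi: "(\<integral>\<^sup>+x. \<psi> x \<partial>\<alpha>) < \<infinity>"
    and eta_psi: "\<eta> \<in> Linf (live S cem) \<psi>"
    and C_pos: "C > 0" and \<gamma>_pos: "\<gamma> > 0"
    and convergence:
      "\<forall>\<nu>\<in>space (prob_algebra (live S cem)). \<forall>t\<ge>0.
         weighted_dist (live S cem) \<psi>
           (scale_measure (ennreal (exp (l * t))) (killed_law \<Omega> S cem X P \<nu> t))
           (scale_measure (\<integral>\<^sup>+x. \<eta> x \<partial>\<nu>) \<alpha>)
         \<le> ennreal C * (\<integral>\<^sup>+x. \<psi> x \<partial>\<nu>) * ennreal (exp (- \<gamma> * t))"
begin

abbreviation "E \<equiv> space S - {cem}"

lemma
  shows \<eta>_live: "\<eta> \<in> borel_measurable (live S cem)"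
    and \<eta>_nonneg_live: "x \<in> E \<Longrightarrow> 0 \<le> \<eta> x"
    and \<eta>_cem: "\<eta> cem = 0"
    and nn_\<alpha>_\<eta>: "(\<integral>\<^sup>+x. ennreal (\<eta> x) \<partial>\<alpha>) = 1"
  using eta unfolding right_eigenfunction_def space_live by blast+

lemma \<eta>_eigen:
  assumes "x \<in> E" "0 \<le> t"
  shows "(\<integral>\<^sup>+\<omega>. indicator (survives t) \<omega> * ennreal (\<eta> (X t \<omega>)) \<partial>P x) = ennreal (exp (- l * t) * \<eta> x)"
proof -
  have "(\<integral>\<^sup>+\<omega>\<in>survives t. ennreal (\<eta> (X t \<omega>)) \<partial>P x) = ennreal (exp (- l * t) * \<eta> x)"
    using eta assms unfolding right_eigenfunction_def space_live by blast
  then show ?thesis by (simp add: mult.commute)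
qed

lemma \<eta>_measurable[measurable]: "\<eta> \<in> borel_measurable S"
  using \<eta>_live cem_measurable by (rule borel_measurable_live_extend)

lemma \<psi>_measurable[measurable]: "\<psi> \<in> borel_measurable S"
  using psi_live cem_measurable by (rule borel_measurable_live_extend)

lemma \<psi>_ge_1: "x \<in> E \<Longrightarrow> 1 \<le> \<psi> x"
  using psi_ge_1 by (simp add: space_live)

lemma \<eta>_nonneg: "x \<in> space S \<Longrightarrow> 0 \<le> \<eta> x"
  using \<eta>_nonneg_live \<eta>_cem by (cases "x = cem") auto

lemma sets_\<alpha>: "sets \<alpha> = sets (live S cem)" and prob_\<alpha>: "prob_space \<alpha>"
  using qsd by (auto simp: quasi_stationary_def space_prob_algebra)

lemma space_\<alpha>: "space \<alpha> = E"
  using sets_eq_imp_space_eq[OF sets_\<alpha>] by (simp add: space_live)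

lemma \<alpha>_measurableI: "g \<in> borel_measurable S \<Longrightarrow> g \<in> borel_measurable \<alpha>"
  using borel_measurable_live_restrict by (simp add: measurable_cong_sets[OF sets_\<alpha> refl])

definition H :: real where
  "H = enn2real (Linf_norm (live S cem) \<psi> \<eta>)"

lemma H_nonneg: "0 \<le> H" by (simp add: H_def)

lemma \<eta>_le: "x \<in> E \<Longrightarrow> \<eta> x \<le> H * \<psi> x"
proof -
  assume x: "x \<in> E"
  have fin: "Linf_norm (live S cem) \<psi> \<eta> < \<infinity>" using eta_psi by (simp add: Linf_def)
  have "ennreal \<bar>\<eta> x / \<psi> x\<bar> \<le> Linf_norm (live S cem) \<psi> \<eta>"
    unfolding Linf_norm_def using x by (intro SUP_upper) (simp add: space_live)
  also have "\<dots> = ennreal H" unfolding H_def using fin by (simp add: less_top)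
  finally have "\<bar>\<eta> x / \<psi> x\<bar> \<le> H" using H_nonneg by simp
  then show ?thesis using \<psi>_ge_1[OF x] \<eta>_nonneg[of x] x by (simp add: field_simps)
qed

text \<open>
  The ball of radius \<open>c\<close> in \<open>L\<^sup>\<infinity>(\<psi>)\<close>. The value at the cemetery is left free, since a killed function
  never sees it.
\<close>

definition dominated :: "real \<Rightarrow> ('a \<Rightarrow> real) \<Rightarrow> bool" where
  "dominated c g \<longleftrightarrow> g \<in> borel_measurable S \<and> 0 \<le> c \<and> (\<forall>y\<in>E. \<bar>g y\<bar> \<le> c * \<psi> y)"

lemma dominated_measurable: "dominated c g \<Longrightarrow> g \<in> borel_measurable S"
  by (simp add: dominated_def)

lemma dominated_abs: "dominated c g \<Longrightarrow> dominated c (\<lambda>y. \<bar>g y\<bar>)"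
  by (auto simp: dominated_def)

lemma integrable_\<psi>: "integrable \<alpha> \<psi>"
proof (rule integrableI_nonneg)
  show "AE x in \<alpha>. 0 \<le> \<psi> x" using \<psi>_ge_1 by (intro AE_I2) (force simp: space_\<alpha>)
qed (use alpha_psi \<alpha>_measurableI[OF \<psi>_measurable] in auto)

lemma integrable_\<alpha>: "dominated c g \<Longrightarrow> integrable \<alpha> g"
  by (rule Bochner_Integration.integrable_bound[OF integrable_mult_right[OF integrable_\<psi>, of c]])
     (auto simp: dominated_def space_\<alpha> intro!: AE_I2 \<alpha>_measurableI intro: order_trans[OF _ abs_ge_self])

lemma \<alpha>_bound: "dominated c g \<Longrightarrow> \<bar>\<integral>y. g y \<partial>\<alpha>\<bar> \<le> c * (\<integral>y. \<psi> y \<partial>\<alpha>)"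
proof -
  assume d: "dominated c g"
  have "norm (\<integral>y. g y \<partial>\<alpha>) \<le> (\<integral>y. c * \<psi> y \<partial>\<alpha>)"
    using d by (intro norm_integral_le) (auto simp: dominated_def space_\<alpha> integrable_\<psi>)
  then show ?thesis by simp
qed

lemma \<alpha>_\<psi>_nonneg: "0 \<le> (\<integral>y. \<psi> y \<partial>\<alpha>)"
  using \<psi>_ge_1 by (intro integral_nonneg_AE AE_I2) (force simp: space_\<alpha>)

lemma dominated_\<eta>: "dominated H \<eta>"
  using \<eta>_le \<eta>_nonneg H_nonneg by (auto simp: dominated_def)

lemma \<alpha>_\<eta>: "(\<integral>y. \<eta> y \<partial>\<alpha>) = 1"
proof -
  have "(\<integral>y. \<eta> y \<partial>\<alpha>) = enn2real (\<integral>\<^sup>+y. \<eta> y \<partial>\<alpha>)"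
    using \<eta>_nonneg by (intro integral_eq_nn_integral \<alpha>_measurableI \<eta>_measurable AE_I2) (auto simp: space_\<alpha>)
  then show ?thesis by (simp add: nn_\<alpha>_\<eta>)
qed

lemma X_in_E: "0 \<le> t \<Longrightarrow> \<omega> \<in> survives t \<Longrightarrow> X t \<omega> \<in> E"
  using X_alive[of t t \<omega>] X_in_space[of t \<omega>] by (auto simp: survival_def)

lemma kernel_live: "P \<in> live S cem \<rightarrow>\<^sub>M subprob_algebra \<Omega>"
  unfolding live_def by (rule measurable_restrict_space1[OF kernel_subprob])

lemma sets_bind_P: "\<nu> \<in> space (prob_algebra (live S cem)) \<Longrightarrow> sets (\<nu> \<bind> P) = sets \<Omega>"
proof -
  assume n: "\<nu> \<in> space (prob_algebra (live S cem))"
  then have s: "sets \<nu> = sets (live S cem)" "prob_space \<nu>" by (auto simp: space_prob_algebra)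
  then have "P \<in> \<nu> \<rightarrow>\<^sub>M subprob_algebra \<Omega>" using kernel_live by (simp add: measurable_cong_sets[OF s(1) refl])
  then show ?thesis using sets_kernel[of P \<nu> \<Omega>] prob_space.not_empty[OF s(2)] by (intro sets_bind) auto
qed

lemma nn_integral_bind_P:
  assumes n: "\<nu> \<in> space (prob_algebra (live S cem))" and k: "k \<in> borel_measurable \<Omega>"
  shows "(\<integral>\<^sup>+\<omega>. k \<omega> \<partial>(\<nu> \<bind> P)) = (\<integral>\<^sup>+x. (\<integral>\<^sup>+\<omega>. k \<omega> \<partial>P x) \<partial>\<nu>)"
proof (rule nn_integral_bind[OF k])
  have s: "sets \<nu> = sets (live S cem)" using n by (auto simp: space_prob_algebra)
  then show "P \<in> \<nu> \<rightarrow>\<^sub>M subprob_algebra \<Omega>" using kernel_live by (simp add: measurable_cong_sets[OF s refl])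
qed

lemma prob_space_bind_P:
  assumes n: "\<nu> \<in> space (prob_algebra (live S cem))"
  shows "prob_space (\<nu> \<bind> P)"
proof
  have s: "sets \<nu> = sets (live S cem)" and p: "prob_space \<nu>" using n by (auto simp: space_prob_algebra)
  have spb: "space (\<nu> \<bind> P) = space \<Omega>" using sets_eq_imp_space_eq[OF sets_bind_P[OF n]] .
  have "emeasure (\<nu> \<bind> P) (space \<Omega>) = (\<integral>\<^sup>+\<omega>. 1 \<partial>(\<nu> \<bind> P))" by (simp add: spb)
  also have "\<dots> = (\<integral>\<^sup>+x. (\<integral>\<^sup>+\<omega>. 1 \<partial>P x) \<partial>\<nu>)" by (rule nn_integral_bind_P[OF n]) simp
  also have "\<dots> = (\<integral>\<^sup>+x. 1 \<partial>\<nu>)"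
    by (rule nn_integral_cong)
       (use sets_eq_imp_space_eq[OF s] in \<open>simp add: space_live prob_space.emeasure_space_1[OF prob_space_P]\<close>)
  also have "\<dots> = 1" by (simp add: prob_space.emeasure_space_1[OF p])
  finally show "emeasure (\<nu> \<bind> P) (space (\<nu> \<bind> P)) = 1" by (simp add: spb)
qed

lemma measurable_X_survives:
  assumes "0 \<le> t" "sets M = sets \<Omega>"
  shows "X t \<in> restrict_space M (survives t) \<rightarrow>\<^sub>M live S cem"
  unfolding live_def
proof (rule measurable_restrict_space2)
  show "X t \<in> restrict_space M (survives t) \<rightarrow>\<^sub>M S"
    using measurable_X[OF assms(1)] by (intro measurable_restrict_space1) (simp add: measurable_cong_sets[OF assms(2) refl])
  show "X t \<in> space (restrict_space M (survives t)) \<rightarrow> E"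
    using X_in_E[OF assms(1)] by (auto simp: space_restrict_space)
qed

lemma nn_integral_killed_law:
  assumes n: "\<nu> \<in> space (prob_algebra (live S cem))" and t: "0 \<le> t" and k: "k \<in> borel_measurable S"
  shows "(\<integral>\<^sup>+y. k y \<partial>killed_law \<Omega> S cem X P \<nu> t) = (\<integral>\<^sup>+x. (\<integral>\<^sup>+\<omega>. indicator (survives t) \<omega> * k (X t \<omega>) \<partial>P x) \<partial>\<nu>)"
proof -
  note sb = sets_bind_P[OF n]
  have Xt: "X t \<in> \<Omega> \<rightarrow>\<^sub>M S" by (rule measurable_X[OF t])
  have "(\<integral>\<^sup>+y. k y \<partial>killed_law \<Omega> S cem X P \<nu> t) = (\<integral>\<^sup>+\<omega>. k (X t \<omega>) \<partial>restrict_space (\<nu> \<bind> P) (survives t))"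
    unfolding killed_law_def
    by (rule nn_integral_distr[OF measurable_X_survives[OF t sb]])
       (use k in \<open>auto simp: live_def intro: measurable_restrict_space1\<close>)
  also have "\<dots> = (\<integral>\<^sup>+\<omega>. k (X t \<omega>) * indicator (survives t) \<omega> \<partial>(\<nu> \<bind> P))"
    by (rule nn_integral_restrict_space) (simp add: sb sets_eq_imp_space_eq[OF sb] sets_survival sets.Int)
  also have "\<dots> = (\<integral>\<^sup>+\<omega>. indicator (survives t) \<omega> * k (X t \<omega>) \<partial>(\<nu> \<bind> P))" by (simp add: mult.commute)
  also have "\<dots> = (\<integral>\<^sup>+x. (\<integral>\<^sup>+\<omega>. indicator (survives t) \<omega> * k (X t \<omega>) \<partial>P x) \<partial>\<nu>)"
    using measurable_compose[OF Xt k] sets_survival[of t] by (intro nn_integral_bind_P[OF n]) measurable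
  finally show ?thesis .
qed

lemma return_in_prob_algebra: "x \<in> E \<Longrightarrow> return (live S cem) x \<in> space (prob_algebra (live S cem))"
  by (simp add: space_prob_algebra prob_space_return space_live)

lemma killed_law_return:
  assumes x: "x \<in> E"
  shows "killed_law \<Omega> S cem X P (return (live S cem) x) t = distr (restrict_space (P x) (survives t)) (live S cem) (X t)"
  unfolding killed_law_def using x by (subst bind_return[OF kernel_live]) (auto simp: space_live)

lemma killed_eq: "0 \<le> t \<Longrightarrow> killed g t \<omega> = indicator (survives t) \<omega> * g (X t \<omega>)"
  by (simp add: killed_def max_def)

lemma
  assumes x: "x \<in> E" and t: "0 \<le> t" and g: "g \<in> borel_measurable S"
  shows integral_killed_law_return: "(\<integral>y. g y \<partial>killed_law \<Omega> S cem X P (return (live S cem) x) t) = killed_semigroup t g x" (is ?I)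
    and integrable_killed_law_return: "integrable (killed_law \<Omega> S cem X P (return (live S cem) x) t) g \<longleftrightarrow> integrable (P x) (killed g t)" (is ?J)
proof -
  have xS: "x \<in> space S" using x by simp
  note ms = measurable_X_survives[OF t sets_P[OF xS]]
  have gl: "g \<in> borel_measurable (live S cem)" using g unfolding live_def by (rule measurable_restrict_space1)
  have sv: "survives t \<inter> space (P x) \<in> sets (P x)"
    by (simp add: sets_P[OF xS] space_P[OF xS] sets_survival sets.Int)
  show ?I
    unfolding killed_law_return[OF x] integral_distr[OF ms gl] integral_restrict_space[OF sv]
    by (simp add: killed_semigroup_def killed_eq[OF t])
  show ?J
    unfolding killed_law_return[OF x] integrable_distr_eq[OF ms gl] integrable_restrict_space[OF sv]
    by (simp add: killed_eq[OF t, abs_def])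
qed

lemma
  fixes M :: "'b measure" and g :: "'b \<Rightarrow> real"
  assumes "g \<in> borel_measurable M" "0 \<le> r"
  shows integral_scale_measure: "(\<integral>x. g x \<partial>scale_measure (ennreal r) M) = r * (\<integral>x. g x \<partial>M)"
    and integrable_scale_measure: "integrable M g \<Longrightarrow> integrable (scale_measure (ennreal r) M) g"
proof -
  have e: "scale_measure (ennreal r) M = density M (\<lambda>_. ennreal r)"
    by (rule measure_eqI) (auto simp: emeasure_density_const)
  show "(\<integral>x. g x \<partial>scale_measure (ennreal r) M) = r * (\<integral>x. g x \<partial>M)"
    unfolding e using assms by (subst integral_density) auto
  show "integrable (scale_measure (ennreal r) M) g" if "integrable M g"
    unfolding e using assms that by (subst integrable_density) auto
qed

lemma convergence_unit_ball:
  assumes x: "x \<in> E" and t: "0 \<le> t" and g: "dominated 1 g" and i: "integrable (P x) (killed g t)"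
  shows "\<bar>exp (l * t) * killed_semigroup t g x - \<eta> x * (\<integral>y. g y \<partial>\<alpha>)\<bar> \<le> C * \<psi> x * exp (- \<gamma> * t)"
proof -
  let ?\<nu> = "return (live S cem) x"
  let ?K = "killed_law \<Omega> S cem X P ?\<nu> t"
  note gS = dominated_measurable[OF g]
  have gl: "g \<in> borel_measurable (live S cem)" by (rule borel_measurable_live_restrict[OF gS])
  have xl: "x \<in> space (live S cem)" using x by (simp add: space_live)
  have ret: "(\<integral>\<^sup>+y. ennreal (h y) \<partial>?\<nu>) = ennreal (h x)" if "h \<in> borel_measurable S" for h
    using that xl by (intro nn_integral_return) (auto intro: borel_measurable_live_restrict)
  have n1: "Linf_norm (live S cem) \<psi> g \<le> 1"
    unfolding Linf_norm_def
  proof (rule SUP_least)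
    fix y assume "y \<in> space (live S cem)"
    then have y: "y \<in> E" by (simp add: space_live)
    then have "\<bar>g y / \<psi> y\<bar> \<le> 1" using g \<psi>_ge_1[OF y] by (auto simp: dominated_def)
    then show "ennreal \<bar>g y / \<psi> y\<bar> \<le> 1" by (simp flip: ennreal_1)
  qed
  have sK: "g \<in> borel_measurable ?K" using gl by (simp add: killed_law_def)
  have "ennreal \<bar>(\<integral>y. g y \<partial>scale_measure (ennreal (exp (l * t))) ?K) - (\<integral>y. g y \<partial>scale_measure (ennreal (\<eta> x)) \<alpha>)\<bar>
     \<le> weighted_dist (live S cem) \<psi> (scale_measure (ennreal (exp (l * t))) ?K) (scale_measure (ennreal (\<eta> x)) \<alpha>)"
    unfolding weighted_dist_def
  proof (rule SUP_upper, intro CollectI conjI)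
    show "g \<in> Linf (live S cem) \<psi>"
      using gl order.strict_trans1[OF n1] by (simp add: Linf_def)
    show "Linf_norm (live S cem) \<psi> g \<le> 1" by (rule n1)
    show "integrable (scale_measure (ennreal (exp (l * t))) ?K) g"
      by (rule integrable_scale_measure[OF sK]) (simp_all add: integrable_killed_law_return[OF x t gS] i)
    show "integrable (scale_measure (ennreal (\<eta> x)) \<alpha>) g"
      using \<eta>_nonneg x by (intro integrable_scale_measure \<alpha>_measurableI gS integrable_\<alpha>[OF g]) auto
  qed
  also have "\<dots> \<le> ennreal C * (\<integral>\<^sup>+y. \<psi> y \<partial>?\<nu>) * ennreal (exp (- \<gamma> * t))"
    using convergence[rule_format, OF return_in_prob_algebra[OF x] t] by (simp only: ret[OF \<eta>_measurable])
  also have "\<dots> = ennreal (C * \<psi> x * exp (- \<gamma> * t))"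
    using C_pos \<psi>_ge_1[OF x] by (simp add: ret ennreal_mult)
  finally have "\<bar>(\<integral>y. g y \<partial>scale_measure (ennreal (exp (l * t))) ?K) - (\<integral>y. g y \<partial>scale_measure (ennreal (\<eta> x)) \<alpha>)\<bar> \<le> C * \<psi> x * exp (- \<gamma> * t)"
    using C_pos \<psi>_ge_1[OF x] by (subst (asm) ennreal_le_iff) auto
  then show ?thesis
    using \<eta>_nonneg[of x] x
    by (simp add: integral_scale_measure[OF sK] integral_scale_measure[OF \<alpha>_measurableI[OF gS]]
        integral_killed_law_return[OF x t gS])
qed

text \<open>
  The operators \<open>R t\<close> on \<open>L\<^sup>\<infinity>(\<psi>)\<close> are bounded by \<open>K\<close> uniformly in time.
\<close>

definition K :: real where "K = H * (\<integral>y. \<psi> y \<partial>\<alpha>) + C"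

lemma K_pos: "0 < K"
  unfolding K_def using H_nonneg \<alpha>_\<psi>_nonneg C_pos by (simp add: add_nonneg_pos)

lemma exp_decay_le_1: "0 \<le> t \<Longrightarrow> exp (- \<gamma> * t) \<le> 1"
  using \<gamma>_pos by simp

text \<open>
  The distance only tests functions that are integrable for both measures, which is not known of
  \<open>\<psi>\<close> itself for the killed law; its bounded truncations are.
\<close>

lemma \<psi>_moment:
  assumes x: "x \<in> E" and t: "0 \<le> t"
  shows "(\<integral>\<^sup>+\<omega>. ennreal (killed \<psi> t \<omega>) \<partial>P x) \<le> ennreal (exp (- l * t) * (K * \<psi> x))"
proof -
  have xS: "x \<in> space S" using x by simp
  note [measurable_cong] = sets_P[OF xS]
  interpret Px: prob_space "P x" by (rule prob_space_P[OF xS])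
  define g where "g n y = min (\<psi> y) (real n)" for n :: nat and y
  have [measurable]: "g n \<in> borel_measurable S" for n unfolding g_def by measurable
  have d: "dominated 1 (g n)" for n using \<psi>_ge_1 by (fastforce simp: dominated_def g_def)
  have kb: "0 \<le> killed (g n) t \<omega>" "killed (g n) t \<omega> \<le> n" for n \<omega>
    using \<psi>_ge_1[OF X_in_E[OF t, of \<omega>]] by (auto simp: killed_eq[OF t] g_def split: split_indicator)
  have i: "integrable (P x) (killed (g n) t)" for n
    using kb by (intro Px.integrable_const_bound[of _ "real n"]) auto
  have bnd: "killed_semigroup t (g n) x \<le> exp (- l * t) * (K * \<psi> x)" for n
  proof -
    have a: "\<bar>\<integral>y. g n y \<partial>\<alpha>\<bar> \<le> (\<integral>y. \<psi> y \<partial>\<alpha>)" using \<alpha>_bound[OF d[of n]] by simp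
    have "exp (l * t) * killed_semigroup t (g n) x \<le> \<eta> x * (\<integral>y. g n y \<partial>\<alpha>) + C * \<psi> x * exp (- \<gamma> * t)"
      using convergence_unit_ball[OF x t d i, of n] by simp
    also have "\<dots> \<le> (H * \<psi> x) * (\<integral>y. \<psi> y \<partial>\<alpha>) + C * \<psi> x * 1"
      using a \<eta>_le[OF x] \<eta>_nonneg[OF xS] \<alpha>_\<psi>_nonneg H_nonneg \<psi>_ge_1[OF x] C_pos exp_decay_le_1[OF t]
      by (intro add_mono mult_mono' mult_left_mono order_trans[OF mult_left_mono[of _ "\<integral>y. \<psi> y \<partial>\<alpha>" "\<eta> x"] mult_right_mono[OF \<eta>_le[OF x]]]) auto
    finally have "exp (l * t) * killed_semigroup t (g n) x \<le> K * \<psi> x" by (simp add: K_def algebra_simps)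
    then have "exp (- l * t) * (exp (l * t) * killed_semigroup t (g n) x) \<le> exp (- l * t) * (K * \<psi> x)" by (rule mult_left_mono) simp
    then show ?thesis by (simp add: mult.assoc[symmetric] flip: exp_add)
  qed
  have "(\<integral>\<^sup>+\<omega>. ennreal (killed \<psi> t \<omega>) \<partial>P x) = (\<integral>\<^sup>+\<omega>. (SUP n. ennreal (killed (g n) t \<omega>)) \<partial>P x)"
  proof (rule nn_integral_cong)
    fix \<omega>
    obtain m :: nat where m: "\<psi> (X t \<omega>) \<le> real m" using real_arch_simple by blast
    have "killed (g n) t \<omega> \<le> killed \<psi> t \<omega>" for n by (auto simp: killed_eq[OF t] g_def split: split_indicator)
    moreover have "killed (g m) t \<omega> = killed \<psi> t \<omega>" using m by (simp add: killed_eq[OF t] g_def)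
    ultimately show "ennreal (killed \<psi> t \<omega>) = (SUP n. ennreal (killed (g n) t \<omega>))"
      by (intro antisym SUP_upper2[of m] SUP_least) (auto intro: ennreal_leI)
  qed
  also have "\<dots> = (SUP n. \<integral>\<^sup>+\<omega>. ennreal (killed (g n) t \<omega>) \<partial>P x)"
  proof (rule nn_integral_monotone_convergence_SUP)
    show "incseq (\<lambda>n \<omega>. ennreal (killed (g n) t \<omega>))"
      by (auto simp: incseq_def le_fun_def killed_eq[OF t] g_def split: split_indicator intro!: ennreal_leI)
  qed measurable
  also have "\<dots> \<le> ennreal (exp (- l * t) * (K * \<psi> x))"
  proof (rule SUP_least)
    fix n
    have "(\<integral>\<^sup>+\<omega>. ennreal (killed (g n) t \<omega>) \<partial>P x) = ennreal (killed_semigroup t (g n) x)"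
      unfolding killed_semigroup_def using kb by (intro nn_integral_eq_integral i) auto
    then show "(\<integral>\<^sup>+\<omega>. ennreal (killed (g n) t \<omega>) \<partial>P x) \<le> ennreal (exp (- l * t) * (K * \<psi> x))"
      using bnd[of n] by (simp add: ennreal_leI)
  qed
  finally show ?thesis .
qed

lemma integrable_killed:
  assumes x: "x \<in> E" and t: "0 \<le> t" and g: "dominated c g"
  shows "integrable (P x) (killed g t)"
proof (rule Bochner_Integration.integrable_bound)
  have xS: "x \<in> space S" using x by simp
  note [measurable_cong] = sets_P[OF xS] and [measurable] = dominated_measurable[OF g]
  have k0: "0 \<le> killed \<psi> t \<omega>" for \<omega>
    using \<psi>_ge_1[OF X_in_E[OF t, of \<omega>]] by (auto simp: killed_eq[OF t] split: split_indicator)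
  have "integrable (P x) (killed \<psi> t)"
    using \<psi>_moment[OF x t] k0 by (intro integrableI_nonneg) (auto intro: order.strict_trans1)
  then show "integrable (P x) (\<lambda>\<omega>. c * killed \<psi> t \<omega>)" by simp
  show "killed g t \<in> borel_measurable (P x)" by measurable
  have "norm (killed g t \<omega>) \<le> norm (c * killed \<psi> t \<omega>)" for \<omega>
    using X_in_E[OF t, of \<omega>] g
    by (auto simp: killed_eq[OF t] dominated_def split: split_indicator intro: order_trans[OF _ abs_ge_self])
  then show "AE \<omega> in P x. norm (killed g t \<omega>) \<le> norm (c * killed \<psi> t \<omega>)" by simp
qed

definition R :: "real \<Rightarrow> ('a \<Rightarrow> real) \<Rightarrow> 'a \<Rightarrow> real" where
  "R t g x = exp (l * t) * killed_semigroup t g x"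

lemma R_convergence:
  assumes x: "x \<in> E" and t: "0 \<le> t" and g: "dominated c g"
  shows "\<bar>R t g x - \<eta> x * (\<integral>y. g y \<partial>\<alpha>)\<bar> \<le> c * C * \<psi> x * exp (- \<gamma> * t)"
proof (cases "c = 0")
  case True
  have "killed g t \<omega> = 0" for \<omega>
    using X_in_E[OF t, of \<omega>] g True by (auto simp: killed_eq[OF t] dominated_def split: split_indicator)
  then have "killed_semigroup t g x = 0" by (simp add: killed_semigroup_def)
  moreover have "(\<integral>y. g y \<partial>\<alpha>) = 0" using \<alpha>_bound[OF g] True by simp
  ultimately show ?thesis using True by (simp add: R_def)
next
  case False
  with g have c: "0 < c" by (simp add: dominated_def)
  have d: "dominated 1 (\<lambda>y. g y / c)"
    using g c by (auto simp: dominated_def divide_le_eq mult.commute)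
  have i: "integrable (P x) (killed (\<lambda>y. g y / c) t)" by (rule integrable_killed[OF x t d])
  have "killed_semigroup t (\<lambda>y. g y / c) x = killed_semigroup t g x / c"
    by (simp add: killed_semigroup_def killed_eq[OF t])
  then have "\<bar>(R t g x - \<eta> x * (\<integral>y. g y \<partial>\<alpha>)) / c\<bar> \<le> C * \<psi> x * exp (- \<gamma> * t)"
    using convergence_unit_ball[OF x t d i] by (simp add: R_def diff_divide_distrib)
  then have "\<bar>R t g x - \<eta> x * (\<integral>y. g y \<partial>\<alpha>)\<bar> / c \<le> C * \<psi> x * exp (- \<gamma> * t)"
    using c by (simp add: abs_divide)
  then show ?thesis using c by (simp add: divide_le_eq mult_ac)
qed

lemma R_decay: "x \<in> E \<Longrightarrow> 0 \<le> t \<Longrightarrow> dominated c g \<Longrightarrow> (\<integral>y. g y \<partial>\<alpha>) = 0 \<Longrightarrow> \<bar>R t g x\<bar> \<le> c * C * \<psi> x * exp (- \<gamma> * t)"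
  using R_convergence[of x t c g] by simp

lemma R_bound:
  assumes x: "x \<in> E" and t: "0 \<le> t" and g: "dominated c g"
  shows "\<bar>R t g x\<bar> \<le> c * K * \<psi> x"
proof -
  have c: "0 \<le> c" using g by (simp add: dominated_def)
  have "\<bar>R t g x\<bar> \<le> \<eta> x * \<bar>\<integral>y. g y \<partial>\<alpha>\<bar> + c * C * \<psi> x * exp (- \<gamma> * t)"
    using R_convergence[OF x t g] \<eta>_nonneg[of x] x abs_triangle_ineq2[of "R t g x" "\<eta> x * (\<integral>y. g y \<partial>\<alpha>)"]
    by (simp add: abs_mult)
  also have "\<dots> \<le> (H * \<psi> x) * (c * (\<integral>y. \<psi> y \<partial>\<alpha>)) + c * C * \<psi> x * 1"
    using \<alpha>_bound[OF g] \<eta>_le[OF x] H_nonneg \<psi>_ge_1[OF x] C_pos exp_decay_le_1[OF t] c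
    by (intro add_mono mult_mono mult_left_mono) auto
  finally show ?thesis by (simp add: K_def algebra_simps)
qed

lemma R_\<eta>:
  assumes x: "x \<in> E" and t: "0 \<le> t"
  shows "R t \<eta> x = \<eta> x"
proof -
  have xS: "x \<in> space S" using x by simp
  note [measurable_cong] = sets_P[OF xS]
  have k0: "0 \<le> killed \<eta> t \<omega>" for \<omega>
    using \<eta>_nonneg[of "X t \<omega>"] X_in_E[OF t, of \<omega>] by (auto simp: killed_eq[OF t] split: split_indicator)
  have "killed_semigroup t \<eta> x = enn2real (\<integral>\<^sup>+\<omega>. ennreal (killed \<eta> t \<omega>) \<partial>P x)"
    unfolding killed_semigroup_def by (rule integral_eq_nn_integral) (use k0 in auto)
  also have "(\<integral>\<^sup>+\<omega>. ennreal (killed \<eta> t \<omega>) \<partial>P x) = (\<integral>\<^sup>+\<omega>. indicator (survives t) \<omega> * ennreal (\<eta> (X t \<omega>)) \<partial>P x)"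
    by (intro nn_integral_cong) (auto simp: killed_eq[OF t] split: split_indicator)
  also have "\<dots> = ennreal (exp (- l * t) * \<eta> x)" by (rule \<eta>_eigen[OF x t])
  finally show ?thesis
    using \<eta>_nonneg[OF xS] by (simp add: R_def mult.assoc[symmetric] flip: exp_add)
qed

text \<open>
  The value \<open>exp (- l t)\<close> of the survival probability from \<open>\<alpha>\<close> comes from testing quasi-stationarity
  against \<open>\<eta>\<close>, whose killed mean under \<open>\<alpha>\<close> is known.
\<close>

lemma nn_integral_\<alpha>_killed:
  assumes t: "0 \<le> t" and k[measurable]: "k \<in> borel_measurable S"
  shows "(\<integral>\<^sup>+x. (\<integral>\<^sup>+\<omega>. indicator (survives t) \<omega> * k (X t \<omega>) \<partial>P x) \<partial>\<alpha>) = ennreal (exp (- l * t)) * (\<integral>\<^sup>+y. k y \<partial>\<alpha>)"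
proof -
  have a: "\<alpha> \<in> space (prob_algebra (live S cem))" using qsd by (simp add: quasi_stationary_def)
  note sb = sets_bind_P[OF a]
  have spb: "space (\<alpha> \<bind> P) = space \<Omega>" using sets_eq_imp_space_eq[OF sb] .
  have probb: "prob_space (\<alpha> \<bind> P)" by (rule prob_space_bind_P[OF a])
  interpret Pa: prob_space "\<alpha> \<bind> P" by (rule probb)
  define m where "m = measure (\<alpha> \<bind> P) (survives t)"
  have m0: "0 \<le> m" by (simp add: m_def)
  have cp: "measure (\<alpha> \<bind> P) {\<omega> \<in> space \<Omega>. X t \<omega> \<in> A \<and> ereal t < hitting_time X cem \<omega>} / m = measure \<alpha> A"
    if "A \<in> sets (live S cem)" for A
    using qsd t that by (simp add: quasi_stationary_def cond_prob_def spb m_def survival_def)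
  have "m \<noteq> 0" using cp[of "space (live S cem)"] prob_space.prob_space[OF prob_\<alpha>] sets_eq_imp_space_eq[OF sets_\<alpha>] by auto
  then have cp': "measure (\<alpha> \<bind> P) {\<omega> \<in> space \<Omega>. X t \<omega> \<in> A \<and> ereal t < hitting_time X cem \<omega>} = m * measure \<alpha> A"
    if "A \<in> sets (live S cem)" for A using cp[OF that] by (simp add: field_simps)
  let ?N = "killed_law \<Omega> S cem X P \<alpha> t"
  have "?N = scale_measure (ennreal m) \<alpha>"
  proof (rule measure_eqI)
    show "sets ?N = sets (scale_measure (ennreal m) \<alpha>)" by (simp add: killed_law_def sets_\<alpha>)
    fix A assume "A \<in> sets ?N"
    then have A: "A \<in> sets (live S cem)" by (simp add: killed_law_def)
    have "emeasure ?N A = emeasure (restrict_space (\<alpha> \<bind> P) (survives t)) (X t -` A \<inter> space (restrict_space (\<alpha> \<bind> P) (survives t)))"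
      unfolding killed_law_def by (rule emeasure_distr[OF measurable_X_survives[OF t sb] A])
    also have "\<dots> = emeasure (\<alpha> \<bind> P) (X t -` A \<inter> space (restrict_space (\<alpha> \<bind> P) (survives t)))"
      by (rule emeasure_restrict_space) (auto simp: sb spb sets_survival sets.Int space_restrict_space)
    also have "X t -` A \<inter> space (restrict_space (\<alpha> \<bind> P) (survives t)) = {\<omega> \<in> space \<Omega>. X t \<omega> \<in> A \<and> ereal t < hitting_time X cem \<omega>}"
      by (auto simp: space_restrict_space spb survival_def)
    also have "emeasure (\<alpha> \<bind> P) \<dots> = ennreal (m * measure \<alpha> A)"
      by (simp add: Pa.emeasure_eq_measure cp'[OF A])
    also have "\<dots> = emeasure (scale_measure (ennreal m) \<alpha>) A"
      using m0 by (simp add: ennreal_mult finite_measure.emeasure_eq_measure[OF prob_space.finite_measure[OF prob_\<alpha>]])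
    finally show "emeasure ?N A = emeasure (scale_measure (ennreal m) \<alpha>) A" .
  qed
  then have nn: "(\<integral>\<^sup>+x. (\<integral>\<^sup>+\<omega>. indicator (survives t) \<omega> * h (X t \<omega>) \<partial>P x) \<partial>\<alpha>) = ennreal m * (\<integral>\<^sup>+y. h y \<partial>\<alpha>)"
    if h: "h \<in> borel_measurable S" for h
    using nn_integral_killed_law[OF a t h] nn_integral_scale_measure[OF \<alpha>_measurableI[OF h], of "ennreal m"] by simp
  have "ennreal m = (\<integral>\<^sup>+x. (\<integral>\<^sup>+\<omega>. indicator (survives t) \<omega> * ennreal (\<eta> (X t \<omega>)) \<partial>P x) \<partial>\<alpha>)"
    using nn[of "\<lambda>y. ennreal (\<eta> y)"] by (simp add: nn_\<alpha>_\<eta>)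
  also have "\<dots> = (\<integral>\<^sup>+x. ennreal (exp (- l * t)) * ennreal (\<eta> x) \<partial>\<alpha>)"
  proof (rule nn_integral_cong)
    fix x assume "x \<in> space \<alpha>"
    then show "(\<integral>\<^sup>+\<omega>. indicator (survives t) \<omega> * ennreal (\<eta> (X t \<omega>)) \<partial>P x) = ennreal (exp (- l * t)) * ennreal (\<eta> x)"
      using t \<eta>_nonneg by (simp add: \<eta>_eigen space_\<alpha> ennreal_mult)
  qed
  also have "\<dots> = ennreal (exp (- l * t))"
    using \<alpha>_measurableI[OF \<eta>_measurable] by (subst nn_integral_cmult) (auto simp: nn_\<alpha>_\<eta>)
  finally show ?thesis using nn[OF k] by simp
qed

end

section \<open>Convergence of the oscillating semigroup at the diffusive scale\<close>

lemma continuous_on_primitive: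
  fixes g :: "real \<Rightarrow> 'b::{banach, second_countable_topology}"
  assumes [measurable]: "g \<in> borel_measurable borel" and b: "\<And>s. 0 \<le> s \<Longrightarrow> norm (g s) \<le> M"
  shows "continuous_on {0..T} (\<lambda>t. LINT s:{0..t}|lborel. g s)"
proof -
  have M: "0 \<le> M" using b[of 0] by (meson norm_ge_zero order_refl order_trans)
  have L: "norm ((LINT r:{0..t}|lborel. g r) - (LINT r:{0..s}|lborel. g r)) \<le> M * (t - s)" if "0 \<le> s" "s \<le> t" for s t
  proof -
    have "(LINT r:{0..t}|lborel. g r) = (LINT r:{0..s}|lborel. g r) + (LINT r:{s..t}|lborel. g r)"
      by (rule set_integral_interval_split[OF set_integrable_bounded_interval[where B=M]]) (use that b in auto)
    then show ?thesis using set_integral_interval_bound[of s t g M] that b M by simp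
  qed
  have "M-lipschitz_on {0..T} (\<lambda>t. LINT s:{0..t}|lborel. g s)"
  proof (rule lipschitz_onI[OF _ M])
    fix s t assume "s \<in> {0..T}" "t \<in> {0..T}"
    then show "dist (LINT r:{0..s}|lborel. g r) (LINT r:{0..t}|lborel. g r) \<le> M * dist s t"
      using L[of s t] L[of t s] by (cases "s \<le> t") (auto simp: dist_norm norm_minus_commute dist_real_def)
  qed
  then show ?thesis by (rule lipschitz_on_continuous_on)
qed

lemma
  assumes "0 \<le> t" "0 < (\<gamma>::real)"
  shows set_integral_exp_decay: "(LINT s:{0..t}|lborel. exp (- \<gamma> * s)) \<le> 1 / \<gamma>"
    and set_integral_exp_decay_reversed: "(LINT s:{0..t}|lborel. exp (- \<gamma> * (t - s))) \<le> 1 / \<gamma>"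
proof -
  have "(LINT s:{0..t}|lborel. exp (- \<gamma> * s)) = - exp (- \<gamma> * t) / \<gamma> - (- exp (- \<gamma> * 0) / \<gamma>)"
    unfolding set_lebesgue_integral_def
    by (rule integral_FTC_atLeastAtMost[OF assms(1)])
       (use assms in \<open>auto intro!: derivative_eq_intros continuous_intros simp: has_real_derivative_iff_has_vector_derivative[symmetric]\<close>)
  then show "(LINT s:{0..t}|lborel. exp (- \<gamma> * s)) \<le> 1 / \<gamma>" using assms by (simp add: diff_divide_distrib[symmetric] divide_right_mono)
  have "(LINT s:{0..t}|lborel. exp (- \<gamma> * (t - s))) = exp (- \<gamma> * (t - t)) / \<gamma> - exp (- \<gamma> * (t - 0)) / \<gamma>"
    unfolding set_lebesgue_integral_def
    by (rule integral_FTC_atLeastAtMost[OF assms(1)])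
       (use assms in \<open>auto intro!: derivative_eq_intros continuous_intros simp: has_real_derivative_iff_has_vector_derivative[symmetric]\<close>)
  then show "(LINT s:{0..t}|lborel. exp (- \<gamma> * (t - s))) \<le> 1 / \<gamma>" using assms by (simp add: diff_divide_distrib[symmetric] divide_right_mono)
qed

lemma set_integrable_exp: "set_integrable lborel {s..t} (\<lambda>r. exp (a * r + b :: real))"
  by (intro borel_integrable_atLeastAtMost' continuous_intros)

lemma norm_set_integral_le:
  fixes F :: "real \<Rightarrow> 'b::{banach, second_countable_topology}"
  assumes "set_integrable lborel A G" "\<And>s. s \<in> A \<Longrightarrow> norm (F s) \<le> G s"
  shows "norm (LINT s:A|lborel. F s) \<le> (LINT s:A|lborel. G s)"
  unfolding set_lebesgue_integral_def
  by (rule norm_integral_le) (use assms in \<open>auto simp: set_integrable_def split: split_indicator\<close>)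

lemma norm_set_integral_exp_decay_reversed:
  fixes F :: "real \<Rightarrow> 'b::{banach, second_countable_topology}"
  assumes t: "0 \<le> t" "0 < \<gamma>" "0 \<le> D"
    and F: "\<And>s. 0 \<le> s \<Longrightarrow> s \<le> t \<Longrightarrow> norm (F s) \<le> D * exp (- \<gamma> * (t - s))"
  shows "norm (LINT s:{0..t}|lborel. F s) \<le> D / \<gamma>"
proof -
  have "set_integrable lborel {0..t} (\<lambda>s. D * exp (- \<gamma> * (t - s)))"
    using set_integrable_exp[of 0 t "\<gamma>" "-\<gamma> * t"] by (simp add: algebra_simps)
  then have "norm (LINT s:{0..t}|lborel. F s) \<le> (LINT s:{0..t}|lborel. D * exp (- \<gamma> * (t - s)))"
    by (rule norm_set_integral_le) (use F in auto)
  also have "\<dots> \<le> D / \<gamma>"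
    using mult_left_mono[OF set_integral_exp_decay_reversed[OF t(1,2)] t(3)] by simp
  finally show ?thesis .
qed

lemma
  assumes "0 < (\<gamma>::real)"
  shows set_integrable_exp_tail: "set_integrable lborel {u..} (\<lambda>q. exp (- \<gamma> * q))"
    and set_integral_exp_tail: "(LINT q:{u..}|lborel. exp (- \<gamma> * q)) = exp (- \<gamma> * u) / \<gamma>"
proof -
  have "(\<integral>\<^sup>+q. ennreal (exp (- \<gamma> * q)) * indicator {u..} q \<partial>lborel) = ennreal (0 - (- exp (- \<gamma> * u) / \<gamma>))"
  proof (rule nn_integral_FTC_atLeast)
    have "((\<lambda>q. exp (- \<gamma> * q)) \<longlongrightarrow> 0) at_top"
      using assms by real_asymp
    from tendsto_divide[OF tendsto_minus[OF this] tendsto_const, of \<gamma>]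
    show "((\<lambda>q. - exp (- \<gamma> * q) / \<gamma>) \<longlongrightarrow> 0) at_top" using assms by simp
  qed (use assms in \<open>auto intro!: derivative_eq_intros\<close>)
  then have "(\<integral>\<^sup>+q. ennreal (indicator {u..} q *\<^sub>R exp (- \<gamma> * q)) \<partial>lborel) = ennreal (exp (- \<gamma> * u) / \<gamma>)"
    by (simp add: ennreal_mult' ennreal_indicator mult.commute)
  then have "has_bochner_integral lborel (\<lambda>q. indicator {u..} q *\<^sub>R exp (- \<gamma> * q)) (exp (- \<gamma> * u) / \<gamma>)"
    using assms by (intro has_bochner_integral_nn_integral) auto
  then show "set_integrable lborel {u..} (\<lambda>q. exp (- \<gamma> * q))"
    "(LINT q:{u..}|lborel. exp (- \<gamma> * q)) = exp (- \<gamma> * u) / \<gamma>"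
    by (auto simp: set_integrable_def set_lebesgue_integral_def has_bochner_integral_iff)
qed

locale centred_functional = exponentially_quasi_ergodic \<Omega> S cem X P \<alpha> \<eta> \<psi> l C \<gamma> + bounded_functional \<Omega> S cem X P f B
  for \<Omega> :: "'w measure" and S :: "'a measure" and cem :: 'a
    and X :: "real \<Rightarrow> 'w \<Rightarrow> 'a" and P :: "'a \<Rightarrow> 'w measure"
    and \<alpha> :: "'a measure" and \<eta> \<psi> f :: "'a \<Rightarrow> real" and l C \<gamma> B :: real +
  assumes f_centred: "(\<integral>y. f y * \<eta> y \<partial>\<alpha>) = 0"
begin

text \<open>
  The rescaled Feynman-Kac semigroup with potential \<open>\<i> \<theta> f\<close>.
\<close>

definition G :: "real \<Rightarrow> real \<Rightarrow> ('a \<Rightarrow> real) \<Rightarrow> 'a \<Rightarrow> complex" where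
  "G \<theta> t w x = exp (l * t) *\<^sub>R phase_semigroup \<theta> t w x"

lemma dominated_f: "dominated c g \<Longrightarrow> dominated (B * c) (\<lambda>y. f y * g y)"
  using f_bounded B_nonneg by (auto simp: dominated_def abs_mult mult.assoc intro!: mult_mono)

lemma dominated_R_decay: "dominated c g \<Longrightarrow> (\<integral>y. g y \<partial>\<alpha>) = 0 \<Longrightarrow> 0 \<le> t \<Longrightarrow> dominated (c * C * exp (- \<gamma> * t)) (R t g)"
  using R_decay[of _ t c g] C_pos killed_semigroup_measurable[of g t] unfolding dominated_def R_def by (auto simp: mult_ac)

lemma dominated_add: "dominated c g \<Longrightarrow> dominated d h \<Longrightarrow> dominated (c + d) (\<lambda>y. g y + h y)"
  unfolding dominated_def by (auto simp: distrib_right intro: order_trans[OF abs_triangle_ineq add_mono])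

lemma dominated_scale: "dominated c g \<Longrightarrow> dominated (\<bar>a\<bar> * c) (\<lambda>y. a * g y)"
  unfolding dominated_def by (auto simp: abs_mult mult.assoc mult_left_mono)

lemma dominated_mono: "dominated c g \<Longrightarrow> c \<le> d \<Longrightarrow> dominated d g"
proof -
  assume d: "dominated c g" and cd: "c \<le> d"
  have "\<bar>g y\<bar> \<le> d * \<psi> y" if y: "y \<in> E" for y
  proof -
    have "\<bar>g y\<bar> \<le> c * \<psi> y" using d y by (simp add: dominated_def)
    also have "\<dots> \<le> d * \<psi> y" using cd \<psi>_ge_1[OF y] by (intro mult_right_mono) auto
    finally show ?thesis .
  qed
  then show ?thesis using d cd by (auto simp: dominated_def)
qed

lemma G_bound:
  assumes x: "x \<in> E" and t: "0 \<le> t" and w: "dominated c w"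
  shows "norm (G \<theta> t w x) \<le> c * K * \<psi> x"
proof -
  have "norm (phase_semigroup \<theta> t w x) \<le> killed_semigroup t (\<lambda>y. \<bar>w y\<bar>) x"
    unfolding phase_semigroup_def killed_semigroup_def
    using integrable_killed[OF x t dominated_abs[OF w]]
    by (intro norm_integral_le) (auto simp: killed_def[abs_def] abs_mult)
  then have "norm (G \<theta> t w x) \<le> R t (\<lambda>y. \<bar>w y\<bar>) x" by (simp add: G_def R_def)
  then show ?thesis using R_bound[OF x t dominated_abs[OF w]] by simp
qed

lemma G_integrable:
  assumes x: "x \<in> E" and t: "0 \<le> t" and w: "dominated c w"
  shows "integrable (P x) (\<lambda>\<omega>. killed w t \<omega> *\<^sub>R cis (\<theta> * A t \<omega>))"
proof -
  have xS: "x \<in> space S" using x by simp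
  note [measurable_cong] = sets_P[OF xS] and [measurable] = dominated_measurable[OF w]
  show ?thesis
    by (rule Bochner_Integration.integrable_bound[OF integrable_killed[OF x t w]]) auto
qed

lemma G_add:
  assumes "x \<in> E" "0 \<le> t" "dominated c g" "dominated d h"
  shows "G \<theta> t (\<lambda>y. g y + h y) x = G \<theta> t g x + G \<theta> t h x"
proof -
  have "phase_semigroup \<theta> t (\<lambda>y. g y + h y) x = phase_semigroup \<theta> t g x + phase_semigroup \<theta> t h x"
    unfolding phase_semigroup_def
    using G_integrable[OF assms(1,2,3), of \<theta>] G_integrable[OF assms(1,2,4), of \<theta>]
    by (subst Bochner_Integration.integral_add[symmetric]) (auto simp: killed_def algebra_simps)
  then show ?thesis by (simp add: G_def scaleR_add_right)
qed

lemma phase_semigroup_scale: "phase_semigroup \<theta> t (\<lambda>y. a * g y) x = a *\<^sub>R phase_semigroup \<theta> t g x"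
proof -
  have "phase_semigroup \<theta> t (\<lambda>y. a * g y) x = (\<integral>\<omega>. a *\<^sub>R (killed g t \<omega> *\<^sub>R cis (\<theta> * A t \<omega>)) \<partial>P x)"
    unfolding phase_semigroup_def by (simp add: killed_def mult_ac)
  also have "\<dots> = a *\<^sub>R (\<integral>\<omega>. killed g t \<omega> *\<^sub>R cis (\<theta> * A t \<omega>) \<partial>P x)" by (rule integral_scaleR_right)
  finally show ?thesis unfolding phase_semigroup_def .
qed

lemma G_scale: "G \<theta> t (\<lambda>y. a * g y) x = a *\<^sub>R G \<theta> t g x"
  by (simp add: G_def phase_semigroup_scale mult_ac)

lemma G_cong:
  assumes "0 \<le> t" "\<And>y. y \<in> E \<Longrightarrow> g y = h y"
  shows "G \<theta> t g x = G \<theta> t h x"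
proof -
  have "killed g t \<omega> = killed h t \<omega>" for \<omega>
    using X_in_E[OF assms(1), of \<omega>] assms by (auto simp: killed_eq split: split_indicator)
  then show ?thesis by (simp add: G_def phase_semigroup_def)
qed

lemma G_measurable:
  assumes x: "x \<in> space S" and g: "(\<lambda>p. g (fst p) (snd p)) \<in> borel_measurable (borel \<Otimes>\<^sub>M S)"
  shows "(\<lambda>s. G \<theta> s (g s) x) \<in> borel_measurable borel"
  unfolding G_def using phase_semigroup_measurable[OF x g] by measurable

lemma R_measurable2:
  assumes [measurable]: "g \<in> borel_measurable S"
  shows "(\<lambda>p. R (fst p) g (snd p)) \<in> borel_measurable (borel \<Otimes>\<^sub>M S)"
  unfolding R_def by measurable

lemma G_Duhamel:
  assumes x: "x \<in> E" and t: "0 \<le> t" and g: "dominated c g"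
  shows "G \<theta> t g x = R t g x + \<i> * \<theta> * (LINT s:{0..t}|lborel. G \<theta> s (\<lambda>y. f y * R (t - s) g y) x)"
proof -
  have xS: "x \<in> space S" using x by simp
  have "exp (l * t) *\<^sub>R (LINT s:{0..t}|lborel. phase_semigroup \<theta> s (\<lambda>y. f y * killed_semigroup (t - s) g y) x)
      = (LINT s:{0..t}|lborel. exp (l * t) *\<^sub>R phase_semigroup \<theta> s (\<lambda>y. f y * killed_semigroup (t - s) g y) x)"
    by simp
  also have "\<dots> = (LINT s:{0..t}|lborel. G \<theta> s (\<lambda>y. f y * R (t - s) g y) x)"
  proof (rule arg_cong[where f="\<lambda>h. set_lebesgue_integral lborel {0..t} h"], rule ext)
    fix s
    have "G \<theta> s (\<lambda>y. f y * R (t - s) g y) x = exp (l * s) *\<^sub>R phase_semigroup \<theta> s (\<lambda>y. exp (l * (t - s)) * (f y * killed_semigroup (t - s) g y)) x"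
      by (simp add: G_def R_def mult_ac)
    also have "\<dots> = exp (l * t) *\<^sub>R phase_semigroup \<theta> s (\<lambda>y. f y * killed_semigroup (t - s) g y) x"
      unfolding phase_semigroup_scale by (simp add: algebra_simps flip: exp_add)
    finally show "exp (l * t) *\<^sub>R phase_semigroup \<theta> s (\<lambda>y. f y * killed_semigroup (t - s) g y) x = G \<theta> s (\<lambda>y. f y * R (t - s) g y) x" by simp
  qed
  finally have e: "exp (l * t) *\<^sub>R (LINT s:{0..t}|lborel. phase_semigroup \<theta> s (\<lambda>y. f y * killed_semigroup (t - s) g y) x)
     = (LINT s:{0..t}|lborel. G \<theta> s (\<lambda>y. f y * R (t - s) g y) x)" .
  have "G \<theta> t g x = exp (l * t) *\<^sub>R (of_real (killed_semigroup t g x)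
    + \<i> * \<theta> * (LINT s:{0..t}|lborel. phase_semigroup \<theta> s (\<lambda>y. f y * killed_semigroup (t - s) g y) x))"
    unfolding G_def Duhamel[OF xS t dominated_measurable[OF g] integrable_killed[OF x t g]] ..
  also have "\<dots> = R t g x + \<i> * \<theta> * (exp (l * t) *\<^sub>R (LINT s:{0..t}|lborel. phase_semigroup \<theta> s (\<lambda>y. f y * killed_semigroup (t - s) g y) x))"
    by (simp add: R_def scaleR_conv_of_real distrib_left mult_ac)
  finally show ?thesis unfolding e .
qed

definition L :: real where "L = C + B * C * K / \<gamma>"

lemma L_pos: "0 < L"
  unfolding L_def using C_pos B_nonneg K_pos \<gamma>_pos by (simp add: add_pos_nonneg)

text \<open>
  Both terms of Duhamel's formula inherit the exponential decay of \<open>R\<close> on \<open>\<alpha>\<close>-centred functions; the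
  second one carries the factor \<open>\<theta>\<close> and integrates \<open>exp (- \<gamma> (t - s))\<close> over \<open>s\<close>.
\<close>

lemma G_decay:
  assumes x: "x \<in> E" and t: "0 \<le> t" and w: "dominated c w" and w0: "(\<integral>y. w y \<partial>\<alpha>) = 0"
  shows "norm (G \<theta> t w x) \<le> c * L * \<psi> x * (exp (- \<gamma> * t) + \<bar>\<theta>\<bar>)"
proof -
  have c: "0 \<le> c" using w by (simp add: dominated_def)
  have px: "0 \<le> \<psi> x" using \<psi>_ge_1[OF x] by simp
  have "norm (LINT s:{0..t}|lborel. G \<theta> s (\<lambda>y. f y * R (t - s) w y) x) \<le> (c * (B * C * K) * \<psi> x) / \<gamma>"
  proof (rule norm_set_integral_exp_decay_reversed[OF t \<gamma>_pos])
    show "0 \<le> c * (B * C * K) * \<psi> x" using c B_nonneg C_pos K_pos px by simp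
    fix s assume s: "0 \<le> s" "s \<le> t"
    have "dominated (B * (c * C * exp (- \<gamma> * (t - s)))) (\<lambda>y. f y * R (t - s) w y)"
      by (rule dominated_f[OF dominated_R_decay[OF w w0]]) (use s in simp)
    from G_bound[OF x s(1) this, of \<theta>]
    show "norm (G \<theta> s (\<lambda>y. f y * R (t - s) w y) x) \<le> c * (B * C * K) * \<psi> x * exp (- \<gamma> * (t - s))"
      by (simp only: mult_ac)
  qed
  moreover have "norm (G \<theta> t w x) \<le> \<bar>R t w x\<bar> + \<bar>\<theta>\<bar> * norm (LINT s:{0..t}|lborel. G \<theta> s (\<lambda>y. f y * R (t - s) w y) x)"
    unfolding G_Duhamel[OF x t w] by (rule order_trans[OF norm_triangle_ineq]) (simp add: norm_mult)
  ultimately have "norm (G \<theta> t w x) \<le> c * C * \<psi> x * exp (- \<gamma> * t) + \<bar>\<theta>\<bar> * ((c * (B * C * K) * \<psi> x) / \<gamma>)"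
    using R_decay[OF x t w w0] by (meson abs_ge_zero add_mono mult_left_mono order_trans)
  also have "\<dots> \<le> c * L * \<psi> x * exp (- \<gamma> * t) + \<bar>\<theta>\<bar> * (c * L * \<psi> x)"
  proof (intro add_mono mult_left_mono)
    show "c * C * \<psi> x * exp (- \<gamma> * t) \<le> c * L * \<psi> x * exp (- \<gamma> * t)"
      unfolding L_def using c px B_nonneg C_pos K_pos \<gamma>_pos by (intro mult_right_mono mult_left_mono) auto
    show "c * (B * C * K) * \<psi> x / \<gamma> \<le> c * L * \<psi> x"
      unfolding L_def using c px C_pos by (simp add: field_simps)
  qed simp
  finally show ?thesis by (simp add: algebra_simps)
qed

definition fe :: "'a \<Rightarrow> real" where "fe y = f y * \<eta> y"

lemma dominated_fe: "dominated (B * H) fe"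
  using dominated_f[OF dominated_\<eta>] by (simp add: fe_def[abs_def])

lemma fe_centred: "(\<integral>y. fe y \<partial>\<alpha>) = 0"
  using f_centred by (simp add: fe_def)

lemma G_\<eta>_Duhamel:
  assumes x: "x \<in> E" and t: "0 \<le> t"
  shows "G \<theta> t \<eta> x = \<eta> x + \<i> * \<theta> * (LINT s:{0..t}|lborel. G \<theta> s fe x)"
proof -
  have "(LINT s:{0..t}|lborel. G \<theta> s (\<lambda>z. f z * R (t - s) \<eta> z) x) = (LINT s:{0..t}|lborel. G \<theta> s fe x)"
  proof (rule set_lebesgue_integral_cong)
    show "\<forall>s. s \<in> {0..t} \<longrightarrow> G \<theta> s (\<lambda>z. f z * R (t - s) \<eta> z) x = G \<theta> s fe x"
      by (intro allI impI G_cong) (auto simp: fe_def R_\<eta>)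
  qed simp
  then show ?thesis unfolding G_Duhamel[OF x t dominated_\<eta>] by (simp add: R_\<eta>[OF x t])
qed

text \<open>
  Under the stationary Q-process \<open>lag q\<close> is the covariance of \<open>f\<close> at two times at distance \<open>q\<close>.
\<close>

definition lag :: "real \<Rightarrow> real" where
  "lag q = (\<integral>y. f y * R q fe y \<partial>\<alpha>)"

definition half_variance :: real where
  "half_variance = (LINT q:{0..}|lborel. lag q)"

lemma lag_measurable[measurable]: "lag \<in> borel_measurable borel"
proof -
  interpret a: prob_space \<alpha> by (rule prob_\<alpha>)
  have [measurable]: "(\<lambda>p. R (fst p) fe (snd p)) \<in> borel_measurable (borel \<Otimes>\<^sub>M S)"
    by (rule R_measurable2[OF dominated_measurable[OF dominated_fe]])
  have m: "(\<lambda>p. f (snd p) * R (fst p) fe (snd p)) \<in> borel_measurable (borel \<Otimes>\<^sub>M S)" by measurable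
  have "(\<lambda>y. y) \<in> \<alpha> \<rightarrow>\<^sub>M S"
    unfolding measurable_cong_sets[OF sets_\<alpha> refl] live_def by (rule measurable_restrict_space1) simp
  then have "(\<lambda>p::real \<times> 'a. (fst p, snd p)) \<in> borel \<Otimes>\<^sub>M \<alpha> \<rightarrow>\<^sub>M borel \<Otimes>\<^sub>M S"
    by (intro measurable_Pair measurable_fst measurable_compose[OF measurable_snd])
  from measurable_compose[OF this m] show ?thesis
    unfolding lag_def by (intro a.borel_measurable_lebesgue_integral) (simp add: split_beta')
qed

text \<open>
  \<open>D1\<close>, \<open>D2\<close> and \<open>D3\<close> are the constants in front of the exponential decay of the function
  \<open>f R\<^sub>q (f \<eta>)\<close>, of its \<open>\<alpha>\<close>-mean \<open>lag q\<close>, and of the error made by exchanging one for the other.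
\<close>

definition D1 :: real where "D1 = B * (B * H * C)"

lemma D1_nonneg: "0 \<le> D1"
  using B_nonneg H_nonneg C_pos by (simp add: D1_def)

lemma dominated_f_R_fe: "0 \<le> q \<Longrightarrow> dominated (D1 * exp (- \<gamma> * q)) (\<lambda>y. f y * R q fe y)"
  using dominated_f[OF dominated_R_decay[OF dominated_fe fe_centred]] by (simp add: D1_def mult.assoc)

definition D2 :: real where "D2 = D1 * (\<integral>y. \<psi> y \<partial>\<alpha>)"

lemma D2_nonneg: "0 \<le> D2"
  using D1_nonneg \<alpha>_\<psi>_nonneg by (simp add: D2_def)

lemma lag_bound: "0 \<le> q \<Longrightarrow> \<bar>lag q\<bar> \<le> D2 * exp (- \<gamma> * q)"
  using \<alpha>_bound[OF dominated_f_R_fe[of q]] by (simp add: lag_def D2_def mult_ac)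

lemma lag_bound_const: "0 \<le> q \<Longrightarrow> \<bar>lag q\<bar> \<le> D2"
  using lag_bound[of q] mult_left_mono[OF exp_decay_le_1[of q] D2_nonneg] by simp

definition D3 :: real where "D3 = (D1 + D2 * H) * L"

lemma D3_nonneg: "0 \<le> D3"
  using D1_nonneg D2_nonneg H_nonneg L_pos by (simp add: D3_def)

text \<open>
  Replacing \<open>f R\<^sub>q (f \<eta>)\<close> by its \<open>\<alpha>\<close>-mean times \<open>\<eta>\<close> costs an error that decays in
  \<open>q\<close>, and in \<open>s\<close> up to a multiple of \<open>\<theta>\<close>.
\<close>

lemma G_lag:
  assumes x: "x \<in> E" and s: "0 \<le> s" and q: "0 \<le> q"
  shows "norm (G \<theta> s (\<lambda>y. f y * R q fe y) x - lag q *\<^sub>R G \<theta> s \<eta> x) \<le> D3 * \<psi> x * exp (- \<gamma> * q) * (exp (- \<gamma> * s) + \<bar>\<theta>\<bar>)"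
proof -
  let ?u = "\<lambda>y. f y * R q fe y"
  note du = dominated_f_R_fe[OF q]
  have de: "dominated (\<bar>- lag q\<bar> * H) (\<lambda>y. - lag q * \<eta> y)" by (rule dominated_scale[OF dominated_\<eta>])
  have "\<bar>- lag q\<bar> * H \<le> D2 * exp (- \<gamma> * q) * H" using lag_bound[OF q] H_nonneg by (intro mult_right_mono) auto
  then have de': "dominated (D2 * exp (- \<gamma> * q) * H) (\<lambda>y. - lag q * \<eta> y)" by (rule dominated_mono[OF de])
  have d: "dominated ((D1 + D2 * H) * exp (- \<gamma> * q)) (\<lambda>y. ?u y + (- lag q * \<eta> y))"
    using dominated_add[OF du de'] by (simp add: algebra_simps)
  have "(\<integral>y. ?u y + (- lag q * \<eta> y) \<partial>\<alpha>) = 0"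
    using integrable_\<alpha>[OF du] integrable_\<alpha>[OF de] integrable_\<alpha>[OF dominated_\<eta>]
    by (subst Bochner_Integration.integral_add) (auto simp: lag_def \<alpha>_\<eta>)
  from G_decay[OF x s d this, of \<theta>]
  have "norm (G \<theta> s (\<lambda>y. ?u y + (- lag q * \<eta> y)) x) \<le> D3 * \<psi> x * exp (- \<gamma> * q) * (exp (- \<gamma> * s) + \<bar>\<theta>\<bar>)"
    by (simp add: D3_def mult_ac)
  moreover have "G \<theta> s (\<lambda>y. ?u y + (- lag q * \<eta> y)) x = G \<theta> s ?u x - lag q *\<^sub>R G \<theta> s \<eta> x"
    unfolding G_add[OF x s du de] G_scale by simp
  ultimately show ?thesis by simp
qed

lemma set_integrable_lag: "0 \<le> u \<Longrightarrow> set_integrable lborel {u..} lag"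
  unfolding set_integrable_def
proof (rule Bochner_Integration.integrable_bound)
  assume u: "0 \<le> u"
  show "integrable lborel (\<lambda>q. D2 * (indicator {u..} q *\<^sub>R exp (- \<gamma> * q)))"
    using set_integrable_exp_tail[OF \<gamma>_pos, of u] unfolding set_integrable_def by (rule integrable_mult_right)
  show "AE q in lborel. norm (indicator {u..} q *\<^sub>R lag q) \<le> norm (D2 * (indicator {u..} q *\<^sub>R exp (- \<gamma> * q)))"
    using lag_bound D2_nonneg u by (intro AE_I2) (auto split: split_indicator)
qed measurable

lemma lag_tail:
  assumes u: "0 \<le> u"
  shows "\<bar>(LINT q:{0..u}|lborel. lag q) - half_variance\<bar> \<le> D2 / \<gamma> * exp (- \<gamma> * u)"
proof -
  have "{0..} = {0..u} \<union> {u<..}" and "{0..u} \<inter> {u<..} = {}" using u by auto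
  then have "half_variance = (LINT q:{0..u}|lborel. lag q) + (LINT q:{u<..}|lborel. lag q)"
    unfolding half_variance_def using set_integral_Un[of "{0..u}" "{u<..}" lborel lag]
      set_integrable_subset[OF set_integrable_lag[of 0]] by fastforce
  moreover have "(LINT q:{u<..}|lborel. lag q) = (LINT q:{u..}|lborel. lag q)"
    by (rule set_integral_discrete_difference[where X="{u}"]) auto
  moreover have "norm (LINT q:{u..}|lborel. lag q) \<le> (LINT q:{u..}|lborel. D2 * exp (- \<gamma> * q))"
    using lag_bound u set_integrable_exp_tail[OF \<gamma>_pos, of u]
    by (intro norm_set_integral_le) auto
  ultimately show ?thesis using set_integral_exp_tail[OF \<gamma>_pos, of u] by (simp del: minus_mult_left[symmetric])
qed

text \<open>
  After exchanging the order of integration the inner integral is that of \<open>lag\<close> over \<open>{0..t - s}\<close>. It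
  misses the full integral by a tail which is exponentially small in \<open>t - s\<close>.
\<close>

lemma lag_convolution:
  fixes y :: "real \<Rightarrow> complex"
  assumes [measurable]: "y \<in> borel_measurable borel" and Y: "\<And>s. 0 \<le> s \<Longrightarrow> norm (y s) \<le> Y" and t: "0 \<le> t"
  shows "norm ((LINT r:{0..t}|lborel. (LINT s:{0..r}|lborel. lag (r - s) *\<^sub>R y s))
    - half_variance *\<^sub>R (LINT s:{0..t}|lborel. y s)) \<le> Y * D2 / \<gamma> / \<gamma>"
proof -
  have Y0: "0 \<le> Y" using Y[of 0] by (meson norm_ge_zero order_refl order_trans)
  define F where "F r s = indicator {0..t} r *\<^sub>R (indicator {0..r} s *\<^sub>R (lag (r - s) *\<^sub>R y s))" for r s
  have Fm[measurable]: "(\<lambda>p. F (fst p) (snd p)) \<in> borel_measurable (borel \<Otimes>\<^sub>M borel)"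
    unfolding F_def by measurable
  have int: "integrable (lborel \<Otimes>\<^sub>M lborel) (\<lambda>(r, s). F r s)"
  proof (rule integrableI_bounded_set[where A="{0..t} \<times> {0..t}" and B="D2 * Y"])
    show "emeasure (lborel \<Otimes>\<^sub>M lborel) ({0..t} \<times> {0..t}) < \<infinity>"
      using t by (simp add: lborel.emeasure_pair_measure_Times ennreal_mult_less_top)
    have "norm (F r s) \<le> D2 * Y" for r s
      using lag_bound_const[of "r - s"] Y[of s] D2_nonneg Y0
      by (auto simp: F_def split: split_indicator intro!: mult_mono)
    then show "AE p in lborel \<Otimes>\<^sub>M lborel. p \<in> {0..t} \<times> {0..t} \<longrightarrow> norm (case p of (r, s) \<Rightarrow> F r s) \<le> D2 * Y"
      by (intro AE_I2) auto
    show "AE p in lborel \<Otimes>\<^sub>M lborel. p \<notin> {0..t} \<times> {0..t} \<longrightarrow> (case p of (r, s) \<Rightarrow> F r s) = 0"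
      by (intro AE_I2) (auto simp: F_def indicator_def split: if_splits)
    show "(\<lambda>(r, s). F r s) \<in> borel_measurable (lborel \<Otimes>\<^sub>M lborel)"
      using Fm by (simp add: split_beta' cong: measurable_cong_sets)
  qed auto
  have "(LINT r:{0..t}|lborel. (LINT s:{0..r}|lborel. lag (r - s) *\<^sub>R y s)) = (\<integral>r. \<integral>s. F r s \<partial>lborel \<partial>lborel)"
    unfolding set_lebesgue_integral_def F_def by (simp only: integral_scaleR_right)
  also have "\<dots> = (\<integral>s. \<integral>r. F r s \<partial>lborel \<partial>lborel)"
    by (rule lborel_pair.Fubini_integral[OF int, symmetric])
  also have "\<dots> = (LINT s:{0..t}|lborel. (LINT q:{0..t - s}|lborel. lag q) *\<^sub>R y s)"
    unfolding set_lebesgue_integral_def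
  proof (rule Bochner_Integration.integral_cong[OF refl])
    fix s :: real
    show "(\<integral>r. F r s \<partial>lborel) = indicator {0..t} s *\<^sub>R ((\<integral>q. indicator {0..t - s} q *\<^sub>R lag q \<partial>lborel) *\<^sub>R y s)"
    proof (cases "s \<in> {0..t}")
      case True
      have "(\<integral>r. F r s \<partial>lborel) = (\<integral>r. F (s + 1 * r) s \<partial>lborel)"
        using lborel_integral_real_affine[of 1 "\<lambda>r. F r s" s] by simp
      also have "\<dots> = (\<integral>q. (indicator {0..t - s} q *\<^sub>R lag q) *\<^sub>R y s \<partial>lborel)"
        using True by (intro Bochner_Integration.integral_cong) (auto simp: F_def split: split_indicator)
      also have "\<dots> = (\<integral>q. indicator {0..t - s} q *\<^sub>R lag q \<partial>lborel) *\<^sub>R y s"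
        using set_integrable_subset[OF set_integrable_lag[of 0], of "{0..t - s}"]
        by (intro integral_scaleR_left) (auto simp: set_integrable_def)
      finally show ?thesis using True by simp
    next
      case False
      then have "F r s = 0" for r by (auto simp: F_def split: split_indicator)
      then show ?thesis using False by simp
    qed
  qed
  finally have e: "(LINT r:{0..t}|lborel. (LINT s:{0..r}|lborel. lag (r - s) *\<^sub>R y s)) = \<dots>" .
  have primitive_m[measurable]: "(\<lambda>u. LINT q:{0..u}|lborel. lag q) \<in> borel_measurable borel"
    unfolding set_lebesgue_integral_def
    by (rule lborel.borel_measurable_lebesgue_integral) measurable
  have pb: "norm (LINT q:{0..u}|lborel. lag q) \<le> \<bar>half_variance\<bar> + D2 / \<gamma>" if "0 \<le> u" for u
    using lag_tail[OF that] mult_left_mono[OF exp_decay_le_1[OF that], of "D2 / \<gamma>"] D2_nonneg \<gamma>_pos by simp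
  have i1: "set_integrable lborel {0..t} (\<lambda>s. (LINT q:{0..t - s}|lborel. lag q) *\<^sub>R y s)"
    unfolding norm_scaleR using D2_nonneg \<gamma>_pos
    by (intro set_integrable_bounded_interval[where B="(\<bar>half_variance\<bar> + D2 / \<gamma>) * Y"])
       (use pb Y Y0 in \<open>auto intro!: mult_mono\<close>)
  have i2: "set_integrable lborel {0..t} (\<lambda>s. half_variance *\<^sub>R y s)"
    by (intro set_integrable_bounded_interval[where B="\<bar>half_variance\<bar> * Y"]) (use Y in \<open>auto intro!: mult_left_mono\<close>)
  have "(LINT s:{0..t}|lborel. (LINT q:{0..t - s}|lborel. lag q) *\<^sub>R y s) - half_variance *\<^sub>R (LINT s:{0..t}|lborel. y s)
    = (LINT s:{0..t}|lborel. (LINT q:{0..t - s}|lborel. lag q) *\<^sub>R y s - half_variance *\<^sub>R y s)"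
    using set_integral_diff(2)[OF i1 i2] by simp
  also have "norm \<dots> \<le> (Y * D2 / \<gamma>) / \<gamma>"
  proof (rule norm_set_integral_exp_decay_reversed[OF t \<gamma>_pos])
    show "0 \<le> Y * D2 / \<gamma>" using Y0 D2_nonneg \<gamma>_pos by simp
    fix s assume s: "0 \<le> s" "s \<le> t"
    have "norm (((LINT q:{0..t - s}|lborel. lag q) - half_variance) *\<^sub>R y s) \<le> (D2 / \<gamma> * exp (- \<gamma> * (t - s))) * Y"
      unfolding norm_scaleR using lag_tail[of "t - s"] Y[of s] s D2_nonneg \<gamma>_pos by (intro mult_mono) auto
    then show "norm ((LINT q:{0..t - s}|lborel. lag q) *\<^sub>R y s - half_variance *\<^sub>R y s) \<le> Y * D2 / \<gamma> * exp (- \<gamma> * (t - s))"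
      by (simp add: scaleR_diff_left mult_ac)
  qed
  finally show ?thesis unfolding e .
qed

text \<open>
  Duhamel's formula for \<open>f \<eta>\<close>, with \<open>G_lag\<close> applied under the integral. The product
  \<open>exp (- \<gamma> (r - s)) exp (- \<gamma> s)\<close> integrates to \<open>r exp (- \<gamma> r)\<close>, which is why the rate drops
  to \<open>\<gamma> / 2\<close>.
\<close>

lemma G_fe_remainder:
  assumes x: "x \<in> E" and r: "0 \<le> r"
  shows "norm (G \<theta> r fe x - \<i> * \<theta> * (LINT s:{0..r}|lborel. lag (r - s) *\<^sub>R G \<theta> s \<eta> x))
    \<le> \<psi> x * ((B * H * C + \<bar>\<theta>\<bar> * D3 * (2 / \<gamma>)) * exp (- (\<gamma> / 2) * r) + \<theta>\<^sup>2 * D3 / \<gamma>)"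
proof -
  have xS: "x \<in> space S" using x by simp
  have px: "0 \<le> \<psi> x" using \<psi>_ge_1[OF x] by simp
  have [measurable]: "(\<lambda>s. G \<theta> s \<eta> x) \<in> borel_measurable borel" by (rule G_measurable[OF xS]) measurable
  have fem[measurable]: "fe \<in> borel_measurable S" by (rule dominated_measurable[OF dominated_fe])
  have "(\<lambda>p :: real \<times> 'a. (r - fst p, snd p)) \<in> borel \<Otimes>\<^sub>M S \<rightarrow>\<^sub>M borel \<Otimes>\<^sub>M S" by measurable
  from measurable_compose[OF this R_measurable2[OF fem]]
  have [measurable]: "(\<lambda>p. R (r - fst p) fe (snd p)) \<in> borel_measurable (borel \<Otimes>\<^sub>M S)" by simp
  have [measurable]: "(\<lambda>s. G \<theta> s (\<lambda>y. f y * R (r - s) fe y) x) \<in> borel_measurable borel"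
    by (rule G_measurable[OF xS]) measurable
  have GB: "norm (G \<theta> s \<eta> x) \<le> H * K * \<psi> x" if "0 \<le> s" for s by (rule G_bound[OF x that dominated_\<eta>])
  have HK: "0 \<le> H * K * \<psi> x" using H_nonneg K_pos px by simp
  have i2: "set_integrable lborel {0..r} (\<lambda>s. lag (r - s) *\<^sub>R G \<theta> s \<eta> x)"
    by (rule set_integrable_bounded_interval[where B="D2 * (H * K * \<psi> x)"])
       (use GB lag_bound_const D2_nonneg HK in \<open>auto intro!: mult_mono\<close>)
  have i1: "set_integrable lborel {0..r} (\<lambda>s. G \<theta> s (\<lambda>y. f y * R (r - s) fe y) x)"
  proof (rule set_integrable_bounded_interval[where B="D1 * K * \<psi> x"])
    fix s assume s: "0 \<le> s" "s \<le> r"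
    have "dominated D1 (\<lambda>y. f y * R (r - s) fe y)"
      by (rule dominated_mono[OF dominated_f_R_fe]) (use s mult_left_mono[OF exp_decay_le_1[of "r - s"] D1_nonneg] in auto)
    from G_bound[OF x s(1) this] show "norm (G \<theta> s (\<lambda>y. f y * R (r - s) fe y) x) \<le> D1 * K * \<psi> x" .
  qed measurable
  define J where "J = (LINT s:{0..r}|lborel. G \<theta> s (\<lambda>y. f y * R (r - s) fe y) x - lag (r - s) *\<^sub>R G \<theta> s \<eta> x)"
  have J: "(LINT s:{0..r}|lborel. G \<theta> s (\<lambda>y. f y * R (r - s) fe y) x) - (LINT s:{0..r}|lborel. lag (r - s) *\<^sub>R G \<theta> s \<eta> x) = J"
    unfolding J_def by (rule set_integral_diff(2)[OF i1 i2, symmetric])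
  let ?g = "\<lambda>s. D3 * \<psi> x * exp (- \<gamma> * r) + \<bar>\<theta>\<bar> * (D3 * \<psi> x) * exp (- \<gamma> * (r - s))"
  have ig1: "set_integrable lborel {0..r} (\<lambda>s. D3 * \<psi> x * exp (- \<gamma> * r))"
    and ig2: "set_integrable lborel {0..r} (\<lambda>s. \<bar>\<theta>\<bar> * (D3 * \<psi> x) * exp (- \<gamma> * (r - s)))"
    using r by (auto intro!: borel_integrable_atLeastAtMost' continuous_intros)
  have "norm J \<le> (LINT s:{0..r}|lborel. ?g s)"
    unfolding J_def
  proof (rule norm_set_integral_le)
    show "set_integrable lborel {0..r} ?g" by (rule set_integral_add(1)[OF ig1 ig2])
    fix s assume s: "s \<in> {0..r}"
    have "exp (- \<gamma> * (r - s)) * exp (- \<gamma> * s) = exp (- \<gamma> * r)" by (simp add: algebra_simps flip: exp_add)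
    then have "D3 * \<psi> x * exp (- \<gamma> * (r - s)) * (exp (- \<gamma> * s) + \<bar>\<theta>\<bar>) = ?g s" by (simp add: algebra_simps)
    then show "norm (G \<theta> s (\<lambda>y. f y * R (r - s) fe y) x - lag (r - s) *\<^sub>R G \<theta> s \<eta> x) \<le> ?g s"
      using G_lag[OF x, of s "r - s" \<theta>] s by simp
  qed
  also have "\<dots> = (LINT s:{0..r}|lborel. D3 * \<psi> x * exp (- \<gamma> * r)) + (LINT s:{0..r}|lborel. \<bar>\<theta>\<bar> * (D3 * \<psi> x) * exp (- \<gamma> * (r - s)))"
    by (rule set_integral_add(2)[OF ig1 ig2])
  also have "\<dots> \<le> D3 * \<psi> x * exp (- \<gamma> * r) * r + \<bar>\<theta>\<bar> * (D3 * \<psi> x) * (1 / \<gamma>)"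
  proof (rule add_mono)
    show "(LINT s:{0..r}|lborel. D3 * \<psi> x * exp (- \<gamma> * r)) \<le> D3 * \<psi> x * exp (- \<gamma> * r) * r"
      using r by (simp add: set_lebesgue_integral_def)
    show "(LINT s:{0..r}|lborel. \<bar>\<theta>\<bar> * (D3 * \<psi> x) * exp (- \<gamma> * (r - s))) \<le> \<bar>\<theta>\<bar> * (D3 * \<psi> x) * (1 / \<gamma>)"
      using set_integral_exp_decay_reversed[OF r \<gamma>_pos] D3_nonneg px
      by (simp only: set_integral_mult_right) (intro mult_left_mono, auto)
  qed
  also have "\<dots> \<le> D3 * \<psi> x * (2 / \<gamma> * exp (- (\<gamma> / 2) * r)) + \<bar>\<theta>\<bar> * (D3 * \<psi> x) * (1 / \<gamma>)"
  proof -
    \<comment> \<open>Half of the exponential rate absorbs the linear factor \<open>r\<close>.\<close>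
    have "\<gamma> / 2 * r \<le> exp (\<gamma> / 2 * r)" using exp_ge_add_one_self[of "\<gamma> / 2 * r"] by linarith
    then have "r \<le> 2 / \<gamma> * exp (\<gamma> / 2 * r)" using \<gamma>_pos by (simp add: field_simps)
    then have "exp (- \<gamma> * r) * r \<le> exp (- \<gamma> * r) * (2 / \<gamma> * exp (\<gamma> / 2 * r))" by (rule mult_left_mono) simp
    also have "\<dots> = 2 / \<gamma> * (exp (- \<gamma> * r) * exp (\<gamma> / 2 * r))" by simp
    also have "exp (- \<gamma> * r) * exp (\<gamma> / 2 * r) = exp (- (\<gamma> / 2) * r)" by (simp add: algebra_simps flip: exp_add)
    finally have "D3 * \<psi> x * (exp (- \<gamma> * r) * r) \<le> D3 * \<psi> x * (2 / \<gamma> * exp (- (\<gamma> / 2) * r))"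
      using D3_nonneg px by (intro mult_left_mono) auto
    then show ?thesis by (simp only: mult.assoc add_le_cancel_right)
  qed
  finally have nJ: "norm J \<le> D3 * \<psi> x * (2 / \<gamma> * exp (- (\<gamma> / 2) * r)) + \<bar>\<theta>\<bar> * (D3 * \<psi> x) * (1 / \<gamma>)" .
  have "\<bar>R r fe x\<bar> \<le> B * H * C * \<psi> x * exp (- \<gamma> * r)" by (rule R_decay[OF x r dominated_fe fe_centred])
  also have "\<dots> \<le> B * H * C * \<psi> x * exp (- (\<gamma> / 2) * r)"
  proof (rule mult_left_mono)
    have "\<gamma> / 2 * r \<le> \<gamma> * r" using \<gamma>_pos r by (intro mult_right_mono) auto
    then show "exp (- \<gamma> * r) \<le> exp (- (\<gamma> / 2) * r)" by simp
    show "0 \<le> B * H * C * \<psi> x" using B_nonneg H_nonneg C_pos px by simp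
  qed
  finally have nR: "\<bar>R r fe x\<bar> \<le> B * H * C * \<psi> x * exp (- (\<gamma> / 2) * r)" .
  have "G \<theta> r fe x - \<i> * \<theta> * (LINT s:{0..r}|lborel. lag (r - s) *\<^sub>R G \<theta> s \<eta> x) = R r fe x + \<i> * \<theta> * J"
    unfolding G_Duhamel[OF x r dominated_fe] J[symmetric] by (simp add: algebra_simps)
  also have "norm \<dots> \<le> \<bar>R r fe x\<bar> + \<bar>\<theta>\<bar> * norm J"
    by (rule order_trans[OF norm_triangle_ineq]) (simp add: norm_mult)
  also have "\<dots> \<le> B * H * C * \<psi> x * exp (- (\<gamma> / 2) * r) + \<bar>\<theta>\<bar> * (D3 * \<psi> x * (2 / \<gamma> * exp (- (\<gamma> / 2) * r)) + \<bar>\<theta>\<bar> * (D3 * \<psi> x) * (1 / \<gamma>))"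
    by (intro add_mono nR mult_left_mono nJ) simp
  also have "\<dots> = \<psi> x * ((B * H * C + \<bar>\<theta>\<bar> * D3 * (2 / \<gamma>)) * exp (- (\<gamma> / 2) * r) + \<bar>\<theta>\<bar>\<^sup>2 * D3 / \<gamma>)"
    by (simp only: power2_eq_square) (simp add: algebra_simps)
  finally show ?thesis by simp
qed

definition defect :: "real \<Rightarrow> real \<Rightarrow> real" where
  "defect \<theta> t = \<bar>\<theta>\<bar> * ((B * H * C + \<bar>\<theta>\<bar> * D3 * (2 / \<gamma>)) * (2 / \<gamma>) + \<theta>\<^sup>2 * D3 / \<gamma> * t) + \<theta>\<^sup>2 * (H * K * D2 / \<gamma> / \<gamma>)"

text \<open>
  Duhamel's formula is inserted into itself. The term of first order in \<open>\<theta>\<close> stays bounded in time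
  because \<open>f \<eta>\<close> is \<open>\<alpha>\<close>-centred; the term of second order is the convolution of \<open>lag\<close> with
  \<open>G \<theta> s \<eta> x\<close>, which acts like multiplication by the total mass of \<open>lag\<close>.
\<close>

theorem G_\<eta>_integral_equation:
  assumes x: "x \<in> E" and t: "0 \<le> t"
  shows "norm (G \<theta> t \<eta> x + of_real (\<theta>\<^sup>2 * half_variance) * (LINT s:{0..t}|lborel. G \<theta> s \<eta> x) - \<eta> x) \<le> \<psi> x * defect \<theta> t"
proof -
  have xS: "x \<in> space S" using x by simp
  have px: "0 \<le> \<psi> x" using \<psi>_ge_1[OF x] by simp
  define y where "y s = G \<theta> s \<eta> x" for s
  have ym[measurable]: "y \<in> borel_measurable borel"
    unfolding y_def by (rule G_measurable[OF xS]) measurable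
  have [measurable]: "fe \<in> borel_measurable S" by (rule dominated_measurable[OF dominated_fe])
  have [measurable]: "(\<lambda>r. G \<theta> r fe x) \<in> borel_measurable borel" by (rule G_measurable[OF xS]) measurable
  have yB: "norm (y s) \<le> H * K * \<psi> x" if "0 \<le> s" for s
    unfolding y_def by (rule G_bound[OF x that dominated_\<eta>])
  define V where "V r = (LINT s:{0..r}|lborel. lag (r - s) *\<^sub>R y s)" for r
  have [measurable]: "V \<in> borel_measurable borel"
    unfolding V_def set_lebesgue_integral_def by measurable
  have VB: "norm (V r) \<le> D2 * (H * K * \<psi> x) * r" if r: "0 \<le> r" for r
  proof -
    have HK: "0 \<le> H * K * \<psi> x" using H_nonneg K_pos px by simp
    have "norm (V r) \<le> D2 * (H * K * \<psi> x) * (r - 0)"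
      unfolding V_def using lag_bound_const yB D2_nonneg HK r
      by (intro set_integral_interval_bound) (auto intro!: mult_mono)
    then show ?thesis by simp
  qed
  have iG: "set_integrable lborel {0..t} (\<lambda>r. G \<theta> r fe x)"
    by (rule set_integrable_bounded_interval) (auto intro: G_bound[OF x _ dominated_fe])
  have iV: "set_integrable lborel {0..t} (\<lambda>r. \<i> * \<theta> * V r)"
  proof (rule set_integrable_bounded_interval)
    fix r assume r: "0 \<le> r" "r \<le> t"
    have "norm (V r) \<le> D2 * (H * K * \<psi> x) * t"
      using VB[OF r(1)] r D2_nonneg H_nonneg K_pos px by (meson mult_left_mono mult_nonneg_nonneg less_imp_le order_trans)
    then show "norm (\<i> * \<theta> * V r) \<le> \<bar>\<theta>\<bar> * (D2 * (H * K * \<psi> x) * t)" by (simp add: norm_mult mult_left_mono)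
  qed measurable
  define Rem where "Rem = (LINT r:{0..t}|lborel. G \<theta> r fe x - \<i> * \<theta> * V r)"
  have "Rem = (LINT r:{0..t}|lborel. G \<theta> r fe x) - (LINT r:{0..t}|lborel. \<i> * \<theta> * V r)"
    unfolding Rem_def by (rule set_integral_diff(2)[OF iG iV])
  then have split: "(LINT r:{0..t}|lborel. G \<theta> r fe x) = Rem + \<i> * \<theta> * (LINT r:{0..t}|lborel. V r)" by simp
  define Q where "Q = (LINT r:{0..t}|lborel. V r) - half_variance *\<^sub>R (LINT s:{0..t}|lborel. y s)"
  have nQ: "norm Q \<le> (H * K * \<psi> x) * D2 / \<gamma> / \<gamma>"
    unfolding Q_def V_def by (rule lag_convolution[OF ym yB t])
  let ?c = "B * H * C + \<bar>\<theta>\<bar> * D3 * (2 / \<gamma>)"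
  have c0: "0 \<le> ?c" using B_nonneg H_nonneg C_pos D3_nonneg \<gamma>_pos by simp
  have nRem: "norm Rem \<le> \<psi> x * (?c * (2 / \<gamma>) + \<theta>\<^sup>2 * D3 / \<gamma> * t)"
  proof -
    have ie: "set_integrable lborel {0..t} (\<lambda>r. \<psi> x * (?c * exp (- (\<gamma> / 2) * r)))"
      and ic: "set_integrable lborel {0..t} (\<lambda>r. \<psi> x * (\<theta>\<^sup>2 * D3 / \<gamma>))"
      using t by (auto intro!: borel_integrable_atLeastAtMost' continuous_intros)
    have "norm Rem \<le> (LINT r:{0..t}|lborel. \<psi> x * (?c * exp (- (\<gamma> / 2) * r)) + \<psi> x * (\<theta>\<^sup>2 * D3 / \<gamma>))"
      unfolding Rem_def
    proof (rule norm_set_integral_le[OF set_integral_add(1)[OF ie ic]])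
      fix r assume "r \<in> {0..t}"
      then show "norm (G \<theta> r fe x - \<i> * \<theta> * V r) \<le> \<psi> x * (?c * exp (- (\<gamma> / 2) * r)) + \<psi> x * (\<theta>\<^sup>2 * D3 / \<gamma>)"
        using G_fe_remainder[OF x, of r \<theta>] unfolding V_def y_def distrib_left by simp
    qed
    also have "\<dots> = (LINT r:{0..t}|lborel. \<psi> x * (?c * exp (- (\<gamma> / 2) * r))) + (LINT r:{0..t}|lborel. \<psi> x * (\<theta>\<^sup>2 * D3 / \<gamma>))"
      by (rule set_integral_add(2)[OF ie ic])
    also have "\<dots> \<le> \<psi> x * (?c * (1 / (\<gamma> / 2))) + \<psi> x * (\<theta>\<^sup>2 * D3 / \<gamma>) * t"
    proof (rule add_mono)
      show "(LINT r:{0..t}|lborel. \<psi> x * (?c * exp (- (\<gamma> / 2) * r))) \<le> \<psi> x * (?c * (1 / (\<gamma> / 2)))"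
        unfolding set_integral_mult_right
        by (intro mult_left_mono set_integral_exp_decay t c0 px) (use \<gamma>_pos in simp)
      show "(LINT r:{0..t}|lborel. \<psi> x * (\<theta>\<^sup>2 * D3 / \<gamma>)) \<le> \<psi> x * (\<theta>\<^sup>2 * D3 / \<gamma>) * t"
        using t by (simp add: set_lebesgue_integral_def mult_ac)
    qed
    also have "\<dots> = \<psi> x * (?c * (2 / \<gamma>) + \<theta>\<^sup>2 * D3 / \<gamma> * t)" by (simp add: algebra_simps)
    finally show ?thesis .
  qed
  have "y t = \<eta> x + \<i> * \<theta> * (LINT s:{0..t}|lborel. G \<theta> s fe x)"
    unfolding y_def by (rule G_\<eta>_Duhamel[OF x t])
  also have "\<dots> = \<eta> x + \<i> * \<theta> * (Rem + \<i> * \<theta> * (Q + half_variance *\<^sub>R (LINT s:{0..t}|lborel. y s)))"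
    unfolding split by (simp add: Q_def)
  finally have "y t + of_real (\<theta>\<^sup>2 * half_variance) * (LINT s:{0..t}|lborel. y s) - \<eta> x = \<i> * \<theta> * Rem - of_real (\<theta>\<^sup>2) * Q"
    by (simp add: algebra_simps power2_eq_square scaleR_conv_of_real)
  also have "norm \<dots> \<le> \<bar>\<theta>\<bar> * norm Rem + \<theta>\<^sup>2 * norm Q"
    by (rule order_trans[OF norm_triangle_ineq4]) (simp add: norm_mult norm_power)
  also have "\<dots> \<le> \<bar>\<theta>\<bar> * (\<psi> x * (?c * (2 / \<gamma>) + \<theta>\<^sup>2 * D3 / \<gamma> * t)) + \<theta>\<^sup>2 * ((H * K * \<psi> x) * D2 / \<gamma> / \<gamma>)"
    by (intro add_mono mult_left_mono nRem nQ) auto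
  also have "\<dots> = \<psi> x * defect \<theta> t" by (simp add: defect_def algebra_simps)
  finally show ?thesis by (simp add: y_def)
qed

lemma G_\<eta>_continuous:
  assumes x: "x \<in> E"
  shows "continuous_on {0..T} (\<lambda>t. G \<theta> t \<eta> x)"
proof -
  have xS: "x \<in> space S" using x by simp
  have [measurable]: "fe \<in> borel_measurable S" by (rule dominated_measurable[OF dominated_fe])
  have "continuous_on {0..T} (\<lambda>t. LINT s:{0..t}|lborel. G \<theta> s fe x)"
    by (rule continuous_on_primitive) (rule G_measurable[OF xS], measurable, rule G_bound[OF x _ dominated_fe])
  then have "continuous_on {0..T} (\<lambda>t. \<eta> x + \<i> * \<theta> * (LINT s:{0..t}|lborel. G \<theta> s fe x))"
    by (intro continuous_intros)
  then show ?thesis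
    by (rule continuous_on_eq) (simp add: G_\<eta>_Duhamel[OF x])
qed

text \<open>
  Relative to \<open>\<psi> x\<close>: the defect propagated through the linear integral equation, and the cost of replacing
  \<open>\<eta>\<close> by \<open>1\<close>.
\<close>

definition rate :: "real \<Rightarrow> real \<Rightarrow> real" where
  "rate u T = (\<bar>u\<bar> * ((B * H * C + \<bar>u\<bar> * D3 * (2 / \<gamma>)) * (2 / \<gamma>) + u\<^sup>2 * D3 / \<gamma>) + u\<^sup>2 * (H * K * D2 / \<gamma> / \<gamma>)) / sqrt T
      * (1 + u\<^sup>2 * half_variance * exp (u\<^sup>2 * half_variance))
    + (1 + H) * L * (exp (- \<gamma> * T) + \<bar>u\<bar> / sqrt T)"

lemma rate_tendsto_0: "(rate u \<longlongrightarrow> 0) at_top"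
proof -
  have s: "((\<lambda>T. c / sqrt T) \<longlongrightarrow> 0) at_top" for c by real_asymp
  have e: "((\<lambda>T. exp (- \<gamma> * T)) \<longlongrightarrow> 0) at_top" using \<gamma>_pos by real_asymp
  have "(rate u \<longlongrightarrow> 0 * (1 + u\<^sup>2 * half_variance * exp (u\<^sup>2 * half_variance)) + (1 + H) * L * (0 + 0)) at_top"
    unfolding rate_def by (intro tendsto_intros s e)
  then show ?thesis by simp
qed

text \<open>
  On \<open>{0..T}\<close> with \<open>\<theta> = u / sqrt T\<close> the product \<open>\<theta>\<^sup>2 t\<close> is at most \<open>u\<^sup>2\<close>, so the defect is of order
  \<open>1 / sqrt T\<close>, whereas the damping accumulated up to time \<open>T\<close> does not depend on \<open>T\<close>. The function
  \<open>1 - \<eta>\<close> is \<open>\<alpha>\<close>-centred, so \<open>\<eta>\<close> may be replaced by \<open>1\<close> at the end.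
\<close>

theorem G_one_limit:
  assumes x: "x \<in> E" and T: "1 \<le> T" and v: "0 \<le> half_variance"
  shows "norm (G (u / sqrt T) T (\<lambda>_. 1) x - exp (- (u\<^sup>2 * half_variance)) * \<eta> x) \<le> \<psi> x * rate u T"
proof -
  define \<theta> where "\<theta> = u / sqrt T"
  have px: "0 \<le> \<psi> x" using \<psi>_ge_1[OF x] by simp
  have sT: "1 \<le> sqrt T" using T by simp
  have T0: "0 \<le> T" using T by simp
  have th: "\<bar>\<theta>\<bar> = \<bar>u\<bar> / sqrt T" using T by (simp add: \<theta>_def)
  have thu: "\<bar>\<theta>\<bar> \<le> \<bar>u\<bar>" unfolding th using sT by (simp add: divide_le_eq mult_left_le[of 1] mult_le_cancel_left1)
  have th2: "\<theta>\<^sup>2 = u\<^sup>2 / T" using T by (simp add: \<theta>_def power_divide)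
  have th2': "\<theta>\<^sup>2 \<le> u\<^sup>2 / sqrt T"
  proof -
    have "sqrt T * 1 \<le> sqrt T * sqrt T" using sT by (intro mult_left_mono) auto
    then have "sqrt T \<le> T" using T0 by simp
    then show ?thesis unfolding th2 using sT by (intro divide_left_mono) auto
  qed
  define M where "M = \<bar>u\<bar> * ((B * H * C + \<bar>u\<bar> * D3 * (2 / \<gamma>)) * (2 / \<gamma>) + u\<^sup>2 * D3 / \<gamma>) + u\<^sup>2 * (H * K * D2 / \<gamma> / \<gamma>)"
  have def: "defect \<theta> t \<le> M / sqrt T" if t: "0 \<le> t" "t \<le> T" for t
  proof -
    have "\<theta>\<^sup>2 * t \<le> u\<^sup>2"
    proof -
      have "\<theta>\<^sup>2 * t \<le> \<theta>\<^sup>2 * T" using t by (intro mult_left_mono) auto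
      also have "\<dots> = u\<^sup>2" unfolding th2 using T by simp
      finally show ?thesis .
    qed
    then have "\<theta>\<^sup>2 * t * (D3 / \<gamma>) \<le> u\<^sup>2 * (D3 / \<gamma>)" using D3_nonneg \<gamma>_pos by (intro mult_right_mono) auto
    then have 1: "\<theta>\<^sup>2 * D3 / \<gamma> * t \<le> u\<^sup>2 * D3 / \<gamma>" by (simp add: mult_ac)
    have 2: "(B * H * C + \<bar>\<theta>\<bar> * D3 * (2 / \<gamma>)) * (2 / \<gamma>) \<le> (B * H * C + \<bar>u\<bar> * D3 * (2 / \<gamma>)) * (2 / \<gamma>)"
      using thu D3_nonneg \<gamma>_pos by (intro mult_right_mono add_left_mono) auto
    have "defect \<theta> t \<le> \<bar>\<theta>\<bar> * ((B * H * C + \<bar>u\<bar> * D3 * (2 / \<gamma>)) * (2 / \<gamma>) + u\<^sup>2 * D3 / \<gamma>) + (u\<^sup>2 / sqrt T) * (H * K * D2 / \<gamma> / \<gamma>)"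
      unfolding defect_def using H_nonneg K_pos D2_nonneg \<gamma>_pos
      by (intro add_mono mult_left_mono mult_right_mono 1 2 th2') auto
    also have "\<dots> = M / sqrt T" unfolding th M_def by (simp add: add_divide_distrib)
    finally show ?thesis .
  qed
  let ?a = "\<theta>\<^sup>2 * half_variance"
  have aT: "?a * T = u\<^sup>2 * half_variance" unfolding th2 using T by simp
  have "norm (G \<theta> T \<eta> x - exp (- complex_of_real ?a * complex_of_real T) * complex_of_real (\<eta> x)) \<le> \<psi> x * (M / sqrt T) * (1 + ?a * T * exp (?a * T))"
  proof (rule perturbed_linear_integral_equation[OF G_\<eta>_continuous[OF x] T0])
    show "0 \<le> ?a" using v by simp
    fix t assume t: "0 \<le> t" "t \<le> T"
    show "norm (G \<theta> t \<eta> x + ?a * (LINT s:{0..t}|lborel. G \<theta> s \<eta> x) - \<eta> x) \<le> \<psi> x * (M / sqrt T)"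
      using G_\<eta>_integral_equation[OF x t(1), of \<theta>] mult_left_mono[OF def[OF t] px] by simp
  qed
  then have 1: "norm (G \<theta> T \<eta> x - exp (- (u\<^sup>2 * half_variance)) * \<eta> x) \<le> \<psi> x * (M / sqrt T) * (1 + u\<^sup>2 * half_variance * exp (u\<^sup>2 * half_variance))"
    by (simp only: of_real_minus[symmetric] of_real_mult[symmetric] exp_of_real mult_minus_left aT)
  have d1: "dominated 1 (\<lambda>_. 1)" using \<psi>_ge_1 by (auto simp: dominated_def)
  have de: "dominated H (\<lambda>y. - 1 * \<eta> y)" using dominated_scale[OF dominated_\<eta>, of "- 1"] by simp
  note dw = dominated_add[OF d1 de]
  interpret a: prob_space \<alpha> by (rule prob_\<alpha>)
  have "(\<integral>y. 1 + - 1 * \<eta> y \<partial>\<alpha>) = 0"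
    using integrable_\<alpha>[OF dominated_\<eta>] by (subst Bochner_Integration.integral_add) (auto simp: \<alpha>_\<eta> a.prob_space)
  from G_decay[OF x T0 dw this, of \<theta>]
  have 2: "norm (G \<theta> T (\<lambda>y. 1 + - 1 * \<eta> y) x) \<le> (1 + H) * L * \<psi> x * (exp (- \<gamma> * T) + \<bar>u\<bar> / sqrt T)" by (simp add: th)
  have "G \<theta> T (\<lambda>y. 1 + - 1 * \<eta> y) x = G \<theta> T (\<lambda>_. 1) x - G \<theta> T \<eta> x"
    unfolding G_add[OF x T0 d1 de] G_scale by simp
  then have "G \<theta> T (\<lambda>_. 1) x - exp (- (u\<^sup>2 * half_variance)) * \<eta> x = (G \<theta> T \<eta> x - exp (- (u\<^sup>2 * half_variance)) * \<eta> x) + G \<theta> T (\<lambda>y. 1 + - 1 * \<eta> y) x"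
    by simp
  then have "norm (G \<theta> T (\<lambda>_. 1) x - exp (- (u\<^sup>2 * half_variance)) * \<eta> x)
     \<le> \<psi> x * (M / sqrt T) * (1 + u\<^sup>2 * half_variance * exp (u\<^sup>2 * half_variance)) + (1 + H) * L * \<psi> x * (exp (- \<gamma> * T) + \<bar>u\<bar> / sqrt T)"
    using 1 2 by (metis norm_triangle_mono)
  also have "\<dots> = \<psi> x * rate u T" unfolding rate_def M_def[symmetric] by (simp add: distrib_left mult_ac)
  finally show ?thesis unfolding \<theta>_def .
qed

end

section \<open>The asymptotic variance through the Q-process\<close>

context exponentially_quasi_ergodic
begin

lemma exists_survival_time:
  assumes x: "x \<in> space S" and s: "0 \<le> s"
  obtains s' where "s < s'" "AE \<omega> in P x. X s' \<omega> \<noteq> cem \<longrightarrow> \<omega> \<in> survives s'"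
proof -
  let ?Q = "\<lambda>r. 0 \<le> r \<longrightarrow> (AE \<omega> in P x. X r \<omega> \<noteq> cem \<longrightarrow> \<omega> \<in> survives r)"
  have "\<exists>r\<in>{s<..<s + 1}. ?Q r"
  proof (rule ccontr)
    assume n: "\<not> (\<exists>r\<in>{s<..<s + 1}. ?Q r)"
    from AE_alive_survives[OF x] have "AE r in lborel. r \<notin> {s<..<s + 1}"
      by eventually_elim (use n in blast)
    then have "{s<..<s + 1} \<in> null_sets lborel" by (subst AE_iff_null_sets) auto
    then show False by (auto simp: null_sets_def)
  qed
  with s that show ?thesis by auto
qed

lemma killed_semigroup_\<eta>:
  assumes y: "y \<in> space S" and t: "0 \<le> t"
  shows "killed_semigroup t \<eta> y = exp (- l * t) * \<eta> y"
proof (cases "y = cem")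
  case True then show ?thesis using killed_semigroup_cem[OF t] \<eta>_cem by simp
next
  case False
  then have "exp (- l * t) * R t \<eta> y = exp (- l * t) * \<eta> y" using R_\<eta>[OF _ t] y by simp
  then show ?thesis by (simp add: R_def mult.assoc[symmetric] flip: exp_add)
qed

text \<open>
  The mean of \<open>\<eta> (X s)\<close> over the paths alive at \<open>s\<close> equals its mean over the paths surviving \<open>s\<close>: both
  are recovered from the eigenvalue equation, the former by running the process on to a later time. As
  the second integrand is the smaller one, the two agree almost surely.
\<close>

lemma
  assumes x: "x \<in> E" and s: "0 \<le> s"
  shows integrable_\<eta>_X: "integrable (P x) (\<lambda>\<omega>. \<eta> (X s \<omega>))"
    and survives_if_\<eta>_pos: "AE \<omega> in P x. \<eta> (X s \<omega>) = killed \<eta> s \<omega>"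
proof -
  have xS: "x \<in> space S" using x by simp
  note [measurable_cong] = sets_P[OF xS]
  have Xs: "X s \<in> \<Omega> \<rightarrow>\<^sub>M S" using s by simp
  note [measurable] = Xs
  obtain s' where s': "s < s'" and alive: "AE \<omega> in P x. X s' \<omega> \<noteq> cem \<longrightarrow> \<omega> \<in> survives s'"
    using exists_survival_time[OF xS s] .
  have t: "0 \<le> s' - s" using s' by simp
  have i: "integrable (P x) (killed \<eta> (s + (s' - s)))" using integrable_killed[OF x _ dominated_\<eta>, of s'] s s' by simp
  note M = markov_killed[OF xS s t _ _ \<eta>_measurable i, of "\<lambda>_. 1" 1]
  have e: "killed_semigroup (s' - s) \<eta> (X s \<omega>) = exp (- l * (s' - s)) * \<eta> (X s \<omega>)" if "\<omega> \<in> space (P x)" for \<omega>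
    using that s t by (intro killed_semigroup_\<eta>) (simp_all add: X_in_space space_P[OF xS])
  have "integrable (P x) (\<lambda>\<omega>. killed_semigroup (s' - s) \<eta> (X s \<omega>))" using M(1) by simp
  then have i2: "integrable (P x) (\<lambda>\<omega>. exp (- l * (s' - s)) * \<eta> (X s \<omega>))"
    by (rule Bochner_Integration.integrable_cong[THEN iffD1, rotated -1]) (auto simp: e)
  then show ie: "integrable (P x) (\<lambda>\<omega>. \<eta> (X s \<omega>))" by simp
  have "(\<integral>\<omega>. killed \<eta> s' \<omega> \<partial>P x) = (\<integral>\<omega>. killed_semigroup (s' - s) \<eta> (X s \<omega>) \<partial>P x)" using M(2) by simp
  also have "\<dots> = (\<integral>\<omega>. exp (- l * (s' - s)) * \<eta> (X s \<omega>) \<partial>P x)" by (rule Bochner_Integration.integral_cong) (auto simp: e)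
  finally have "exp (- l * s') * \<eta> x = exp (- l * (s' - s)) * (\<integral>\<omega>. \<eta> (X s \<omega>) \<partial>P x)"
    using killed_semigroup_\<eta>[OF xS, of s'] s s' by (simp add: killed_semigroup_def)
  then have "exp (l * (s' - s)) * (exp (- l * s') * \<eta> x) = (\<integral>\<omega>. \<eta> (X s \<omega>) \<partial>P x)"
    by (simp add: mult.assoc[symmetric] flip: exp_add)
  then have "(\<integral>\<omega>. \<eta> (X s \<omega>) \<partial>P x) = (\<integral>\<omega>. killed \<eta> s \<omega> \<partial>P x)"
    using killed_semigroup_\<eta>[OF xS s] by (simp add: killed_semigroup_def mult.assoc[symmetric] algebra_simps flip: exp_add)
  then have "(\<integral>\<omega>. \<eta> (X s \<omega>) - killed \<eta> s \<omega> \<partial>P x) = 0"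
    using ie integrable_killed[OF x s dominated_\<eta>] by simp
  moreover have "AE \<omega> in P x. 0 \<le> \<eta> (X s \<omega>) - killed \<eta> s \<omega>"
    using \<eta>_nonneg s by (intro AE_I2) (auto simp: killed_eq space_P[OF xS] X_in_space split: split_indicator)
  ultimately have "AE \<omega> in P x. \<eta> (X s \<omega>) - killed \<eta> s \<omega> = 0"
    using integral_nonneg_eq_0_iff_AE[OF Bochner_Integration.integrable_diff[OF ie integrable_killed[OF x s dominated_\<eta>]]] by blast
  then show "AE \<omega> in P x. \<eta> (X s \<omega>) = killed \<eta> s \<omega>" by eventually_elim simp
qed

lemma dominated_one: "dominated 1 (\<lambda>_. 1)"
  using \<psi>_ge_1 by (auto simp: dominated_def)

text \<open>
  Conditioning on late survival reweights paths up to time \<open>s\<close> by \<open>\<eta> (X s)\<close>. The Markov property is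
  applied at a slightly later time \<open>s'\<close> at which being alive and surviving agree almost surely, so that
  the \<open>\<psi>\<close>-moment at time \<open>s'\<close> is under control.
\<close>

lemma survival_asymptotics:
  assumes x: "x \<in> E" and s: "0 \<le> s" and \<Gamma>: "\<Gamma> \<in> sets (\<F> s)"
  shows "((\<lambda>T. exp (l * T) * measure (P x) (\<Gamma> \<inter> survives T)) \<longlongrightarrow> exp (l * s) * (\<integral>\<omega>. indicator \<Gamma> \<omega> * \<eta> (X s \<omega>) \<partial>P x)) at_top"
proof -
  have xS: "x \<in> space S" using x by simp
  interpret Px: prob_space "P x" by (rule prob_space_P[OF xS])
  note [measurable_cong] = sets_P[OF xS]
  have Gm[measurable]: "\<Gamma> \<in> sets \<Omega>" using \<Gamma> filtration_le by auto
  note sv[measurable] = sets_survival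
  obtain s' where s': "s < s'" and alive: "AE \<omega> in P x. X s' \<omega> \<noteq> cem \<longrightarrow> \<omega> \<in> survives s'"
    using exists_survival_time[OF xS s] .
  have s'0: "0 \<le> s'" using s s' by simp
  have [measurable]: "X s' \<in> \<Omega> \<rightarrow>\<^sub>M S" "X s \<in> \<Omega> \<rightarrow>\<^sub>M S" using s s'0 by auto
  have G': "\<Gamma> \<in> sets (\<F> s')" using filtration_mono[of s s'] s' \<Gamma> by auto
  have b: "\<bar>indicator \<Gamma> \<omega> :: real\<bar> \<le> 1" for \<omega> by (simp add: indicator_def)
  have iG: "integrable (P x) (\<lambda>\<omega>. indicator \<Gamma> \<omega> * h \<omega>)" if "integrable (P x) h" for h :: "'w \<Rightarrow> real"
    using integrable_real_mult_indicator[OF _ that, of \<Gamma>] Gm by (simp add: sets_P[OF xS] mult.commute)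
  let ?I = "\<integral>\<omega>. indicator \<Gamma> \<omega> * \<eta> (X s' \<omega>) \<partial>P x"
  define Psi where "Psi = (\<integral>\<omega>. killed \<psi> s' \<omega> \<partial>P x)"
  have ipsi: "integrable (P x) (killed \<psi> s')"
    by (rule integrable_killed[OF x s'0, of 1]) (use \<psi>_ge_1 in \<open>force simp: dominated_def\<close>)
  have est: "\<bar>exp (l * T) * measure (P x) (\<Gamma> \<inter> survives T) - exp (l * s') * ?I\<bar> \<le> exp (l * s') * (C * exp (- \<gamma> * (T - s')) * Psi)"
    if T: "s' \<le> T" for T
  proof -
    have T': "0 \<le> T - s'" "0 \<le> T" using T s'0 by auto
    have i1: "integrable (P x) (killed (\<lambda>_. 1) (s' + (T - s')))"
      using integrable_killed[OF x T'(2) dominated_one] by simp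
    note M = markov_killed[OF xS s'0 T'(1) _ b _ i1, OF borel_measurable_indicator[OF G'] borel_measurable_const]
    have "measure (P x) (\<Gamma> \<inter> survives T) = (\<integral>\<omega>. indicator (\<Gamma> \<inter> survives T) \<omega> \<partial>P x)"
      using sets.Int[OF Gm sv] by (simp add: sets_P[OF xS] sets.Int_space_eq2)
    also have "\<dots> = (\<integral>\<omega>. indicator \<Gamma> \<omega> * killed (\<lambda>_. 1) (s' + (T - s')) \<omega> \<partial>P x)"
      by (simp add: killed_def indicator_inter_arith)
    also have "\<dots> = (\<integral>\<omega>. indicator \<Gamma> \<omega> * killed_semigroup (T - s') (\<lambda>_. 1) (X s' \<omega>) \<partial>P x)" by (rule M(2))
    finally have "exp (l * T) * measure (P x) (\<Gamma> \<inter> survives T) = exp (l * T) * (\<integral>\<omega>. indicator \<Gamma> \<omega> * killed_semigroup (T - s') (\<lambda>_. 1) (X s' \<omega>) \<partial>P x)" by simp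
    also have "\<dots> = exp (l * s') * (\<integral>\<omega>. indicator \<Gamma> \<omega> * R (T - s') (\<lambda>_. 1) (X s' \<omega>) \<partial>P x)"
    proof -
      have "(\<integral>\<omega>. indicator \<Gamma> \<omega> * R (T - s') (\<lambda>_. 1) (X s' \<omega>) \<partial>P x) = (\<integral>\<omega>. exp (l * (T - s')) * (indicator \<Gamma> \<omega> * killed_semigroup (T - s') (\<lambda>_. 1) (X s' \<omega>)) \<partial>P x)"
        by (simp add: R_def mult_ac)
      also have "\<dots> = exp (l * (T - s')) * (\<integral>\<omega>. indicator \<Gamma> \<omega> * killed_semigroup (T - s') (\<lambda>_. 1) (X s' \<omega>) \<partial>P x)" by simp
      finally have "exp (l * s') * (\<integral>\<omega>. indicator \<Gamma> \<omega> * R (T - s') (\<lambda>_. 1) (X s' \<omega>) \<partial>P x)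
          = (exp (l * s') * exp (l * (T - s'))) * (\<integral>\<omega>. indicator \<Gamma> \<omega> * killed_semigroup (T - s') (\<lambda>_. 1) (X s' \<omega>) \<partial>P x)"
        by (simp only: mult.assoc)
      moreover have "exp (l * s') * exp (l * (T - s')) = exp (l * T)" by (simp add: right_diff_distrib flip: exp_add)
      ultimately show ?thesis by simp
    qed
    finally have e1: "exp (l * T) * measure (P x) (\<Gamma> \<inter> survives T) = exp (l * s') * (\<integral>\<omega>. indicator \<Gamma> \<omega> * R (T - s') (\<lambda>_. 1) (X s' \<omega>) \<partial>P x)" .
    have iR: "integrable (P x) (\<lambda>\<omega>. R (T - s') (\<lambda>_. 1) (X s' \<omega>))" unfolding R_def using M(1) by simp
    have "(\<integral>\<omega>. indicator \<Gamma> \<omega> * R (T - s') (\<lambda>_. 1) (X s' \<omega>) \<partial>P x) - ?I = (\<integral>\<omega>. indicator \<Gamma> \<omega> * R (T - s') (\<lambda>_. 1) (X s' \<omega>) - indicator \<Gamma> \<omega> * \<eta> (X s' \<omega>) \<partial>P x)"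
      using iG[OF iR] iG[OF integrable_\<eta>_X[OF x s'0]] by simp
    moreover have "norm \<dots> \<le> (\<integral>\<omega>. C * exp (- \<gamma> * (T - s')) * killed \<psi> s' \<omega> \<partial>P x)"
    proof (rule norm_integral_le)
      show "integrable (P x) (\<lambda>\<omega>. C * exp (- \<gamma> * (T - s')) * killed \<psi> s' \<omega>)" using ipsi by simp
      show "AE \<omega> in P x. norm (indicator \<Gamma> \<omega> * R (T - s') (\<lambda>_. 1) (X s' \<omega>) - indicator \<Gamma> \<omega> * \<eta> (X s' \<omega>)) \<le> C * exp (- \<gamma> * (T - s')) * killed \<psi> s' \<omega>"
        using alive AE_space
      proof eventually_elim
        case (elim \<omega>)
        show ?case
        proof (cases "X s' \<omega> = cem")
          case True
          then have "\<omega> \<notin> survives s'" using X_alive[OF s'0 order_refl, of \<omega>] by auto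
          then show ?thesis using True killed_semigroup_cem[OF T'(1)] by (simp add: R_def \<eta>_cem killed_def)
        next
          case False
          then have sw: "\<omega> \<in> survives s'" and XE: "X s' \<omega> \<in> E"
            using elim s'0 by (auto simp: space_P[OF xS] X_in_space)
          have "\<bar>R (T - s') (\<lambda>_. 1) (X s' \<omega>) - \<eta> (X s' \<omega>)\<bar> \<le> C * \<psi> (X s' \<omega>) * exp (- \<gamma> * (T - s'))"
            using R_convergence[OF XE T'(1) dominated_one] prob_space.prob_space[OF prob_\<alpha>] by simp
          moreover have "killed \<psi> s' \<omega> = \<psi> (X s' \<omega>)" using sw by (simp add: killed_eq[OF s'0])
          ultimately show ?thesis
            using C_pos \<psi>_ge_1[OF XE] by (auto simp: mult_ac split: split_indicator)
        qed
      qed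
    qed
    ultimately have "\<bar>(\<integral>\<omega>. indicator \<Gamma> \<omega> * R (T - s') (\<lambda>_. 1) (X s' \<omega>) \<partial>P x) - ?I\<bar> \<le> C * exp (- \<gamma> * (T - s')) * Psi"
      by (simp add: Psi_def)
    then have "exp (l * s') * \<bar>(\<integral>\<omega>. indicator \<Gamma> \<omega> * R (T - s') (\<lambda>_. 1) (X s' \<omega>) \<partial>P x) - ?I\<bar> \<le> exp (l * s') * (C * exp (- \<gamma> * (T - s')) * Psi)"
      by (rule mult_left_mono) simp
    then show ?thesis unfolding e1 right_diff_distrib[symmetric] abs_mult by simp
  qed
  have ed: "((\<lambda>T. exp (- \<gamma> * (T - s'))) \<longlongrightarrow> 0) at_top" using \<gamma>_pos by real_asymp
  have "((\<lambda>T. exp (l * s') * (C * exp (- \<gamma> * (T - s')) * Psi)) \<longlongrightarrow> exp (l * s') * (C * 0 * Psi)) at_top"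
    by (intro tendsto_intros ed)
  then have lim0: "((\<lambda>T. exp (l * s') * (C * exp (- \<gamma> * (T - s')) * Psi)) \<longlongrightarrow> 0) at_top" by simp
  have "((\<lambda>T. exp (l * T) * measure (P x) (\<Gamma> \<inter> survives T) - exp (l * s') * ?I) \<longlongrightarrow> 0) at_top"
  proof (rule Lim_null_comparison[OF _ lim0])
    show "\<forall>\<^sub>F T in at_top. norm (exp (l * T) * measure (P x) (\<Gamma> \<inter> survives T) - exp (l * s') * ?I) \<le> exp (l * s') * (C * exp (- \<gamma> * (T - s')) * Psi)"
      using eventually_ge_at_top[of s'] by eventually_elim (use est in auto)
  qed
  then have lim: "((\<lambda>T. exp (l * T) * measure (P x) (\<Gamma> \<inter> survives T)) \<longlongrightarrow> exp (l * s') * ?I) at_top"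
    by (simp add: LIM_zero_iff)
  have t: "0 \<le> s' - s" using s' by simp
  have i: "integrable (P x) (killed \<eta> (s + (s' - s)))" using integrable_killed[OF x s'0 dominated_\<eta>] by simp
  note M = markov_killed[OF xS s t _ b \<eta>_measurable i, OF borel_measurable_indicator[OF \<Gamma>]]
  have "?I = (\<integral>\<omega>. indicator \<Gamma> \<omega> * killed \<eta> s' \<omega> \<partial>P x)"
  proof (rule integral_cong_AE)
    show "AE \<omega> in P x. indicator \<Gamma> \<omega> * \<eta> (X s' \<omega>) = indicator \<Gamma> \<omega> * killed \<eta> s' \<omega>"
      using survives_if_\<eta>_pos[OF x s'0] by eventually_elim simp
  qed measurable
  also have "\<dots> = (\<integral>\<omega>. indicator \<Gamma> \<omega> * killed_semigroup (s' - s) \<eta> (X s \<omega>) \<partial>P x)" using M(2) by simp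
  also have "\<dots> = (\<integral>\<omega>. exp (- l * (s' - s)) * (indicator \<Gamma> \<omega> * \<eta> (X s \<omega>)) \<partial>P x)"
    using s t by (intro Bochner_Integration.integral_cong) (auto simp: killed_semigroup_\<eta> X_in_space space_P[OF xS])
  finally have "exp (l * s') * ?I = exp (l * s') * exp (- l * (s' - s)) * (\<integral>\<omega>. indicator \<Gamma> \<omega> * \<eta> (X s \<omega>) \<partial>P x)" by simp
  also have "exp (l * s') * exp (- l * (s' - s)) = exp (l * s)" by (simp add: algebra_simps flip: exp_add)
  finally show ?thesis using lim by simp
qed

text \<open>
  Doob's transform of \<open>P x\<close> by the space-time harmonic function \<open>exp (l s) \<eta>\<close>.
\<close>

definition tilted :: "real \<Rightarrow> 'a \<Rightarrow> 'w measure" where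
  "tilted s x = density (P x) (\<lambda>\<omega>. ennreal (exp (l * s) * \<eta> (X s \<omega>) / \<eta> x))"

lemma Q_law_eq:
  assumes x: "x \<in> E" and pos: "0 < \<eta> x" and s: "0 \<le> s"
  shows "Q_law \<Omega> S cem X P s x = restr_to_subalg (tilted s x) (\<F> s)"
proof -
  have xS: "x \<in> space S" using x by simp
  interpret Px: prob_space "P x" by (rule prob_space_P[OF xS])
  note [measurable_cong] = sets_P[OF xS]
  have [measurable]: "X s \<in> \<Omega> \<rightarrow>\<^sub>M S" using s by auto
  have sub: "sets (\<F> s) \<subseteq> Pow (space \<Omega>)" using sets.space_closed[of "\<F> s"] by (simp add: space_filtration)
  have sp: "space (tilted s x) = space \<Omega>" by (simp add: tilted_def space_P[OF xS])
  have den: "((\<lambda>T. exp (l * T) * measure (P x) (survives T)) \<longlongrightarrow> \<eta> x) at_top"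
  proof -
    have "space \<Omega> \<in> sets (\<F> 0)" using sets.top[of "\<F> 0"] by (simp add: space_filtration)
    from survival_asymptotics[OF x order_refl this]
    have "((\<lambda>T. exp (l * T) * measure (P x) (space \<Omega> \<inter> survives T)) \<longlongrightarrow> (\<integral>\<omega>. indicator (space \<Omega>) \<omega> * \<eta> (X 0 \<omega>) \<partial>P x)) at_top" by simp
    moreover have "space \<Omega> \<inter> survives T = survives T" for T by (auto simp: survival_def)
    moreover have "(\<integral>\<omega>. indicator (space \<Omega>) \<omega> * \<eta> (X 0 \<omega>) \<partial>P x) = (\<integral>\<omega>. \<eta> x \<partial>P x)"
    proof (rule integral_cong_AE)
      show "AE \<omega> in P x. indicator (space \<Omega>) \<omega> * \<eta> (X 0 \<omega>) = \<eta> x"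
        using start[OF xS] AE_space by eventually_elim (simp add: space_P[OF xS])
      have [measurable]: "X 0 \<in> \<Omega> \<rightarrow>\<^sub>M S" by simp
      show "(\<lambda>\<omega>. indicator (space \<Omega>) \<omega> * \<eta> (X 0 \<omega>)) \<in> borel_measurable (P x)" by measurable
    qed simp
    ultimately show ?thesis by (simp add: Px.prob_space)
  qed
  have "ennreal (Lim at_top (\<lambda>T. \<P>(\<omega> in P x. \<omega> \<in> \<Gamma> \<bar> ereal T < hitting_time X cem \<omega>))) = emeasure (tilted s x) \<Gamma>"
    if \<Gamma>: "\<Gamma> \<in> sets (\<F> s)" for \<Gamma>
  proof -
    have Gm[measurable]: "\<Gamma> \<in> sets \<Omega>" using \<Gamma> filtration_le by auto
    have Gs: "\<Gamma> \<subseteq> space \<Omega>" using sets.sets_into_space[OF Gm] .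
    let ?I = "exp (l * s) * (\<integral>\<omega>. indicator \<Gamma> \<omega> * \<eta> (X s \<omega>) \<partial>P x)"
    have "((\<lambda>T. (exp (l * T) * measure (P x) (\<Gamma> \<inter> survives T)) / (exp (l * T) * measure (P x) (survives T))) \<longlongrightarrow> ?I / \<eta> x) at_top"
      by (rule tendsto_divide[OF survival_asymptotics[OF x s \<Gamma>] den]) (use pos in simp)
    moreover have "\<P>(\<omega> in P x. \<omega> \<in> \<Gamma> \<bar> ereal T < hitting_time X cem \<omega>) = (exp (l * T) * measure (P x) (\<Gamma> \<inter> survives T)) / (exp (l * T) * measure (P x) (survives T))" for T
    proof -
      have "{\<omega> \<in> space (P x). \<omega> \<in> \<Gamma> \<and> ereal T < hitting_time X cem \<omega>} = \<Gamma> \<inter> survives T"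
        "{\<omega> \<in> space (P x). ereal T < hitting_time X cem \<omega>} = survives T"
        using Gs by (auto simp: survival_def space_P[OF xS])
      then show ?thesis by (simp add: cond_prob_def)
    qed
    ultimately have "((\<lambda>T. \<P>(\<omega> in P x. \<omega> \<in> \<Gamma> \<bar> ereal T < hitting_time X cem \<omega>)) \<longlongrightarrow> ?I / \<eta> x) at_top" by simp
    then have "Lim at_top (\<lambda>T. \<P>(\<omega> in P x. \<omega> \<in> \<Gamma> \<bar> ereal T < hitting_time X cem \<omega>)) = ?I / \<eta> x"
      by (intro tendsto_Lim) auto
    moreover have "emeasure (tilted s x) \<Gamma> = ennreal (?I / \<eta> x)"
    proof -
      have "emeasure (tilted s x) \<Gamma> = (\<integral>\<^sup>+\<omega>. ennreal (exp (l * s) * \<eta> (X s \<omega>) / \<eta> x) * indicator \<Gamma> \<omega> \<partial>P x)"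
        unfolding tilted_def using Gm by (intro emeasure_density) (auto simp: sets_P[OF xS])
      also have "\<dots> = (\<integral>\<^sup>+\<omega>. ennreal ((exp (l * s) / \<eta> x) * (indicator \<Gamma> \<omega> * \<eta> (X s \<omega>))) \<partial>P x)"
        by (intro nn_integral_cong) (auto split: split_indicator)
      also have "\<dots> = ennreal (\<integral>\<omega>. (exp (l * s) / \<eta> x) * (indicator \<Gamma> \<omega> * \<eta> (X s \<omega>)) \<partial>P x)"
      proof (rule nn_integral_eq_integral)
        have "integrable (P x) (\<lambda>\<omega>. indicator \<Gamma> \<omega> * \<eta> (X s \<omega>))"
          using integrable_real_mult_indicator[OF _ integrable_\<eta>_X[OF x s], of \<Gamma>] Gm by (simp add: sets_P[OF xS] mult.commute)
        then show "integrable (P x) (\<lambda>\<omega>. (exp (l * s) / \<eta> x) * (indicator \<Gamma> \<omega> * \<eta> (X s \<omega>)))" by (rule integrable_mult_right)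
        show "AE \<omega> in P x. 0 \<le> (exp (l * s) / \<eta> x) * (indicator \<Gamma> \<omega> * \<eta> (X s \<omega>))"
          using pos \<eta>_nonneg s by (intro AE_I2) (simp add: space_P[OF xS] X_in_space)
      qed
      also have "(\<integral>\<omega>. (exp (l * s) / \<eta> x) * (indicator \<Gamma> \<omega> * \<eta> (X s \<omega>)) \<partial>P x) = ?I / \<eta> x" by simp
      finally show ?thesis .
    qed
    ultimately show ?thesis by simp
  qed
  then show ?thesis
    unfolding Q_law_def restr_to_subalg_def sp
    by (intro measure_of_eq[OF sub]) (simp add: sets.sigma_sets_eq[of "\<F> s", unfolded space_filtration])
qed

lemma subalgebra_tilted: "x \<in> E \<Longrightarrow> subalgebra (tilted s x) (\<F> s)"
  using subalgebra_filtration[of x s] by (simp add: subalgebra_def tilted_def)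

lemma integral_Q_law:
  assumes x: "x \<in> E" and pos: "0 < \<eta> x" and s: "0 \<le> s" and Z: "Z \<in> borel_measurable (\<F> s)"
  shows "(\<integral>\<omega>. Z \<omega> \<partial>Q_law \<Omega> S cem X P s x) = exp (l * s) / \<eta> x * (\<integral>\<omega>. \<eta> (X s \<omega>) * Z \<omega> \<partial>P x)"
proof -
  have xS: "x \<in> space S" using x by simp
  note [measurable_cong] = sets_P[OF xS]
  have [measurable]: "X s \<in> \<Omega> \<rightarrow>\<^sub>M S" using s by auto
  note [measurable] = measurable_filtration_imp[OF Z]
  have "(\<integral>\<omega>. Z \<omega> \<partial>Q_law \<Omega> S cem X P s x) = (\<integral>\<omega>. Z \<omega> \<partial>tilted s x)"
    unfolding Q_law_eq[OF x pos s] by (rule integral_subalgebra2[OF subalgebra_tilted[OF x] Z])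
  also have "\<dots> = (\<integral>\<omega>. (exp (l * s) * \<eta> (X s \<omega>) / \<eta> x) *\<^sub>R Z \<omega> \<partial>P x)"
    unfolding tilted_def using pos \<eta>_nonneg s
    by (intro integral_density) (auto simp: space_P[OF xS] X_in_space)
  also have "\<dots> = (\<integral>\<omega>. (exp (l * s) / \<eta> x) * (\<eta> (X s \<omega>) * Z \<omega>) \<partial>P x)" by (simp add: mult_ac)
  finally show ?thesis by simp
qed

abbreviation "E' \<equiv> {x \<in> space (live S cem). 0 < \<eta> x}"

lemma nn_integral_\<eta>_X:
  assumes x: "x \<in> E" and s: "0 \<le> s"
  shows "(\<integral>\<^sup>+\<omega>. ennreal (\<eta> (X s \<omega>)) \<partial>P x) = ennreal (exp (- l * s) * \<eta> x)"
proof -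
  have "(\<integral>\<^sup>+\<omega>. ennreal (\<eta> (X s \<omega>)) \<partial>P x) = (\<integral>\<^sup>+\<omega>. indicator (survives s) \<omega> * ennreal (\<eta> (X s \<omega>)) \<partial>P x)"
    using survives_if_\<eta>_pos[OF x s] by (intro nn_integral_cong_AE) (auto simp: killed_eq[OF s] split: split_indicator)
  then show ?thesis using \<eta>_eigen[OF x s] by simp
qed

lemma Q_law_kernel:
  assumes s: "0 \<le> s" and sM: "sets M = sets (restrict_space (live S cem) E')"
  shows "Q_law \<Omega> S cem X P s \<in> M \<rightarrow>\<^sub>M subprob_algebra (\<F> s)"
    and "x \<in> E' \<Longrightarrow> emeasure (Q_law \<Omega> S cem X P s x) (space \<Omega>) = 1"
proof -
  have Xs: "X s \<in> \<Omega> \<rightarrow>\<^sub>M S" using s by auto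
  have em: "emeasure (Q_law \<Omega> S cem X P s x) \<Gamma> = ennreal (1 / \<eta> x) * (\<integral>\<^sup>+\<omega>. indicator \<Gamma> \<omega> * ennreal (exp (l * s) * \<eta> (X s \<omega>)) \<partial>P x)"
    if x: "x \<in> E'" and \<Gamma>: "\<Gamma> \<in> sets (\<F> s)" for x \<Gamma>
  proof -
    have xE: "x \<in> E" and xS: "x \<in> space S" and pos: "0 < \<eta> x" using x by (auto simp: space_live)
    note [measurable_cong] = sets_P[OF xS] and [measurable] = Xs
    have Gm[measurable]: "\<Gamma> \<in> sets \<Omega>" using \<Gamma> filtration_le by auto
    have "emeasure (Q_law \<Omega> S cem X P s x) \<Gamma> = emeasure (tilted s x) \<Gamma>"
      unfolding Q_law_eq[OF xE pos s] by (rule emeasure_restr_to_subalg[OF subalgebra_tilted[OF xE] \<Gamma>])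
    also have "\<dots> = (\<integral>\<^sup>+\<omega>. ennreal (exp (l * s) * \<eta> (X s \<omega>) / \<eta> x) * indicator \<Gamma> \<omega> \<partial>P x)"
      unfolding tilted_def using Gm by (intro emeasure_density) (auto simp: sets_P[OF xS])
    also have "\<dots> = (\<integral>\<^sup>+\<omega>. ennreal (1 / \<eta> x) * (indicator \<Gamma> \<omega> * ennreal (exp (l * s) * \<eta> (X s \<omega>))) \<partial>P x)"
    proof (rule nn_integral_cong)
      fix \<omega> assume "\<omega> \<in> space (P x)"
      then have "0 \<le> \<eta> (X s \<omega>)" using \<eta>_nonneg s by (simp add: space_P[OF xS] X_in_space)
      then show "ennreal (exp (l * s) * \<eta> (X s \<omega>) / \<eta> x) * indicator \<Gamma> \<omega> = ennreal (1 / \<eta> x) * (indicator \<Gamma> \<omega> * ennreal (exp (l * s) * \<eta> (X s \<omega>)))"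
        using pos by (auto simp: ennreal_mult[symmetric] split: split_indicator)
    qed
    also have "\<dots> = ennreal (1 / \<eta> x) * (\<integral>\<^sup>+\<omega>. indicator \<Gamma> \<omega> * ennreal (exp (l * s) * \<eta> (X s \<omega>)) \<partial>P x)"
      by (rule nn_integral_cmult) measurable
    finally show ?thesis .
  qed
  have one: "emeasure (Q_law \<Omega> S cem X P s x) (space \<Omega>) = 1" if x: "x \<in> E'" for x
  proof -
    have xE: "x \<in> E" and xS: "x \<in> space S" and pos: "0 < \<eta> x" using x by (auto simp: space_live)
    note [measurable_cong] = sets_P[OF xS] and [measurable] = Xs
    have top: "space \<Omega> \<in> sets (\<F> s)" using sets.top[of "\<F> s"] by (simp add: space_filtration)
    have "(\<integral>\<^sup>+\<omega>. indicator (space \<Omega>) \<omega> * ennreal (exp (l * s) * \<eta> (X s \<omega>)) \<partial>P x) = (\<integral>\<^sup>+\<omega>. ennreal (exp (l * s)) * ennreal (\<eta> (X s \<omega>)) \<partial>P x)"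
      using \<eta>_nonneg s by (intro nn_integral_cong) (simp add: space_P[OF xS] X_in_space ennreal_mult)
    also have "\<dots> = ennreal (exp (l * s)) * ennreal (exp (- l * s) * \<eta> x)"
      unfolding nn_integral_\<eta>_X[OF xE s, symmetric] by (rule nn_integral_cmult) measurable
    also have "\<dots> = ennreal (\<eta> x)" using pos by (simp add: ennreal_mult[symmetric] mult.assoc[symmetric] flip: exp_add)
    finally show ?thesis using em[OF x top] pos by (simp add: ennreal_mult[symmetric])
  qed
  show "x \<in> E' \<Longrightarrow> emeasure (Q_law \<Omega> S cem X P s x) (space \<Omega>) = 1" by (rule one)
  have setsQ: "sets (Q_law \<Omega> S cem X P s x) = sets (\<F> s)" if "x \<in> E'" for x
    using that by (auto simp: Q_law_eq[OF _ _ s] space_live sets_restr_to_subalg[OF subalgebra_tilted])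
  have "Q_law \<Omega> S cem X P s \<in> restrict_space (live S cem) E' \<rightarrow>\<^sub>M subprob_algebra (\<F> s)"
  proof (rule measurable_subprob_algebra)
    fix x assume "x \<in> space (restrict_space (live S cem) E')"
    then have x: "x \<in> E'" by (auto simp: space_restrict_space)
    show "sets (Q_law \<Omega> S cem X P s x) = sets (\<F> s)" by (rule setsQ[OF x])
    have spQ: "space (Q_law \<Omega> S cem X P s x) = space \<Omega>" using sets_eq_imp_space_eq[OF setsQ[OF x]] by (simp add: space_filtration)
    have "space \<Omega> \<noteq> {}" using prob_space.not_empty[OF prob_space_P[of x]] x by (auto simp: space_live space_P)
    then show "subprob_space (Q_law \<Omega> S cem X P s x)"
      using one[OF x] spQ by (intro subprob_spaceI) auto
  next
    fix \<Gamma> assume \<Gamma>: "\<Gamma> \<in> sets (\<F> s)"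
    then have Gm: "\<Gamma> \<in> sets \<Omega>" using filtration_le by auto
    have "(\<lambda>\<omega>. indicator \<Gamma> \<omega> * ennreal (exp (l * s) * \<eta> (X s \<omega>))) \<in> borel_measurable \<Omega>"
      using Gm Xs by measurable
    from measurable_compose[OF kernel_subprob nn_integral_measurable_subprob_algebra[OF this]]
    have "(\<lambda>x. ennreal (1 / \<eta> x) * (\<integral>\<^sup>+\<omega>. indicator \<Gamma> \<omega> * ennreal (exp (l * s) * \<eta> (X s \<omega>)) \<partial>P x)) \<in> borel_measurable S"
      by measurable
    then have "(\<lambda>x. ennreal (1 / \<eta> x) * (\<integral>\<^sup>+\<omega>. indicator \<Gamma> \<omega> * ennreal (exp (l * s) * \<eta> (X s \<omega>)) \<partial>P x)) \<in> borel_measurable (restrict_space (live S cem) E')"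
      unfolding live_def by (intro measurable_restrict_space1)
    then show "(\<lambda>x. emeasure (Q_law \<Omega> S cem X P s x) \<Gamma>) \<in> borel_measurable (restrict_space (live S cem) E')"
      by (rule measurable_cong[THEN iffD1, rotated]) (auto simp: space_restrict_space em[OF _ \<Gamma>])
  qed
  then show "Q_law \<Omega> S cem X P s \<in> M \<rightarrow>\<^sub>M subprob_algebra (\<F> s)"
    by (simp add: measurable_cong_sets[OF sM refl])
qed

lemma killed_semigroup_bounded_\<eta>:
  assumes x: "x \<in> E" and s: "0 \<le> s" and g: "g \<in> borel_measurable S"
  shows "(\<integral>\<omega>. \<eta> (X s \<omega>) * g (X s \<omega>) \<partial>P x) = killed_semigroup s (\<lambda>y. g y * \<eta> y) x"
proof -
  have xS: "x \<in> space S" using x by simp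
  note [measurable_cong] = sets_P[OF xS] and [measurable] = g
  have [measurable]: "X s \<in> \<Omega> \<rightarrow>\<^sub>M S" using s by auto
  show ?thesis
    unfolding killed_semigroup_def
  proof (rule integral_cong_AE)
    show "AE \<omega> in P x. \<eta> (X s \<omega>) * g (X s \<omega>) = killed (\<lambda>y. g y * \<eta> y) s \<omega>"
      using survives_if_\<eta>_pos[OF x s]
      by eventually_elim (auto simp: killed_eq[OF s] split: split_indicator_asm split_indicator)
  qed measurable
qed

text \<open>
  The density \<open>\<eta>\<close> of the invariant law of the Q-process cancels the factor \<open>1 / \<eta> x\<close> of the transform,
  and started from a zero of \<open>\<eta>\<close> the process is almost surely at a zero of \<open>\<eta>\<close> at time \<open>s\<close>.
\<close>

lemma integral_Q_beta:
  assumes s: "0 \<le> s" and g: "g \<in> borel_measurable S" "h \<in> borel_measurable S"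
    and b: "\<And>y. \<bar>g y\<bar> \<le> a" "\<And>y. \<bar>h y\<bar> \<le> b"
  shows "(\<integral>\<omega>. g (X 0 \<omega>) * h (X s \<omega>) \<partial>Q_beta \<Omega> S cem X P \<alpha> \<eta> s) = (\<integral>x. g x * R s (\<lambda>y. h y * \<eta> y) x \<partial>\<alpha>)"
proof -
  let ?\<beta> = "beta_measure \<eta> \<alpha>"
  let ?M = "restrict_space ?\<beta> E'"
  let ?Z = "\<lambda>\<omega>. g (X 0 \<omega>) * h (X s \<omega>)"
  interpret a: prob_space \<alpha> by (rule prob_\<alpha>)
  have sb: "sets ?\<beta> = sets (live S cem)" by (simp add: beta_measure_def sets_\<alpha>)
  have spb: "space ?\<beta> = E" using sets_eq_imp_space_eq[OF sb] by (simp add: space_live)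
  have \<eta>a: "\<eta> \<in> borel_measurable \<alpha>" by (rule \<alpha>_measurableI) measurable
  have "prob_space ?\<beta>"
  proof
    have "emeasure ?\<beta> (space ?\<beta>) = (\<integral>\<^sup>+x. 1 \<partial>?\<beta>)" by simp
    also have "\<dots> = (\<integral>\<^sup>+x. ennreal (\<eta> x) * 1 \<partial>\<alpha>)"
      unfolding beta_measure_def using \<eta>a by (intro nn_integral_density) auto
    finally show "emeasure ?\<beta> (space ?\<beta>) = 1" by (simp add: nn_\<alpha>_\<eta>)
  qed
  then interpret b: prob_space ?\<beta> .
  have E'm: "E' \<in> sets (live S cem)" using \<eta>_live by measurable
  have E's: "E' \<inter> space ?\<beta> \<in> sets ?\<beta>" using sets.Int[OF E'm sets.top] unfolding sb spb space_live[symmetric] .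
  have sM: "sets ?M = sets (restrict_space (live S cem) E')" by (rule sets_restrict_space_cong[OF sb])
  have finM: "finite_measure ?M" using E'm by (intro finite_measure_restrict_space b.finite_measure_axioms) (simp add: sb)
  have Zm: "?Z \<in> borel_measurable (\<F> s)"
    using measurable_compose[OF measurable_filtration_X[OF order_refl s] g(1)] measurable_compose[OF measurable_filtration_X[OF s order_refl] g(2)]
    by measurable
  have Zb: "\<bar>?Z \<omega>\<bar> \<le> a * b" for \<omega>
    unfolding abs_mult using b by (intro mult_mono) (auto intro: order_trans[OF abs_ge_zero])
  have "(\<integral>\<omega>. ?Z \<omega> \<partial>Q_beta \<Omega> S cem X P \<alpha> \<eta> s) = (\<integral>x. (\<integral>\<omega>. ?Z \<omega> \<partial>Q_law \<Omega> S cem X P s x) \<partial>?M)"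
    unfolding Q_beta_def
  proof (rule integral_bind[OF Zm Zb Q_law_kernel(1)[OF s sM] finM])
    show "AE x in ?M. emeasure (Q_law \<Omega> S cem X P s x) (space (Q_law \<Omega> S cem X P s x)) \<le> ennreal 1"
    proof (rule AE_I2)
      fix x assume x: "x \<in> space ?M"
      then have "subprob_space (Q_law \<Omega> S cem X P s x)"
        using measurable_space[OF Q_law_kernel(1)[OF s sM]] by (auto simp: space_subprob_algebra)
      then show "emeasure (Q_law \<Omega> S cem X P s x) (space (Q_law \<Omega> S cem X P s x)) \<le> ennreal 1"
        by (simp add: subprob_space.emeasure_space_le_1)
    qed
  qed
  also have "\<dots> = (\<integral>x. (1 / \<eta> x) * (g x * R s (\<lambda>y. h y * \<eta> y) x) \<partial>?M)"
  proof (rule Bochner_Integration.integral_cong[OF refl])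
    fix x assume "x \<in> space ?M"
    then have x: "x \<in> E" and pos: "0 < \<eta> x" by (auto simp: space_restrict_space space_live)
    have xS: "x \<in> space S" using x by simp
    note [measurable_cong] = sets_P[OF xS] and [measurable] = g
    have [measurable]: "X s \<in> \<Omega> \<rightarrow>\<^sub>M S" "X 0 \<in> \<Omega> \<rightarrow>\<^sub>M S" using s by auto
    have "(\<integral>\<omega>. \<eta> (X s \<omega>) * ?Z \<omega> \<partial>P x) = (\<integral>\<omega>. g x * (\<eta> (X s \<omega>) * h (X s \<omega>)) \<partial>P x)"
    proof (rule integral_cong_AE)
      show "AE \<omega> in P x. \<eta> (X s \<omega>) * ?Z \<omega> = g x * (\<eta> (X s \<omega>) * h (X s \<omega>))"
        using start[OF xS] by eventually_elim simp
    qed measurable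
    also have "\<dots> = g x * killed_semigroup s (\<lambda>y. h y * \<eta> y) x" using killed_semigroup_bounded_\<eta>[OF x s g(2)] by simp
    finally show "(\<integral>\<omega>. ?Z \<omega> \<partial>Q_law \<Omega> S cem X P s x) = (1 / \<eta> x) * (g x * R s (\<lambda>y. h y * \<eta> y) x)"
      unfolding integral_Q_law[OF x pos s Zm] by (simp add: R_def)
  qed
  also have "\<dots> = (\<integral>x. indicator E' x *\<^sub>R ((1 / \<eta> x) * (g x * R s (\<lambda>y. h y * \<eta> y) x)) \<partial>?\<beta>)"
    by (rule integral_restrict_space[OF E's])
  also have "\<dots> = (\<integral>x. \<eta> x *\<^sub>R (indicator E' x *\<^sub>R ((1 / \<eta> x) * (g x * R s (\<lambda>y. h y * \<eta> y) x))) \<partial>\<alpha>)"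
  proof -
    have [measurable]: "killed_semigroup s (\<lambda>y. h y * \<eta> y) \<in> borel_measurable S" using g(2) by measurable
    have "(\<lambda>x. (1 / \<eta> x) * (g x * R s (\<lambda>y. h y * \<eta> y) x)) \<in> borel_measurable S" unfolding R_def using g by measurable
    note m = \<alpha>_measurableI[OF this]
    have [measurable]: "E' \<in> sets \<alpha>" using E'm by (simp add: sets_\<alpha>)
    have m': "(\<lambda>x. indicator E' x *\<^sub>R ((1 / \<eta> x) * (g x * R s (\<lambda>y. h y * \<eta> y) x))) \<in> borel_measurable \<alpha>"
      using m by measurable
    show ?thesis
      unfolding beta_measure_def using \<eta>_nonneg
      by (intro integral_density[OF m' \<eta>a]) (auto simp: space_\<alpha>)
  qed
  also have "\<dots> = (\<integral>x. g x * R s (\<lambda>y. h y * \<eta> y) x \<partial>\<alpha>)"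
  proof (rule Bochner_Integration.integral_cong[OF refl])
    fix x assume "x \<in> space \<alpha>"
    then have x: "x \<in> E" by (simp add: space_\<alpha>)
    show "\<eta> x *\<^sub>R (indicator E' x *\<^sub>R ((1 / \<eta> x) * (g x * R s (\<lambda>y. h y * \<eta> y) x))) = g x * R s (\<lambda>y. h y * \<eta> y) x"
    proof (cases "0 < \<eta> x")
      case True
      then show ?thesis using x by (simp add: space_live)
    next
      case False
      then have 0: "\<eta> x = 0" using \<eta>_nonneg[of x] x by simp
      have xS: "x \<in> space S" using x by simp
      note [measurable_cong] = sets_P[OF xS]
      have [measurable]: "X s \<in> \<Omega> \<rightarrow>\<^sub>M S" using s by auto
      have "(\<lambda>\<omega>. ennreal (\<eta> (X s \<omega>))) \<in> borel_measurable (P x)" by measurable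
      then have "AE \<omega> in P x. \<eta> (X s \<omega>) \<le> 0"
        using nn_integral_\<eta>_X[OF x s] 0 by (simp add: nn_integral_0_iff_AE ennreal_eq_0_iff)
      then have "AE \<omega> in P x. \<eta> (X s \<omega>) * h (X s \<omega>) = 0"
        using AE_space
      proof eventually_elim
        case (elim \<omega>)
        then show ?case using \<eta>_nonneg[of "X s \<omega>"] s by (simp add: space_P[OF xS] X_in_space)
      qed
      then have "(\<integral>\<omega>. \<eta> (X s \<omega>) * h (X s \<omega>) \<partial>P x) = 0" by (rule integral_eq_zero_AE)
      then show ?thesis using 0 killed_semigroup_bounded_\<eta>[OF x s g(2)] by (simp add: R_def)
    qed
  qed
  finally show ?thesis .
qed

lemma \<alpha>_R_invariant:
  assumes s: "0 \<le> s" and g: "dominated c g"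
  shows "(\<integral>x. R s g x \<partial>\<alpha>) = (\<integral>x. g x \<partial>\<alpha>)"
proof -
  have nonneg: "(\<integral>x. R s h x \<partial>\<alpha>) = (\<integral>x. h x \<partial>\<alpha>)" if h: "dominated c h" and h0: "\<And>y. 0 \<le> h y" for h
  proof -
    note hm[measurable] = dominated_measurable[OF h]
    have k0: "0 \<le> killed h s \<omega>" for \<omega> by (simp add: killed_def h0)
    have R0: "0 \<le> R s h x" for x unfolding R_def killed_semigroup_def by (intro mult_nonneg_nonneg integral_nonneg_AE) (auto simp: k0)
    have Rm: "R s h \<in> borel_measurable S" unfolding R_def by measurable
    have "(\<integral>\<^sup>+x. ennreal (R s h x) \<partial>\<alpha>) = (\<integral>\<^sup>+x. ennreal (exp (l * s)) * (\<integral>\<^sup>+\<omega>. indicator (survives s) \<omega> * ennreal (h (X s \<omega>)) \<partial>P x) \<partial>\<alpha>)"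
    proof (rule nn_integral_cong)
      fix x assume "x \<in> space \<alpha>"
      then have x: "x \<in> E" by (simp add: space_\<alpha>)
      have "ennreal (killed_semigroup s h x) = (\<integral>\<^sup>+\<omega>. ennreal (killed h s \<omega>) \<partial>P x)"
        unfolding killed_semigroup_def using integrable_killed[OF x s h] k0 by (intro nn_integral_eq_integral[symmetric]) auto
      also have "\<dots> = (\<integral>\<^sup>+\<omega>. indicator (survives s) \<omega> * ennreal (h (X s \<omega>)) \<partial>P x)"
        by (intro nn_integral_cong) (auto simp: killed_eq[OF s] split: split_indicator)
      finally show "ennreal (R s h x) = ennreal (exp (l * s)) * (\<integral>\<^sup>+\<omega>. indicator (survives s) \<omega> * ennreal (h (X s \<omega>)) \<partial>P x)"
        by (simp add: R_def ennreal_mult')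
    qed
    also have "\<dots> = ennreal (exp (l * s)) * (\<integral>\<^sup>+x. (\<integral>\<^sup>+\<omega>. indicator (survives s) \<omega> * ennreal (h (X s \<omega>)) \<partial>P x) \<partial>\<alpha>)"
    proof (rule nn_integral_cmult, rule \<alpha>_measurableI)
      have [measurable]: "X s \<in> \<Omega> \<rightarrow>\<^sub>M S" "survives s \<in> sets \<Omega>" using s sets_survival by auto
      show "(\<lambda>x. \<integral>\<^sup>+\<omega>. indicator (survives s) \<omega> * ennreal (h (X s \<omega>)) \<partial>P x) \<in> borel_measurable S"
        by (rule measurable_compose[OF kernel_subprob nn_integral_measurable_subprob_algebra]) measurable
    qed
    also have "\<dots> = ennreal (exp (l * s)) * (ennreal (exp (- l * s)) * (\<integral>\<^sup>+x. ennreal (h x) \<partial>\<alpha>))"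
      by (subst nn_integral_\<alpha>_killed[OF s]) auto
    also have "\<dots> = (\<integral>\<^sup>+x. ennreal (h x) \<partial>\<alpha>)"
      by (simp add: mult.assoc[symmetric] ennreal_mult[symmetric] flip: exp_add)
    finally show ?thesis
      using R0 h0 \<alpha>_measurableI[OF Rm] \<alpha>_measurableI[OF hm] by (subst (1 2) integral_eq_nn_integral) auto
  qed
  let ?p = "\<lambda>y. max 0 (g y)" and ?m = "\<lambda>y. max 0 (- g y)"
  have dom: "dominated c h" if "h \<in> borel_measurable S" "\<And>y. \<bar>h y\<bar> \<le> \<bar>g y\<bar>" for h
    using g that by (auto simp: dominated_def intro: order_trans)
  note [measurable] = dominated_measurable[OF g]
  have dp: "dominated c ?p" and dm: "dominated c ?m"
    by (rule dom; auto)+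
  have Rdiff: "R s g x = R s ?p x - R s ?m x" if x: "x \<in> E" for x
  proof -
    have "killed g s \<omega> = killed ?p s \<omega> - killed ?m s \<omega>" for \<omega> by (auto simp: killed_def split: split_indicator)
    then show ?thesis
      using integrable_killed[OF x s dp] integrable_killed[OF x s dm]
      by (simp add: R_def killed_semigroup_def right_diff_distrib)
  qed
  have iR: "integrable \<alpha> (R s h)" if "dominated c h" for h
  proof (rule integrable_\<alpha>)
    show "dominated (c * K) (R s h)"
      using R_bound[OF _ s that] K_pos killed_semigroup_measurable[OF dominated_measurable[OF that], of s] that unfolding dominated_def R_def by auto
  qed
  have "(\<integral>x. R s g x \<partial>\<alpha>) = (\<integral>x. R s ?p x - R s ?m x \<partial>\<alpha>)"
    by (rule Bochner_Integration.integral_cong) (auto simp: space_\<alpha> Rdiff)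
  also have "\<dots> = (\<integral>x. ?p x \<partial>\<alpha>) - (\<integral>x. ?m x \<partial>\<alpha>)"
    using iR[OF dp] iR[OF dm] nonneg[OF dp] nonneg[OF dm] by simp
  also have "\<dots> = (\<integral>x. ?p x - ?m x \<partial>\<alpha>)"
    using integrable_\<alpha>[OF dp] integrable_\<alpha>[OF dm] by simp
  also have "(\<lambda>x. ?p x - ?m x) = g" by auto
  finally show ?thesis .
qed

end

context centred_functional
begin

lemma covariance_Q_beta:
  assumes s: "0 \<le> s" and f0: "\<And>y. y \<in> space S \<Longrightarrow> f0 y = f y + m"
  shows "covariance (Q_beta \<Omega> S cem X P \<alpha> \<eta> s) (\<lambda>\<omega>. f0 (X 0 \<omega>)) (\<lambda>\<omega>. f0 (X s \<omega>)) = lag s"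
proof -
  let ?Q = "Q_beta \<Omega> S cem X P \<alpha> \<eta> s"
  have spQ: "space ?Q = space \<Omega>"
  proof -
    have sM: "sets (restrict_space (beta_measure \<eta> \<alpha>) E') = sets (restrict_space (live S cem) E')"
      by (rule sets_restrict_space_cong) (simp add: beta_measure_def sets_\<alpha>)
    have "E' \<noteq> {}"
    proof
      assume "E' = {}"
      then have "\<forall>x\<in>E. \<eta> x = 0" using \<eta>_nonneg by (fastforce simp: space_live intro: antisym)
      then have "(\<integral>x. \<eta> x \<partial>\<alpha>) = (\<integral>x. 0 \<partial>\<alpha>)" by (intro Bochner_Integration.integral_cong) (auto simp: space_\<alpha>)
      then show False using \<alpha>_\<eta> by simp
    qed
    then have "space (restrict_space (beta_measure \<eta> \<alpha>) E') \<noteq> {}"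
      unfolding sets_eq_imp_space_eq[OF sM] by (auto simp: space_restrict_space)
    then have "sets ?Q = sets (\<F> s)"
      unfolding Q_beta_def using sets_kernel[OF Q_law_kernel(1)[OF s sM]] by (intro sets_bind) auto
    then show ?thesis using sets_eq_imp_space_eq space_filtration by metis
  qed
  have f0X: "f0 (X r \<omega>) = f (X r \<omega>) + m" if "0 \<le> r" "\<omega> \<in> space ?Q" for r \<omega>
    using that by (simp add: f0 X_in_space spQ)
  have fmm: "(\<lambda>y. f y + m) \<in> borel_measurable S" by measurable
  have fmb: "\<bar>f y + m\<bar> \<le> B + \<bar>m\<bar>" for y using f_bounded[of y] by linarith
  have dfe: "dominated (B * H) (\<lambda>y. f y * \<eta> y)" by (rule dominated_f[OF dominated_\<eta>])
  have int: "(\<integral>y. (f y + m) * \<eta> y \<partial>\<alpha>) = m"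
    using integrable_\<alpha>[OF dfe] integrable_\<alpha>[OF dominated_\<eta>] f_centred \<alpha>_\<eta>
    by (simp add: distrib_right)
  have e0: "(\<integral>\<omega>. f0 (X 0 \<omega>) \<partial>?Q) = m"
  proof -
    have "(\<integral>\<omega>. f0 (X 0 \<omega>) \<partial>?Q) = (\<integral>\<omega>. (f (X 0 \<omega>) + m) * (\<lambda>_. 1) (X s \<omega>) \<partial>?Q)"
      by (rule Bochner_Integration.integral_cong) (auto simp: f0X)
    also have "\<dots> = (\<integral>x. (f x + m) * R s (\<lambda>y. 1 * \<eta> y) x \<partial>\<alpha>)"
      by (rule integral_Q_beta[OF s fmm _ fmb, where b=1]) auto
    also have "\<dots> = (\<integral>x. (f x + m) * \<eta> x \<partial>\<alpha>)"
      using s by (intro Bochner_Integration.integral_cong) (auto simp: space_\<alpha> R_\<eta>)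
    finally show ?thesis by (simp add: int)
  qed
  have es: "(\<integral>\<omega>. f0 (X s \<omega>) \<partial>?Q) = m"
  proof -
    have "(\<integral>\<omega>. f0 (X s \<omega>) \<partial>?Q) = (\<integral>\<omega>. (\<lambda>_. 1) (X 0 \<omega>) * (f (X s \<omega>) + m) \<partial>?Q)"
      using s by (intro Bochner_Integration.integral_cong) (auto simp: f0X)
    also have "\<dots> = (\<integral>x. 1 * R s (\<lambda>y. (f y + m) * \<eta> y) x \<partial>\<alpha>)"
      by (rule integral_Q_beta[OF s _ fmm _ fmb, where a=1]) auto
    also have "\<dots> = (\<integral>x. (f x + m) * \<eta> x \<partial>\<alpha>)"
      using \<alpha>_R_invariant[OF s dominated_add[OF dfe dominated_scale[OF dominated_\<eta>, of m]]]
      by (simp add: distrib_right)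
    finally show ?thesis by (simp add: int)
  qed
  have "covariance ?Q (\<lambda>\<omega>. f0 (X 0 \<omega>)) (\<lambda>\<omega>. f0 (X s \<omega>)) = (\<integral>\<omega>. f (X 0 \<omega>) * f (X s \<omega>) \<partial>?Q)"
    unfolding covariance_def e0 es using s by (intro Bochner_Integration.integral_cong) (auto simp: f0X)
  also have "\<dots> = lag s"
    unfolding lag_def fe_def[abs_def] by (rule integral_Q_beta[OF s f_measurable f_measurable f_bounded f_bounded])
  finally show ?thesis .
qed

lemma asymptotic_variance_eq:
  assumes "\<And>y. y \<in> space S \<Longrightarrow> f0 y = f y + m"
  shows "asymptotic_variance \<Omega> S cem X P \<alpha> \<eta> f0 = 2 * half_variance"
  unfolding asymptotic_variance_def half_variance_def
  by (intro arg_cong[where f="\<lambda>z. 2 * z"] set_lebesgue_integral_cong) (auto simp: covariance_Q_beta[OF _ assms])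

end

section \<open>Characteristic functions\<close>

lemma char_normal_density:
  assumes "0 < \<sigma>"
  shows "char (density lborel (normal_density 0 \<sigma>)) u = complex_of_real (exp (- (u\<^sup>2 * \<sigma>\<^sup>2 / 2)))"
proof -
  define N where "N = density lborel (normal_density 0 \<sigma>)"
  interpret N: prob_space N unfolding N_def by (rule prob_space_normal_density[OF assms])
  have "distributed N lborel (\<lambda>x. x) (normal_density 0 \<sigma>)"
    by (auto simp: distributed_def N_def distr_id2 intro!: distr_id2)
  from N.normal_density_affine[OF this assms, of "1 / \<sigma>" 0]
  have d: "distributed N lborel (\<lambda>x. x / \<sigma>) std_normal_density" using assms by simp
  then have e: "distr N lborel (\<lambda>x. x / \<sigma>) = std_normal_distribution"
    by (simp add: distributed_def)
  have "char N u = (\<integral>x. iexp (u * \<sigma> * (x / \<sigma>)) \<partial>N)"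
    unfolding char_def using assms by simp
  also have "\<dots> = (\<integral>x. iexp (u * \<sigma> * x) \<partial>distr N lborel (\<lambda>x. x / \<sigma>))"
    by (subst integral_distr) (auto simp: N_def)
  also have "\<dots> = char std_normal_distribution (u * \<sigma>)" unfolding e by (simp add: char_def)
  finally show ?thesis by (simp add: N_def char_std_normal_distribution power_mult_distrib)
qed

text \<open>
  Levy's continuity theorem speaks about sequences. Along a sequence tending to infinity the indices are
  replaced by their maximum with \<open>1\<close>, which changes only finitely many of the measures.
\<close>

lemma weakly_converges_at_topI_char:
  fixes Lw :: "real \<Rightarrow> real measure"
  assumes L: "\<And>t. 1 \<le> t \<Longrightarrow> real_distribution (Lw t)" and N: "real_distribution N"
    and char: "\<And>u. ((\<lambda>t. char (Lw t) u) \<longlongrightarrow> char N u) at_top"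
  shows "weakly_converges Lw N at_top"
  unfolding weakly_converges_def
proof (intro allI impI)
  fix g :: "real \<Rightarrow> real" assume g: "continuous_on UNIV g \<and> bounded (range g)"
  show "((\<lambda>t. \<integral>y. g y \<partial>Lw t) \<longlongrightarrow> (\<integral>y. g y \<partial>N)) at_top"
  proof (rule tendsto_at_topI_sequentially)
    fix T :: "nat \<Rightarrow> real" assume T: "filterlim T at_top sequentially"
    have ev: "\<forall>\<^sub>F n in sequentially. max 1 (T n) = T n"
      using filterlim_at_top[THEN iffD1, OF T, rule_format, of 1] by eventually_elim simp
    have "weakly_converges (\<lambda>n. Lw (max 1 (T n))) N sequentially"
    proof (subst weakly_converges_sequentially_iff[OF _ N])
      show "weak_conv_m (\<lambda>n. Lw (max 1 (T n))) N"
      proof (rule levy_continuity[OF _ N])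
        fix u
        have "(\<lambda>n. char (Lw (T n)) u) \<longlonglongrightarrow> char N u" by (rule filterlim_compose[OF char T])
        moreover have "\<forall>\<^sub>F n in sequentially. char (Lw (T n)) u = char (Lw (max 1 (T n))) u"
          using ev by eventually_elim simp
        ultimately show "(\<lambda>n. char (Lw (max 1 (T n))) u) \<longlonglongrightarrow> char N u" by (rule Lim_transform_eventually)
      qed (auto intro: L)
    qed (auto intro: L)
    then have "(\<lambda>n. \<integral>y. g y \<partial>Lw (max 1 (T n))) \<longlonglongrightarrow> (\<integral>y. g y \<partial>N)"
      using g unfolding weakly_converges_def by blast
    moreover have "\<forall>\<^sub>F n in sequentially. (\<integral>y. g y \<partial>Lw (max 1 (T n))) = (\<integral>y. g y \<partial>Lw (T n))"
      using ev by eventually_elim simp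
    ultimately show "(\<lambda>n. \<integral>y. g y \<partial>Lw (T n)) \<longlonglongrightarrow> (\<integral>y. g y \<partial>N)" by (rule Lim_transform_eventually)
  qed
qed

lemma integral_bind_complex:
  fixes h :: "'b \<Rightarrow> complex"
  assumes h[measurable]: "h \<in> borel_measurable N" and b: "\<And>x. norm (h x) \<le> B"
    and k: "k \<in> M \<rightarrow>\<^sub>M subprob_algebra N" and M: "finite_measure M"
  shows "(\<integral>\<omega>. h \<omega> \<partial>(M \<bind> k)) = (\<integral>x. (\<integral>\<omega>. h \<omega> \<partial>k x) \<partial>M)"
    and "integrable M (\<lambda>x. \<integral>\<omega>. h \<omega> \<partial>k x)"
proof -
  have sub: "subprob_space (k x)" "sets (k x) = sets N" if "x \<in> space M" for x
    using measurable_space[OF k that] by (auto simp: space_subprob_algebra)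
  have "AE x in M. emeasure (k x) (space (k x)) \<le> ennreal 1"
    using sub(1) by (intro AE_I2) (simp add: subprob_space.emeasure_space_le_1)
  note AE = this
  have re: "\<bar>Re (h x)\<bar> \<le> B" and im: "\<bar>Im (h x)\<bar> \<le> B" for x
    using b[of x] abs_Re_le_cmod[of "h x"] abs_Im_le_cmod[of "h x"] by linarith+
  have Rem: "(\<lambda>x. Re (h x)) \<in> borel_measurable N" and Imm: "(\<lambda>x. Im (h x)) \<in> borel_measurable N" by measurable
  note R = integrable_bind[OF Rem re k M AE] integral_bind[OF Rem re k M AE]
  note I = integrable_bind[OF Imm im k M AE] integral_bind[OF Imm im k M AE]
  have ih: "integrable (M \<bind> k) h"
  proof -
    have "integrable (M \<bind> k) (\<lambda>x. complex_of_real (Re (h x)) + \<i> * complex_of_real (Im (h x)))"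
      by (intro Bochner_Integration.integrable_add integrable_mult_right integrable_of_real R(1) I(1))
    then show ?thesis by (simp only: complex_eq[symmetric])
  qed
  have ik: "integrable (k x) h" if "x \<in> space M" for x
  proof -
    interpret subprob_space "k x" by (rule sub(1)[OF that])
    show ?thesis
      by (rule integrable_const_bound[of _ B]) (use b h in \<open>auto simp: measurable_cong_sets[OF sub(2)[OF that] refl]\<close>)
  qed
  have m: "(\<lambda>x. \<integral>\<omega>. h \<omega> \<partial>k x) \<in> borel_measurable M"
    by (rule measurable_compose[OF k integral_measurable_subprob_algebra]) measurable
  have B0: "0 \<le> B" using b[of undefined] by (meson norm_ge_zero order_trans)
  show iM: "integrable M (\<lambda>x. \<integral>\<omega>. h \<omega> \<partial>k x)"
  proof (rule finite_measure.integrable_const_bound[OF M _ m, of B], rule AE_I2)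
    fix x assume x: "x \<in> space M"
    interpret subprob_space "k x" by (rule sub(1)[OF x])
    have "norm (\<integral>\<omega>. h \<omega> \<partial>k x) \<le> (\<integral>\<omega>. B \<partial>k x)" by (rule norm_integral_le) (auto simp: b)
    also have "\<dots> \<le> B" using B0 subprob_measure_le_1 by (simp add: mult_left_le_one_le)
    finally show "norm (\<integral>\<omega>. h \<omega> \<partial>k x) \<le> B" .
  qed
  show "(\<integral>\<omega>. h \<omega> \<partial>(M \<bind> k)) = (\<integral>x. (\<integral>\<omega>. h \<omega> \<partial>k x) \<partial>M)"
  proof (rule complex_eqI)
    have "Re (\<integral>\<omega>. h \<omega> \<partial>(M \<bind> k)) = (\<integral>x. (\<integral>\<omega>. Re (h \<omega>) \<partial>k x) \<partial>M)"
      using R(2) ih by simp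
    also have "\<dots> = (\<integral>x. Re (\<integral>\<omega>. h \<omega> \<partial>k x) \<partial>M)"
      using ik by (intro Bochner_Integration.integral_cong) simp_all
    also have "\<dots> = Re (\<integral>x. (\<integral>\<omega>. h \<omega> \<partial>k x) \<partial>M)" using iM by simp
    finally show "Re (\<integral>\<omega>. h \<omega> \<partial>(M \<bind> k)) = Re (\<integral>x. (\<integral>\<omega>. h \<omega> \<partial>k x) \<partial>M)" .
    have "Im (\<integral>\<omega>. h \<omega> \<partial>(M \<bind> k)) = (\<integral>x. (\<integral>\<omega>. Im (h \<omega>) \<partial>k x) \<partial>M)"
      using I(2) ih by simp
    also have "\<dots> = (\<integral>x. Im (\<integral>\<omega>. h \<omega> \<partial>k x) \<partial>M)"
      using ik by (intro Bochner_Integration.integral_cong) simp_all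
    also have "\<dots> = Im (\<integral>x. (\<integral>\<omega>. h \<omega> \<partial>k x) \<partial>M)" using iM by simp
    finally show "Im (\<integral>\<omega>. h \<omega> \<partial>(M \<bind> k)) = Im (\<integral>x. (\<integral>\<omega>. h \<omega> \<partial>k x) \<partial>M)" .
  qed
qed

section \<open>The conditional central limit theorem\<close>

context centred_functional
begin

text \<open>
  The value at \<open>u\<close> of the characteristic function of \<open>A t / sqrt t\<close> on the event of survival, before
  division by the probability of that event.
\<close>

definition numerator :: "'a measure \<Rightarrow> real \<Rightarrow> real \<Rightarrow> complex" where
  "numerator \<mu> u t = (\<integral>\<omega>. indicator (survives t) \<omega> *\<^sub>R cis (u / sqrt t * A t \<omega>) \<partial>(\<mu> \<bind> P))"

lemma numerator_limit:
  assumes mu: "\<mu> \<in> space (prob_algebra (live S cem))" and psi: "(\<integral>\<^sup>+x. \<psi> x \<partial>\<mu>) < \<infinity>" and v: "0 \<le> half_variance"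
  shows "((\<lambda>t. exp (l * t) *\<^sub>R numerator \<mu> u t) \<longlongrightarrow> of_real (exp (- (u\<^sup>2 * half_variance)) * (\<integral>x. \<eta> x \<partial>\<mu>))) at_top"
proof -
  have smu: "sets \<mu> = sets (live S cem)" and pmu: "prob_space \<mu>" using mu by (auto simp: space_prob_algebra)
  interpret mu: prob_space \<mu> by (rule pmu)
  have spmu: "space \<mu> = E" using sets_eq_imp_space_eq[OF smu] by (simp add: space_live)
  have mm: "g \<in> borel_measurable \<mu>" if "g \<in> borel_measurable S" for g :: "'a \<Rightarrow> real"
    using borel_measurable_live_restrict[OF that] by (simp add: measurable_cong_sets[OF smu refl])
  have ipsi: "integrable \<mu> \<psi>"
  proof (rule integrableI_nonneg[OF mm[OF \<psi>_measurable] _ psi])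
    show "AE x in \<mu>. 0 \<le> \<psi> x" using \<psi>_ge_1 by (intro AE_I2) (force simp: spmu)
  qed
  have ieta: "integrable \<mu> \<eta>"
    by (rule Bochner_Integration.integrable_bound[OF integrable_mult_right[OF ipsi, of H] mm[OF \<eta>_measurable]])
       (use \<eta>_le \<eta>_nonneg in \<open>auto simp: spmu intro!: AE_I2 intro: order_trans[OF _ abs_ge_self]\<close>)
  have kmu: "P \<in> \<mu> \<rightarrow>\<^sub>M subprob_algebra \<Omega>" using kernel_live by (simp add: measurable_cong_sets[OF smu refl])
  have eq: "exp (l * t) *\<^sub>R numerator \<mu> u t = (\<integral>x. G (u / sqrt t) t (\<lambda>_. 1) x \<partial>\<mu>)"
    and iG: "integrable \<mu> (\<lambda>x. G (u / sqrt t) t (\<lambda>_. 1) x)" for t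
  proof -
    have [measurable]: "survives t \<in> sets \<Omega>" by (rule sets_survival)
    have hm: "(\<lambda>\<omega>. indicator (survives t) \<omega> *\<^sub>R cis (u / sqrt t * A t \<omega>)) \<in> borel_measurable \<Omega>" by measurable
    have hb: "norm (indicator (survives t) \<omega> *\<^sub>R cis (u / sqrt t * A t \<omega>)) \<le> 1" for \<omega> by (simp add: indicator_def)
    have "numerator \<mu> u t = (\<integral>x. phase_semigroup (u / sqrt t) t (\<lambda>_. 1) x \<partial>\<mu>)"
      "integrable \<mu> (\<lambda>x. phase_semigroup (u / sqrt t) t (\<lambda>_. 1) x)"
      unfolding numerator_def phase_semigroup_def killed_def
      using integral_bind_complex[OF hm hb kmu mu.finite_measure_axioms] by simp_all
    then show "exp (l * t) *\<^sub>R numerator \<mu> u t = (\<integral>x. G (u / sqrt t) t (\<lambda>_. 1) x \<partial>\<mu>)"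
      "integrable \<mu> (\<lambda>x. G (u / sqrt t) t (\<lambda>_. 1) x)"
      by (simp_all add: G_def)
  qed
  let ?l = "of_real (exp (- (u\<^sup>2 * half_variance)) * (\<integral>x. \<eta> x \<partial>\<mu>)) :: complex"
  have "((\<lambda>t. exp (l * t) *\<^sub>R numerator \<mu> u t - ?l) \<longlongrightarrow> 0) at_top"
  proof (rule Lim_null_comparison)
    show "((\<lambda>t. (\<integral>x. \<psi> x \<partial>\<mu>) * rate u t) \<longlongrightarrow> 0) at_top"
      using tendsto_mult[OF tendsto_const rate_tendsto_0] by simp
    show "\<forall>\<^sub>F t in at_top. norm (exp (l * t) *\<^sub>R numerator \<mu> u t - ?l) \<le> (\<integral>x. \<psi> x \<partial>\<mu>) * rate u t"
      using eventually_ge_at_top[of 1]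
    proof eventually_elim
      case (elim t)
      have "?l = (\<integral>x. complex_of_real (exp (- (u\<^sup>2 * half_variance)) * \<eta> x) \<partial>\<mu>)"
        using ieta by simp
      then have e: "exp (l * t) *\<^sub>R numerator \<mu> u t - ?l = (\<integral>x. G (u / sqrt t) t (\<lambda>_. 1) x - complex_of_real (exp (- (u\<^sup>2 * half_variance)) * \<eta> x) \<partial>\<mu>)"
        unfolding eq using iG ieta by (subst Bochner_Integration.integral_diff) (auto simp del: of_real_mult)
      have "norm (\<integral>x. G (u / sqrt t) t (\<lambda>_. 1) x - complex_of_real (exp (- (u\<^sup>2 * half_variance)) * \<eta> x) \<partial>\<mu>) \<le> (\<integral>x. \<psi> x * rate u t \<partial>\<mu>)"
        using G_one_limit[OF _ elim v, of _ u] ipsi by (intro norm_integral_le) (auto simp: spmu)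
      then show ?case unfolding e by simp
    qed
  qed
  then show ?thesis by (simp add: LIM_zero_iff)
qed

lemma numerator_0: "\<mu> \<in> space (prob_algebra (live S cem)) \<Longrightarrow> numerator \<mu> 0 t = measure (\<mu> \<bind> P) (survives t)"
  unfolding numerator_def
  using sets_bind_P[of \<mu>] prob_space_bind_P[of \<mu>, THEN prob_space.finite_measure] sets_survival[of t]
  by (simp add: sets_eq_imp_space_eq[OF sets_bind_P] scaleR_conv_of_real finite_measure.emeasure_eq_measure sets.Int_space_eq2)

text \<open>
  The characteristic function of the conditional law is the quotient of the numerators at \<open>u\<close> and at
  \<open>0\<close>; rescaled by \<open>exp (l t)\<close>, both converge, and the factor \<open>\<mu>(\<eta>)\<close> cancels.
\<close>

theorem conditional_CLT:
  assumes mu: "\<mu> \<in> space (prob_algebra (live S cem))" and psi: "(\<integral>\<^sup>+x. \<psi> x \<partial>\<mu>) < \<infinity>"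
    and eta_pos: "(\<integral>\<^sup>+x. \<eta> x \<partial>\<mu>) > 0" and v: "0 < half_variance"
    and f0: "\<And>y. y \<in> space S \<Longrightarrow> f0 y = f y + m" and m: "m = (\<integral>x. f0 x \<partial>beta_measure \<eta> \<alpha>)"
  shows "weakly_converges (conditional_fluctuation_law \<Omega> cem X P \<alpha> \<eta> f0 \<mu>)
    (density lborel (normal_density 0 (sqrt (2 * half_variance)))) at_top"
proof (rule weakly_converges_at_topI_char)
  let ?Pm = "\<mu> \<bind> P"
  note sb = sets_bind_P[OF mu]
  have spb: "space ?Pm = space \<Omega>" using sets_eq_imp_space_eq[OF sb] .
  note [measurable_cong] = sb
  interpret Pm: prob_space ?Pm by (rule prob_space_bind_P[OF mu])
  have sv[measurable]: "survives t \<in> sets \<Omega>" for t by (rule sets_survival)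
  let ?N = "density lborel (normal_density 0 (sqrt (2 * half_variance)))"
  have N: "prob_space ?N" by (rule prob_space_normal_density) (use v in simp)
  then show "real_distribution ?N"
    by (auto simp: real_distribution_def real_distribution_axioms_def)
  have eta0: "0 < (\<integral>x. \<eta> x \<partial>\<mu>)"
  proof -
    have smu: "sets \<mu> = sets (live S cem)" using mu by (auto simp: space_prob_algebra)
    have spmu: "space \<mu> = E" using sets_eq_imp_space_eq[OF smu] by (simp add: space_live)
    have em: "\<eta> \<in> borel_measurable \<mu>" using \<eta>_live by (simp add: measurable_cong_sets[OF smu refl])
    have AE: "AE x in \<mu>. 0 \<le> \<eta> x" using \<eta>_nonneg by (intro AE_I2) (simp add: spmu)
    have "(\<integral>\<^sup>+x. \<eta> x \<partial>\<mu>) \<le> (\<integral>\<^sup>+x. ennreal H * ennreal (\<psi> x) \<partial>\<mu>)"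
      using \<eta>_le H_nonneg by (intro nn_integral_mono) (simp add: spmu ennreal_mult''[symmetric] ennreal_leI flip: ennreal_mult')
    also have "\<dots> = ennreal H * (\<integral>\<^sup>+x. \<psi> x \<partial>\<mu>)"
      using psi_live by (intro nn_integral_cmult) (simp add: measurable_cong_sets[OF smu refl])
    also have "\<dots> < \<infinity>" using psi by (simp add: ennreal_mult_less_top)
    finally show ?thesis
      using integral_eq_nn_integral[OF em AE] eta_pos by (simp add: enn2real_positive_iff)
  qed
  \<comment> \<open>The rescaled survival probability has the positive limit \<open>\<mu>(\<eta>)\<close>, and survival is antitone in time.\<close>
  have surv: "0 < measure ?Pm (survives t)" for t
  proof -
    have "((\<lambda>t. exp (l * t) *\<^sub>R numerator \<mu> 0 t) \<longlongrightarrow> of_real (\<integral>x. \<eta> x \<partial>\<mu>)) at_top"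
      using numerator_limit[OF mu psi, of 0] v by simp
    then have "((\<lambda>t. Re (exp (l * t) *\<^sub>R numerator \<mu> 0 t)) \<longlongrightarrow> Re (of_real (\<integral>x. \<eta> x \<partial>\<mu>))) at_top" by (rule tendsto_Re)
    then have "((\<lambda>t. exp (l * t) * measure ?Pm (survives t)) \<longlongrightarrow> (\<integral>x. \<eta> x \<partial>\<mu>)) at_top" by (simp add: numerator_0[OF mu])
    from order_tendstoD(1)[OF this eta0] eventually_ge_at_top[of t]
    have "\<forall>\<^sub>F r in at_top. 0 < measure ?Pm (survives r) \<and> t \<le> r"
      by eventually_elim (simp add: zero_less_mult_iff)
    then obtain r where r: "0 < measure ?Pm (survives r)" "t \<le> r"
      using eventually_happens[of _ "at_top :: real filter"] by fastforce
    have "measure ?Pm (survives r) \<le> measure ?Pm (survives t)"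
      using survives_antimono[OF r(2)] by (intro Pm.finite_measure_mono) (auto simp: sb sv)
    with r show ?thesis by simp
  qed
  have fluct: "sqrt t * (1 / t * (LINT s:{0..t}|lborel. f0 (X s \<omega>)) - m) = A t \<omega> / sqrt t" if t: "1 \<le> t" and w: "\<omega> \<in> space \<Omega>" for t \<omega>
  proof -
    have i: "set_integrable lborel {0..t} (\<lambda>s. f (X (max 0 s) \<omega>))"
      by (rule set_integrable_bounded_interval[where B=B])
         (use f_bounded measurable_compose[OF path_measurable[OF w] f_measurable] in auto)
    have ic: "set_integrable lborel {0..t} (\<lambda>s. m)" by (rule set_integrable_bounded_interval) auto
    have "(LINT s:{0..t}|lborel. f0 (X s \<omega>)) = (LINT s:{0..t}|lborel. f (X (max 0 s) \<omega>) + m)"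
      using w by (intro set_lebesgue_integral_cong) (auto simp: f0 X_in_space max_def)
    also have "\<dots> = A t \<omega> + m * t"
      unfolding A_def set_integral_add(2)[OF i ic] using t by (simp add: set_lebesgue_integral_def)
    finally have "sqrt t * (1 / t * (LINT s:{0..t}|lborel. f0 (X s \<omega>)) - m) = sqrt t * (A t \<omega> / t)"
      using t by (simp add: field_simps)
    also have "\<dots> = A t \<omega> / sqrt t" using t by (simp add: real_div_sqrt field_simps flip: power2_eq_square)
    finally show ?thesis .
  qed
  define U where "U t = uniform_measure ?Pm (survives t)" for t
  have setsU[measurable_cong]: "sets (U t) = sets \<Omega>" for t by (simp add: U_def sb)
  have spU: "space (U t) = space \<Omega>" for t by (simp add: U_def spb)
  have probU: "prob_space (U t)" for t
    unfolding U_def using surv[of t] by (intro prob_space_uniform_measure) (auto simp: Pm.emeasure_eq_measure)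
  have law: "conditional_fluctuation_law \<Omega> cem X P \<alpha> \<eta> f0 \<mu> t = distr (U t) borel (\<lambda>\<omega>. A t \<omega> / sqrt t)" if "1 \<le> t" for t
    unfolding conditional_fluctuation_law_def U_def[symmetric] m[symmetric]
    by (rule distr_cong) (use fluct[OF that] in \<open>auto simp: spU\<close>)
  show "real_distribution (conditional_fluctuation_law \<Omega> cem X P \<alpha> \<eta> f0 \<mu> t)" if t: "1 \<le> t" for t
    unfolding law[OF t] real_distribution_def real_distribution_axioms_def
    by (auto intro!: prob_space.prob_space_distr[OF probU])
  fix u
  have cf: "char (conditional_fluctuation_law \<Omega> cem X P \<alpha> \<eta> f0 \<mu> t) u = (exp (l * t) *\<^sub>R numerator \<mu> u t) / (exp (l * t) *\<^sub>R numerator \<mu> 0 t)" if t: "1 \<le> t" for t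
  proof -
    have "char (conditional_fluctuation_law \<Omega> cem X P \<alpha> \<eta> f0 \<mu> t) u = (\<integral>\<omega>. cis (u / sqrt t * A t \<omega>) \<partial>U t)"
      unfolding law[OF t] char_def by (subst integral_distr) (auto simp: cis_conv_exp)
    also have "\<dots> = (\<integral>\<omega>. cis (u / sqrt t * A t \<omega>) \<partial>density ?Pm (\<lambda>\<omega>. ennreal (indicator (survives t) \<omega> / measure ?Pm (survives t))))"
    proof (rule arg_cong[where f="\<lambda>M. integral\<^sup>L M _"])
      show "U t = density ?Pm (\<lambda>\<omega>. ennreal (indicator (survives t) \<omega> / measure ?Pm (survives t)))"
        unfolding U_def uniform_measure_def using surv[of t]
        by (intro density_cong) (auto simp: Pm.emeasure_eq_measure divide_ennreal[symmetric] ennreal_indicator)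
    qed
    also have "\<dots> = (\<integral>\<omega>. (indicator (survives t) \<omega> / measure ?Pm (survives t)) *\<^sub>R cis (u / sqrt t * A t \<omega>) \<partial>?Pm)"
      by (rule integral_density) auto
    also have "\<dots> = (\<integral>\<omega>. (1 / measure ?Pm (survives t)) *\<^sub>R (indicator (survives t) \<omega> *\<^sub>R cis (u / sqrt t * A t \<omega>)) \<partial>?Pm)"
      by simp
    also have "\<dots> = (1 / measure ?Pm (survives t)) *\<^sub>R numerator \<mu> u t"
      unfolding numerator_def by (rule integral_scaleR_right)
    finally show ?thesis by (simp add: numerator_0[OF mu] scaleR_conv_of_real)
  qed
  have "((\<lambda>t. (exp (l * t) *\<^sub>R numerator \<mu> u t) / (exp (l * t) *\<^sub>R numerator \<mu> 0 t)) \<longlongrightarrow>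
      of_real (exp (- (u\<^sup>2 * half_variance)) * (\<integral>x. \<eta> x \<partial>\<mu>)) / of_real (exp (- (0\<^sup>2 * half_variance)) * (\<integral>x. \<eta> x \<partial>\<mu>))) at_top"
    using v eta0 by (intro tendsto_divide numerator_limit[OF mu psi]) auto
  moreover have "of_real (exp (- (u\<^sup>2 * half_variance)) * (\<integral>x. \<eta> x \<partial>\<mu>)) / of_real (exp (- (0\<^sup>2 * half_variance)) * (\<integral>x. \<eta> x \<partial>\<mu>))
      = char ?N u"
    using v eta0 by (subst char_normal_density) auto
  ultimately have "((\<lambda>t. (exp (l * t) *\<^sub>R numerator \<mu> u t) / (exp (l * t) *\<^sub>R numerator \<mu> 0 t)) \<longlongrightarrow> char ?N u) at_top" by simp
  moreover have "\<forall>\<^sub>F t in at_top. (exp (l * t) *\<^sub>R numerator \<mu> u t) / (exp (l * t) *\<^sub>R numerator \<mu> 0 t) = char (conditional_fluctuation_law \<Omega> cem X P \<alpha> \<eta> f0 \<mu> t) u"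
    using eventually_ge_at_top[of 1] by eventually_elim (simp add: cf)
  ultimately show "((\<lambda>t. char (conditional_fluctuation_law \<Omega> cem X P \<alpha> \<eta> f0 \<mu> t) u) \<longlongrightarrow> char ?N u) at_top"
    by (rule Lim_transform_eventually)
qed

end

theorem theorem1:
  fixes \<Omega> :: "'w measure" and S :: "'a measure" and cem :: 'a
    and X :: "real \<Rightarrow> 'w \<Rightarrow> 'a" and P :: "'a \<Rightarrow> 'w measure"
    and \<alpha> \<mu> :: "'a measure" and \<eta> \<psi>\<^sub>1 f :: "'a \<Rightarrow> real"
    and lam\<^sub>0 C \<gamma> :: real
  assumes process: "absorbed_markov_process \<Omega> S cem X P"
    and qsd: "quasi_stationary S cem X P \<alpha>"
    and rate_eq: "lam\<^sub>0 = absorption_rate \<Omega> cem X P \<alpha>"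
    and eta: "right_eigenfunction \<Omega> S cem X P \<alpha> lam\<^sub>0 \<eta>"
    and psi_measurable: "\<psi>\<^sub>1 \<in> borel_measurable (live S cem)"
    and psi_ge_1: "\<forall>x\<in>space (live S cem). 1 \<le> \<psi>\<^sub>1 x"
    and alpha_psi: "(\<integral>\<^sup>+x. \<psi>\<^sub>1 x \<partial>\<alpha>) < \<infinity>"
    and eta_psi: "\<eta> \<in> Linf (live S cem) \<psi>\<^sub>1"
    and constants: "C > 0" "\<gamma> > 0"
    and convergence:
      "\<forall>\<nu>\<in>space (prob_algebra (live S cem)). \<forall>t\<ge>0.
         weighted_dist (live S cem) \<psi>\<^sub>1
           (scale_measure (ennreal (exp (lam\<^sub>0 * t))) (killed_law \<Omega> S cem X P \<nu> t))
           (scale_measure (\<integral>\<^sup>+x. \<eta> x \<partial>\<nu>) \<alpha>)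
         \<le> ennreal C * (\<integral>\<^sup>+x. \<psi>\<^sub>1 x \<partial>\<nu>) * ennreal (exp (- \<gamma> * t))"
    and f: "f \<in> borel_measurable (live S cem)" "bounded (f ` space (live S cem))"
    and variance_pos: "asymptotic_variance \<Omega> S cem X P \<alpha> \<eta> f > 0"
    and mu: "\<mu> \<in> space (prob_algebra (live S cem))"
      "(\<integral>\<^sup>+x. \<psi>\<^sub>1 x \<partial>\<mu>) < \<infinity>" "(\<integral>\<^sup>+x. \<eta> x \<partial>\<mu>) > 0"
  shows "weakly_converges
    (conditional_fluctuation_law \<Omega> cem X P \<alpha> \<eta> f \<mu>)
    (density lborel (normal_density 0 (sqrt (asymptotic_variance \<Omega> S cem X P \<alpha> \<eta> f))))
    at_top"
proof -
  interpret Q: exponentially_quasi_ergodic \<Omega> S cem X P \<alpha> \<eta> \<psi>\<^sub>1 lam\<^sub>0 C \<gamma>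
    using process qsd eta psi_measurable psi_ge_1 alpha_psi eta_psi constants convergence
    by (intro exponentially_quasi_ergodic.intro exponentially_quasi_ergodic_axioms.intro)
  define m where "m = (\<integral>x. f x \<partial>beta_measure \<eta> \<alpha>)"
  obtain b where b: "\<And>y. y \<in> space S - {cem} \<Longrightarrow> \<bar>f y\<bar> \<le> b"
    using f(2) by (auto simp: bounded_iff space_live)
  \<comment> \<open>Centred, and bounded on the whole type; \<open>B\<close> also covers the value of \<open>f\<close> at the cemetery.\<close>
  define g where "g y = (if y \<in> space S then f y - m else 0)" for y
  define B where "B = \<bar>b\<bar> + \<bar>f cem\<bar> + \<bar>m\<bar>"
  have fS: "f \<in> borel_measurable S" by (rule borel_measurable_live_extend[OF f(1) Q.cem_measurable])
  have gS: "g \<in> borel_measurable S"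
  proof -
    have "(\<lambda>y. f y - m) \<in> borel_measurable S" using fS by measurable
    then show ?thesis by (rule measurable_cong[THEN iffD1, rotated]) (simp add: g_def)
  qed
  have gB: "\<bar>g y\<bar> \<le> B" for y
    using b[of y] by (cases "y = cem") (auto simp: g_def B_def)
  have m_eq: "m = (\<integral>y. f y * \<eta> y \<partial>\<alpha>)"
  proof -
    have "m = (\<integral>y. \<eta> y *\<^sub>R f y \<partial>\<alpha>)"
      unfolding m_def beta_measure_def using Q.\<eta>_nonneg
      by (intro integral_density Q.\<alpha>_measurableI fS Q.\<eta>_measurable AE_I2) (auto simp: Q.space_\<alpha>)
    then show ?thesis by (simp add: mult.commute)
  qed
  have centred: "(\<integral>y. g y * \<eta> y \<partial>\<alpha>) = 0"
  proof -
    have "Q.dominated (\<bar>b\<bar> * Q.H) (\<lambda>y. f y * \<eta> y)"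
      using Q.\<eta>_le Q.\<eta>_nonneg Q.H_nonneg fS b unfolding Q.dominated_def
      by (auto simp: abs_mult mult.assoc intro!: mult_mono intro: order_trans[OF _ abs_ge_self])
    note i = Q.integrable_\<alpha>[OF this] Q.integrable_\<alpha>[OF Q.dominated_\<eta>]
    have "(\<integral>y. g y * \<eta> y \<partial>\<alpha>) = (\<integral>y. f y * \<eta> y - m * \<eta> y \<partial>\<alpha>)"
      by (intro Bochner_Integration.integral_cong) (auto simp: Q.space_\<alpha> g_def left_diff_distrib)
    also have "\<dots> = 0" using i by (simp add: Q.\<alpha>_\<eta> flip: m_eq)
    finally show ?thesis .
  qed
  interpret F: centred_functional \<Omega> S cem X P \<alpha> \<eta> \<psi>\<^sub>1 g lam\<^sub>0 C \<gamma> B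
    using gS gB centred
    by (intro centred_functional.intro centred_functional_axioms.intro bounded_functional.intro
        bounded_functional_axioms.intro Q.exponentially_quasi_ergodic_axioms process)
  have fg: "f y = g y + m" if "y \<in> space S" for y using that by (simp add: g_def)
  have var: "asymptotic_variance \<Omega> S cem X P \<alpha> \<eta> f = 2 * F.half_variance"
    by (rule F.asymptotic_variance_eq[OF fg])
  have "0 < F.half_variance" using variance_pos var by simp
  from F.conditional_CLT[OF mu this fg m_def] show ?thesis unfolding var .
qed

end
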